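(* Let $(E,\mathcal{E},m)$ be a $\sigma$-finite measure space. Let $r:E\to(0,\infty)$ be measurable and such that $\hat m(dx)=\frac{1}{r(x)}m(dx)$ is a probability measure. Let $\alpha:\mathbb{R}\to[c,d]\subset(0,2)$ be a $C^1$ function and let $b:\mathbb{R}\to\mathbb{R}$ be a $C^1$ function. Let $f(t,u,\cdot)$, $(t,u)\in\mathbb{R}^2$, be a family of functions such that $f(t,u,\cdot)\in\mathcal{F}_{\alpha(u)}(E,\mathcal{E},m)$ for all $(t,u)\in\mathbb{R}^2$. Let $(\Gamma_i)_{i\ge1}$ be the sequence of arrival times of a Poisson process with unit rate, let $(V_i)_{i\ge1}$ be a sequence of i.i.d. random variables with distribution $\hat m$ on $E$, and let $(\gamma_i)_{i\ge1}$ be a sequence of i.i.d. random variables with $P(\gamma_i=1)=P(\gamma_i=-1)=1/2$. Assume that the three sequences $(\Gamma_i)_{i\ge1}$, $(V_i)_{i\ge1}$, $(\gamma_i)_{i\ge1}$ are independent. Consider the random field $$X(t,u)=b(u)\,C_{\alpha(u)}^{1/\alpha(u)}\sum_{i=1}^{\infty}\gamma_i\,\Gamma_i^{-1/\alpha(u)}\,r(V_i)^{1/\alpha(u)}f(t,u,V_i),\qquad C_\alpha=\left(\int_0^\infty x^{-\alpha}\sin(x)\,dx\right)^{-1}.$$ Fix $u\in\mathbb{R}$ and assume that $t\mapsto X(t,u)$ is localisable at $u$ with exponent $h\in(0,1)$ and local form $X'_u(\cdot,u)$. Assume in addition that: (Cs1) the function $v\mapsto f(t,v,x)$ is differentiable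 for all $(v,t)$ in a neighbourhood of $(u,u)$ and almost all $x\in E$ (that is, for each $t$ near $u$ and almost every $x$, it is differentiable at every $v$ in a neighbourhood of $u$, the neighbourhoods not depending on $x$); its derivative with respect to $v$ is denoted $f'_v$; (Cs2) there exists $\varepsilon>0$ such that $\displaystyle\sup_{t\in B(u,\varepsilon)}\int_E\sup_{w\in B(u,\varepsilon)}|f(t,w,x)|^{\alpha(w)}\,m(dx)<\infty$; (Cs3) there exists $\varepsilon>0$ such that $\displaystyle\sup_{t\in B(u,\varepsilon)}\int_E\sup_{w\in B(u,\varepsilon)}|f'_v(t,w,x)|^{\alpha(w)}\,m(dx)<\infty$; (Cs4) there exists $\varepsilon>0$ such that $\displaystyle\sup_{t\in B(u,\varepsilon)}\int_E\sup_{w\in B(u,\varepsilon)}\big|f(t,w,x)\log|f(t,w,x)|\big|^{\alpha(w)}\,m(dx)<\infty$; (Cs5) there exists $\varepsilon>0$ such that $\displaystyle\sup_{t\in B(u,\varepsilon)}\int_E\sup_{w\in B(u,\varepsilon)}\big|f(t,w,x)\log(r(x))\big|^{\alpha(w)}\,m(dx)<\infty$. Then the process $Y(t):=X(t,t)$ is localisable at $u$ with exponent $h$ and local form $Y'_u(t)=X'_u(t,u)$.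
   Context: $B(u,\varepsilon)$ is the open interval $(u-\varepsilon,u+\varepsilon)$. $\mathcal{F}_{\alpha}(E,\mathcal{E},m)$ is the set of measurable $f:E\to\mathbb{R}$ with $\int_E|f|^\alpha\,dm<\infty$. The convention $0\log 0=0$ is used. $f'_v(t,w,x)$ denotes the derivative of $f$ with respect to its second argument, evaluated at $(t,w,x)$. Localisability: a process $Y=\{Y(t)\}$ is $h$-localisable at $u$ (localisable at $u$ with exponent $h$) if there is a non-trivial process $Y'_u=\{Y'_u(t):t\in\mathbb{R}\}$, called the local form of $Y$ at $u$, such that $$\frac{Y(u+rt)-Y(u)}{r^h}\longrightarrow Y'_u(t)\quad\text{as } r\to0^+$$ in the sense of convergence of finite-dimensional distributions (as processes in $t$). Local forms are identified up to equality of finite-dimensional distributions. *)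

theory Defs
  imports "HOL-Probability.Probability"
begin

definition real_process :: "'a measure \<Rightarrow> (real \<Rightarrow> 'a \<Rightarrow> real) \<Rightarrow> bool" where
  "real_process M Y \<longleftrightarrow> prob_space M \<and> (\<forall>t. Y t \<in> borel_measurable M)"

text \<open>
  Convergence in distribution of random elements of a topological space. The limit may live
  on a different probability space.
\<close>

definition conv_in_distribution ::
  "'a measure \<Rightarrow> ('i \<Rightarrow> 'a \<Rightarrow> 'c::topological_space) \<Rightarrow> 'b measure \<Rightarrow> ('b \<Rightarrow> 'c) \<Rightarrow> 'i filter \<Rightarrow> bool"
where
  "conv_in_distribution M Z N Z' F \<longleftrightarrow>
     (\<forall>g :: 'c \<Rightarrow> real. continuous_on UNIV g \<and> bounded (range g) \<longrightarrow>
        ((\<lambda>i. \<integral>\<omega>. g (Z i \<omega>) \<partial>M) \<longlongrightarrow> (\<integral>\<omega>. g (Z' \<omega>) \<partial>N)) F)"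

text \<open>
  The random vector \<open>(Y (s 0), ..., Y (s (n - 1)))\<close>. Since \<open>n\<close> varies, \<open>\<real>\<^sup>n\<close> is realised as
  the closed subspace of the sequences vanishing from index \<open>n\<close> on, inside \<open>nat \<Rightarrow> real\<close> with
  its product topology. Every continuous function on this subspace extends to the whole space
  with the same range (compose with truncation), so that convergence in distribution is the
  usual one for random vectors.
\<close>

definition fd_vector :: "(real \<Rightarrow> 'a \<Rightarrow> real) \<Rightarrow> nat \<Rightarrow> (nat \<Rightarrow> real) \<Rightarrow> 'a \<Rightarrow> (nat \<Rightarrow> real)" where
  "fd_vector Y n s \<omega> = (\<lambda>i. if i < n then Y (s i) \<omega> else 0)"

definition fdd_converges ::
  "'a measure \<Rightarrow> ('i \<Rightarrow> real \<Rightarrow> 'a \<Rightarrow> real) \<Rightarrow> 'b measure \<Rightarrow> (real \<Rightarrow> 'b \<Rightarrow> real) \<Rightarrow> 'i filter \<Rightarrow> bool"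
where
  "fdd_converges M Z N Z' F \<longleftrightarrow>
     (\<forall>n s. conv_in_distribution M (\<lambda>i. fd_vector (Z i) n s) N (fd_vector Z' n s) F)"

text \<open>
  \<open>localisable_with M Y u h N Y'\<close>: the process \<open>Y\<close> on \<open>M\<close> is \<open>h\<close>-localisable at \<open>u\<close> with local
  form \<open>Y'\<close>, a process on \<open>N\<close>. Only the finite-dimensional distributions of \<open>Y'\<close> matter.
\<close>

definition localisable_with ::
  "'a measure \<Rightarrow> (real \<Rightarrow> 'a \<Rightarrow> real) \<Rightarrow> real \<Rightarrow> real \<Rightarrow> 'b measure \<Rightarrow> (real \<Rightarrow> 'b \<Rightarrow> real) \<Rightarrow> bool"
where
  "localisable_with M Y u h N Y' \<longleftrightarrow>
     real_process M Y \<and> real_process N Y' \<and>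
     (\<exists>t. \<not> (AE \<omega> in N. Y' t \<omega> = 0)) \<and>
     fdd_converges M (\<lambda>\<rho> t \<omega>. (Y (u + \<rho> * t) \<omega> - Y u \<omega>) / \<rho> powr h) N Y' (at_right 0)"

definition F_space :: "real \<Rightarrow> 'e measure \<Rightarrow> ('e \<Rightarrow> real) set" where
  "F_space a m = {g \<in> borel_measurable m. (\<integral>\<^sup>+x. ennreal (\<bar>g x\<bar> powr a) \<partial>m) < \<infinity>}"

text \<open>
  For \<open>a \<le> 1\<close> the integral converges only conditionally. The gauge integral over an unbounded
  interval includes such improper integrals, the Lebesgue integral does not.
\<close>

definition C_const :: "real \<Rightarrow> real" where
  "C_const a = inverse (integral {0<..} (\<lambda>x. x powr (- a) * sin x))"

text \<open>
  Sequences indexed by \<open>i \<ge> 1\<close> are shifted to start at \<open>0\<close>: \<open>\<Gamma> i\<close> is the arrival time number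
  \<open>i + 1\<close>. A unit rate Poisson process is one whose inter-arrival times are i.i.d.
  exponential with parameter \<open>1\<close>.
\<close>

definition poisson_arrival_times :: "'a measure \<Rightarrow> (nat \<Rightarrow> 'a \<Rightarrow> real) \<Rightarrow> bool" where
  "poisson_arrival_times M \<Gamma> \<longleftrightarrow>
     (let T = (\<lambda>i \<omega>. \<Gamma> i \<omega> - (if i = 0 then 0 else \<Gamma> (i - 1) \<omega>)) in
        prob_space.indep_vars M (\<lambda>_. borel) T UNIV \<and>
        (\<forall>i. distributed M lborel (T i) (\<lambda>x. ennreal (exponential_density 1 x))))"

definition iid_with_law :: "'a measure \<Rightarrow> 'e measure \<Rightarrow> (nat \<Rightarrow> 'a \<Rightarrow> 'e) \<Rightarrow> bool" where
  "iid_with_law M P V \<longleftrightarrow>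
     prob_space.indep_vars M (\<lambda>_. P) V UNIV \<and> (\<forall>i. distr M P (V i) = P)"

definition iid_signs :: "'a measure \<Rightarrow> (nat \<Rightarrow> 'a \<Rightarrow> real) \<Rightarrow> bool" where
  "iid_signs M \<gamma> \<longleftrightarrow>
     prob_space.indep_vars M (\<lambda>_. borel) \<gamma> UNIV \<and>
     (\<forall>i. measure M {\<omega> \<in> space M. \<gamma> i \<omega> = 1} = 1 / 2 \<and>
          measure M {\<omega> \<in> space M. \<gamma> i \<omega> = -1} = 1 / 2)"

definition sequence_events :: "'a measure \<Rightarrow> 'e measure \<Rightarrow> (nat \<Rightarrow> 'a \<Rightarrow> 'e) \<Rightarrow> 'a set set" where
  "sequence_events M K S =
     {(\<lambda>\<omega> i. S i \<omega>) -` A \<inter> space M | A. A \<in> sets (\<Pi>\<^sub>M i\<in>UNIV. K)}"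

text \<open>Mutual independence of three sequences, each regarded as one random element.\<close>

definition independent_sequences ::
  "'a measure \<Rightarrow> 'b measure \<Rightarrow> (nat \<Rightarrow> 'a \<Rightarrow> 'b) \<Rightarrow> 'c measure \<Rightarrow> (nat \<Rightarrow> 'a \<Rightarrow> 'c) \<Rightarrow>
   'd measure \<Rightarrow> (nat \<Rightarrow> 'a \<Rightarrow> 'd) \<Rightarrow> bool"
where
  "independent_sequences M K R L S P T \<longleftrightarrow>
     prob_space.indep_sets M
       (\<lambda>k. [sequence_events M K R, sequence_events M L S, sequence_events M P T] ! k) {..<3}"

definition series_field ::
  "(real \<Rightarrow> real) \<Rightarrow> (real \<Rightarrow> real) \<Rightarrow> ('e \<Rightarrow> real) \<Rightarrow> (real \<Rightarrow> real \<Rightarrow> 'e \<Rightarrow> real) \<Rightarrow>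
   (nat \<Rightarrow> 'a \<Rightarrow> real) \<Rightarrow> (nat \<Rightarrow> 'a \<Rightarrow> real) \<Rightarrow> (nat \<Rightarrow> 'a \<Rightarrow> 'e) \<Rightarrow> real \<Rightarrow> real \<Rightarrow> 'a \<Rightarrow> real"
where
  "series_field b \<alpha> r f \<gamma> \<Gamma> V t v \<omega> =
     b v * C_const (\<alpha> v) powr (1 / \<alpha> v) *
     (\<Sum>i. \<gamma> i \<omega> * \<Gamma> i \<omega> powr (- 1 / \<alpha> v) * r (V i \<omega>) powr (1 / \<alpha> v) * f t v (V i \<omega>))"

text \<open>
  All suprema and integrals take values in \<open>[0, \<infinity>]\<close>. The condition is monotone: if it holds for
  some \<open>\<epsilon>\<close>, it holds for every smaller one. It may therefore be used for functions \<open>g\<close> that are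
  meaningful only near \<open>u\<close>, such as a derivative.
\<close>

definition locally_sup_integrable ::
  "'e measure \<Rightarrow> (real \<Rightarrow> real) \<Rightarrow> real \<Rightarrow> (real \<Rightarrow> real \<Rightarrow> 'e \<Rightarrow> real) \<Rightarrow> bool"
where
  "locally_sup_integrable m \<alpha> u g \<longleftrightarrow>
     (\<exists>\<epsilon>>0. (SUP t\<in>ball u \<epsilon>. \<integral>\<^sup>+x. (SUP w\<in>ball u \<epsilon>. ennreal (\<bar>g t w x\<bar> powr \<alpha> w)) \<partial>m) < \<infinity>)"

end

theory Submission imports Defs begin

text \<open>
  With \<open>B v = b v * C_const (\<alpha> v) powr (1 / \<alpha> v)\<close> the field is \<open>X t v = B v * S t v\<close>, where
  \<open>S t v\<close> is the bare series. The increments of \<open>t \<mapsto> X t t\<close> at \<open>u\<close> differ from those of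
  \<open>t \<mapsto> X t u\<close> by
  \<open>X t t - X t u = B t * (S t t - S t u) + (B t - B u) * S t u\<close>,
  which turns out to be of order \<open>\<bar>t - u\<bar>\<close> in probability. Since \<open>h < 1\<close>, it disappears after division
  by \<open>\<rho> powr h\<close>, and a perturbation that tends to zero in probability does not change a limit in
  distribution (\<open>fdd_converges_perturb\<close>).

  The tool for both summands is a tail bound for series \<open>\<Sum>i. \<gamma> i * g (\<Gamma> i, V i)\<close>. Conditionally on the
  points \<open>(\<Gamma> i, V i)\<close>, this is a series with independent signs and constant coefficients, to which
  Kolmogorov's maximal inequality applies: it converges if the coefficients are square summable, and
  it exceeds \<open>l\<close> with probability at most \<open>\<Sum>i. min 1 ((g (\<Gamma> i, V i) / l)\<^sup>2)\<close>. Taking the mean over the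
  points, Campbell's formula (\<open>campbell_marked_poisson\<close>, which amounts to the fact that the Erlang
  densities add up to one) turns this sum into an integral (\<open>lepage_series\<close>). With the substitution
  \<open>y / r x\<close> for the arrival time, the weight \<open>1 / r\<close> in the law of the marks cancels, and if
  \<open>\<bar>g (y, x)\<bar>\<close> is at most \<open>K\<close> times a sum of powers of \<open>W x / (y / r x)\<close> with exponents above one half,
  the integral is at most a constant times \<open>\<integral>W dm\<close>, where the constant tends to zero with \<open>K / l\<close>
  (\<open>lepage_series_dominated\<close>). Exponents above one half exist because \<open>\<alpha> \<le> d < 2\<close>.

  For \<open>S t t - S t u\<close> the bound on \<open>g\<close> is the mean value theorem for
  \<open>v \<mapsto> y powr (-1 / \<alpha> v) * f t v x\<close> (\<open>power_kernel_increment_le\<close>). The derivative brings in \<open>f'\<close> and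
  \<open>f * ln y\<close>; in terms of the jump size \<open>z = y powr (-1 / \<alpha>) * \<bar>f\<bar>\<close> one has
  \<open>ln y = \<alpha> * (ln \<bar>f\<bar> - ln z)\<close>, so that \<open>z * ln y\<close> is controlled by \<open>f * ln \<bar>f\<bar>\<close> and by \<open>z * ln z\<close>, and the
  last logarithm costs only an arbitrarily small change of the exponent. It is essential that all
  exponents are taken at the same intermediate point \<open>w\<close>: the suprema of \<open>\<bar>f\<bar> powr \<alpha> w\<close>,
  \<open>\<bar>f'\<bar> powr \<alpha> w\<close> and \<open>\<bar>f * ln \<bar>f\<bar>\<bar> powr \<alpha> w\<close> then supply \<open>W\<close>.

  Finally \<open>B\<close> is Lipschitz at \<open>u\<close>. Integration by parts gives
  \<open>\<integral> x powr (-a) * sin x dx = a * \<integral> x powr (-a - 1) * (1 - cos x) dx\<close>, and the right-hand integral converges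
  absolutely, is positive, and is locally Lipschitz in \<open>a\<close> (\<open>lipschitz_at_normalisation\<close>).
\<close>

section \<open>Series with random signs\<close>

text \<open>
  The partial sums of \<open>a i * g i\<close>, frozen as soon as their modulus reaches \<open>l\<close>. The stopped sum at time \<open>n\<close>
  depends on \<open>g 0, \<dots>, g (n - 1)\<close> only, which makes it independent of the sign number \<open>n\<close>.
\<close>

primrec stopped_sum :: "real \<Rightarrow> (nat \<Rightarrow> real) \<Rightarrow> nat \<Rightarrow> (nat \<Rightarrow> real) \<Rightarrow> real" where
  "stopped_sum l a 0 g = 0"
| "stopped_sum l a (Suc n) g =
     stopped_sum l a n g + (if l \<le> \<bar>stopped_sum l a n g\<bar> then 0 else a n) * g n"

lemma stopped_sum_restrict: "stopped_sum l a n (restrict g {..<n}) = stopped_sum l a n g"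
proof -
  have "n \<le> k \<Longrightarrow> stopped_sum l a n (restrict g {..<k}) = stopped_sum l a n g" for k
    by (induction n) auto
  then show ?thesis by simp
qed

lemma measurable_stopped_sum:
  "{..<n} \<subseteq> J \<Longrightarrow> stopped_sum l a n \<in> borel_measurable (Pi\<^sub>M J (\<lambda>_. borel))"
proof (induction n)
  case (Suc n)
  then have "{..<n} \<subseteq> J" "n \<in> J" by auto
  then have [measurable]: "stopped_sum l a n \<in> borel_measurable (Pi\<^sub>M J (\<lambda>_. borel))"
    and [measurable]: "(\<lambda>g. g n) \<in> borel_measurable (Pi\<^sub>M J (\<lambda>_. borel))"
    using Suc.IH by (auto intro!: measurable_component_singleton)
  show ?case by simp
next
  case 0
  have "stopped_sum l a 0 = (\<lambda>_. 0)" by (simp add: fun_eq_iff)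
  then show ?case by simp
qed

lemma stopped_sum_eq:
  assumes "\<And>k. k < n \<Longrightarrow> \<bar>\<Sum>i<k. a i * g i\<bar> < l"
  shows "stopped_sum l a n g = (\<Sum>i<n. a i * g i)"
  using assms
proof (induction n)
  case (Suc n)
  have "stopped_sum l a n g = (\<Sum>i<n. a i * g i)" by (rule Suc.IH) (use Suc.prems in auto)
  then show ?case using Suc.prems[of n] by simp
qed simp

lemma stopped_sum_stays: "l \<le> \<bar>stopped_sum l a n g\<bar> \<Longrightarrow> n \<le> m \<Longrightarrow> stopped_sum l a m g = stopped_sum l a n g"
  by (induction m) (auto simp: le_Suc_eq)

lemma stopped_sum_ge:
  assumes "k \<le> n" "l \<le> \<bar>\<Sum>i<k. a i * g i\<bar>"
  shows "l \<le> \<bar>stopped_sum l a n g\<bar>"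
proof -
  define j where "j = (LEAST k. l \<le> \<bar>\<Sum>i<k. a i * g i\<bar>)"
  have j: "l \<le> \<bar>\<Sum>i<j. a i * g i\<bar>" "j \<le> k"
    unfolding j_def using assms by (auto intro: LeastI Least_le)
  have "stopped_sum l a j g = (\<Sum>i<j. a i * g i)"
    by (rule stopped_sum_eq) (use not_less_Least in \<open>fastforce simp: j_def\<close>)
  then show ?thesis using stopped_sum_stays[of l a j g n] j assms(1) by simp
qed

lemma abs_stopped_sum_le:
  "(\<And>i. \<bar>g i\<bar> \<le> 1) \<Longrightarrow> \<bar>stopped_sum l a n g\<bar> \<le> (\<Sum>i<n. \<bar>a i\<bar>)"
proof (induction n)
  case (Suc n)
  have "\<bar>a n * g n\<bar> \<le> \<bar>a n\<bar>"
    using Suc.prems[of n] by (simp add: abs_mult mult_left_le)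
  then show ?case
    using Suc.IH[OF Suc.prems] abs_triangle_ineq[of "stopped_sum l a n g" "a n * g n"] by auto
qed simp

context prob_space
begin

lemma iid_signs_measurable: "iid_signs M \<gamma> \<Longrightarrow> \<gamma> i \<in> borel_measurable M"
  by (auto simp: iid_signs_def indep_vars_def)

lemma prob_iid_sign:
  assumes "iid_signs M \<gamma>"
  shows "prob {\<omega> \<in> space M. \<gamma> i \<omega> = 1} = 1 / 2" "prob {\<omega> \<in> space M. \<gamma> i \<omega> = -1} = 1 / 2"
  using assms unfolding iid_signs_def by blast+

lemma AE_iid_signs:
  assumes "iid_signs M \<gamma>"
  shows "AE \<omega> in M. \<forall>i. \<gamma> i \<omega> = 1 \<or> \<gamma> i \<omega> = -1"
proof (subst AE_all_countable, rule allI)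
  fix i
  note [measurable] = iid_signs_measurable[OF assms]
  have "prob ({\<omega> \<in> space M. \<gamma> i \<omega> = 1} \<union> {\<omega> \<in> space M. \<gamma> i \<omega> = -1}) = 1"
    by (subst finite_measure_Union) (auto simp: prob_iid_sign[OF assms])
  also have "{\<omega> \<in> space M. \<gamma> i \<omega> = 1} \<union> {\<omega> \<in> space M. \<gamma> i \<omega> = -1} =
      {\<omega> \<in> space M. \<gamma> i \<omega> = 1 \<or> \<gamma> i \<omega> = -1}" by auto
  finally show "AE \<omega> in M. \<gamma> i \<omega> = 1 \<or> \<gamma> i \<omega> = -1"
    by (subst (asm) prob_Collect_eq_1) auto
qed

lemma expectation_iid_sign:
  assumes "iid_signs M \<gamma>"
  shows "expectation (\<gamma> i) = 0"
proof -
  note [measurable] = iid_signs_measurable[OF assms]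
  have "expectation (\<gamma> i) = expectation (\<lambda>\<omega>. indicator {\<omega> \<in> space M. \<gamma> i \<omega> = 1} \<omega> - indicator {\<omega> \<in> space M. \<gamma> i \<omega> = -1} \<omega>)"
    using AE_iid_signs[OF assms] by (intro integral_cong_AE) (auto simp: indicator_def)
  also have "\<dots> = 0"
    by (subst Bochner_Integration.integral_diff)
      (simp_all add: integrable_real_indicator less_top[symmetric] prob_iid_sign[OF assms])
  finally show ?thesis .
qed

text \<open>
  Each step adds \<open>a n\<close> or \<open>0\<close> times a centred sign that is independent of everything before it, so the
  cross term vanishes and the second moment grows by at most \<open>(a n)\<^sup>2\<close>.
\<close>

lemma integral_stopped_sum_sq:
  assumes "iid_signs M \<gamma>"
  shows "integrable M (\<lambda>\<omega>. (stopped_sum l a n (\<lambda>i. \<gamma> i \<omega>))\<^sup>2)"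
    and "expectation (\<lambda>\<omega>. (stopped_sum l a n (\<lambda>i. \<gamma> i \<omega>))\<^sup>2) \<le> (\<Sum>i<n. (a i)\<^sup>2)"
proof -
  note [measurable] = iid_signs_measurable[OF assms]
  define T where "T n \<omega> = stopped_sum l a n (\<lambda>i. \<gamma> i \<omega>)" for n \<omega>
  define A where "A n \<omega> = (if l \<le> \<bar>T n \<omega>\<bar> then 0 else a n)" for n \<omega>
  have [measurable]: "T n \<in> borel_measurable M" for n
    by (induction n) (auto simp: T_def)
  have [measurable]: "A n \<in> borel_measurable M" for n
    unfolding A_def by measurable
  have Tb: "AE \<omega> in M. \<bar>T n \<omega>\<bar> \<le> (\<Sum>i<n. \<bar>a i\<bar>)" for n
    using AE_iid_signs[OF assms]
  proof eventually_elim
    case (elim \<omega>)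
    then have "\<bar>\<gamma> i \<omega>\<bar> \<le> 1" for i by (metis abs_minus_cancel abs_one order_refl)
    then show ?case unfolding T_def by (rule abs_stopped_sum_le)
  qed
  have int2: "integrable M (\<lambda>\<omega>. (T n \<omega>)\<^sup>2)" for n
  proof (rule integrable_const_bound)
    show "AE \<omega> in M. norm ((T n \<omega>)\<^sup>2) \<le> (\<Sum>i<n. \<bar>a i\<bar>)\<^sup>2"
      using Tb[of n] by eventually_elim (auto simp: abs_le_square_iff[symmetric])
  qed measurable
  have intg: "integrable M (\<gamma> n)" for n
  proof (rule integrable_const_bound)
    show "AE \<omega> in M. norm (\<gamma> n \<omega>) \<le> 1"
      using AE_iid_signs[OF assms]
      by eventually_elim (metis norm_minus_cancel norm_one order_refl)
  qed measurable
  have intTA: "integrable M (\<lambda>\<omega>. T n \<omega> * A n \<omega>)" for n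
  proof (rule integrable_const_bound)
    show "AE \<omega> in M. norm (T n \<omega> * A n \<omega>) \<le> (\<Sum>i<n. \<bar>a i\<bar>) * \<bar>a n\<bar>"
      using Tb[of n] by eventually_elim (auto simp: abs_mult A_def intro!: mult_mono sum_nonneg)
  qed measurable
  have ind: "indep_var borel (\<lambda>\<omega>. T n \<omega> * A n \<omega>) borel (\<gamma> n)" for n
  proof -
    define h where "h g = stopped_sum l a n g * (if l \<le> \<bar>stopped_sum l a n g\<bar> then 0 else a n)" for g
    have [measurable]: "stopped_sum l a n \<in> borel_measurable (Pi\<^sub>M {..<n} (\<lambda>_. borel))"
      by (rule measurable_stopped_sum) simp
    have 1: "indep_var (Pi\<^sub>M {..<n} (\<lambda>_. borel)) (\<lambda>\<omega>. restrict (\<lambda>i. \<gamma> i \<omega>) {..<n})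
        (Pi\<^sub>M {n} (\<lambda>_. borel)) (\<lambda>\<omega>. restrict (\<lambda>i. \<gamma> i \<omega>) {n})"
      using assms by (intro indep_var_restrict[where I=UNIV]) (auto simp: iid_signs_def)
    have "indep_var borel (h \<circ> (\<lambda>\<omega>. restrict (\<lambda>i. \<gamma> i \<omega>) {..<n})) borel ((\<lambda>g. g n) \<circ> (\<lambda>\<omega>. restrict (\<lambda>i. \<gamma> i \<omega>) {n}))"
      using 1 by (rule indep_var_compose) (auto simp: h_def[abs_def] intro!: measurable_component_singleton)
    moreover have "h \<circ> (\<lambda>\<omega>. restrict (\<lambda>i. \<gamma> i \<omega>) {..<n}) = (\<lambda>\<omega>. T n \<omega> * A n \<omega>)"
      by (simp add: fun_eq_iff h_def T_def A_def stopped_sum_restrict)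
    moreover have "(\<lambda>g. g n) \<circ> (\<lambda>\<omega>. restrict (\<lambda>i. \<gamma> i \<omega>) {n}) = \<gamma> n"
      by (simp add: fun_eq_iff)
    ultimately show ?thesis by simp
  qed
  have step: "expectation (\<lambda>\<omega>. (T (Suc n) \<omega>)\<^sup>2) \<le> expectation (\<lambda>\<omega>. (T n \<omega>)\<^sup>2) + (a n)\<^sup>2" for n
  proof -
    have "expectation (\<lambda>\<omega>. (T (Suc n) \<omega>)\<^sup>2) \<le> expectation (\<lambda>\<omega>. (T n \<omega>)\<^sup>2 + 2 * (T n \<omega> * A n \<omega> * \<gamma> n \<omega>) + (a n)\<^sup>2)"
    proof (rule integral_mono_AE)
      show "AE \<omega> in M. (T (Suc n) \<omega>)\<^sup>2 \<le> (T n \<omega>)\<^sup>2 + 2 * (T n \<omega> * A n \<omega> * \<gamma> n \<omega>) + (a n)\<^sup>2"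
        using AE_iid_signs[OF assms]
      proof eventually_elim
        case (elim \<omega>)
        then have "(\<gamma> n \<omega>)\<^sup>2 = 1" by (metis one_power2 power2_minus)
        moreover have "T (Suc n) \<omega> = T n \<omega> + A n \<omega> * \<gamma> n \<omega>" by (simp add: T_def A_def)
        ultimately show ?case by (simp add: power2_sum power_mult_distrib A_def)
      qed
    qed (auto intro!: Bochner_Integration.integrable_add int2 integrable_mult_right indep_var_integrable[OF ind intTA intg])
    also have "\<dots> = expectation (\<lambda>\<omega>. (T n \<omega>)\<^sup>2) + 2 * expectation (\<lambda>\<omega>. T n \<omega> * A n \<omega> * \<gamma> n \<omega>) + (a n)\<^sup>2"
      by (simp add: int2 indep_var_integrable[OF ind intTA intg] prob_space)
    also have "expectation (\<lambda>\<omega>. T n \<omega> * A n \<omega> * \<gamma> n \<omega>) = 0"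
      by (subst indep_var_lebesgue_integral[OF ind intTA intg]) (simp add: expectation_iid_sign[OF assms])
    finally show ?thesis by simp
  qed
  have "expectation (\<lambda>\<omega>. (T n \<omega>)\<^sup>2) \<le> (\<Sum>i<n. (a i)\<^sup>2)"
  proof (induction n)
    case (Suc n)
    then show ?case using step[of n] by simp
  qed (simp add: T_def)
  then show "expectation (\<lambda>\<omega>. (stopped_sum l a n (\<lambda>i. \<gamma> i \<omega>))\<^sup>2) \<le> (\<Sum>i<n. (a i)\<^sup>2)"
    "integrable M (\<lambda>\<omega>. (stopped_sum l a n (\<lambda>i. \<gamma> i \<omega>))\<^sup>2)"
    using int2 by (simp_all add: T_def)
qed

text \<open>
  Kolmogorov's maximal inequality. If some partial sum up to \<open>n\<close> reaches \<open>l\<close>, the stopped sum at \<open>n\<close> still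
  has modulus at least \<open>l\<close>, and Markov's inequality applies to its square.
\<close>

lemma kolmogorov_maximal_signs:
  assumes s: "iid_signs M \<gamma>" and sm: "summable (\<lambda>i. (a i)\<^sup>2)" and l: "0 < l"
  shows "prob {\<omega> \<in> space M. \<exists>k. l \<le> \<bar>\<Sum>i<k. a i * \<gamma> i \<omega>\<bar>} \<le> (\<Sum>i. (a i)\<^sup>2) / l\<^sup>2"
proof -
  note [measurable] = iid_signs_measurable[OF s]
  define T where "T n \<omega> = stopped_sum l a n (\<lambda>i. \<gamma> i \<omega>)" for n \<omega>
  have [measurable]: "T n \<in> borel_measurable M" for n
    by (induction n) (auto simp: T_def)
  define A where "A n = {\<omega> \<in> space M. \<exists>k\<le>n. l \<le> \<bar>\<Sum>i<k. a i * \<gamma> i \<omega>\<bar>}" for n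
  have [measurable]: "A n \<in> events" for n unfolding A_def by measurable
  have le: "prob (A n) \<le> (\<Sum>i. (a i)\<^sup>2) / l\<^sup>2" for n
  proof -
    have "prob (A n) \<le> prob {\<omega> \<in> space M. l\<^sup>2 \<le> (T n \<omega>)\<^sup>2}"
    proof (rule finite_measure_mono)
      show "A n \<subseteq> {\<omega> \<in> space M. l\<^sup>2 \<le> (T n \<omega>)\<^sup>2}"
        using l by (auto simp: A_def T_def abs_le_square_iff[symmetric] intro: stopped_sum_ge)
    qed measurable
    also have "\<dots> \<le> expectation (\<lambda>\<omega>. (T n \<omega>)\<^sup>2) / l\<^sup>2"
      using l integral_stopped_sum_sq(1)[OF s]
      by (intro integral_Markov_inequality_measure[where A="{}"]) (auto simp: T_def)
    also have "\<dots> \<le> (\<Sum>i. (a i)\<^sup>2) / l\<^sup>2"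
      using integral_stopped_sum_sq(2)[OF s, of l a n] sum_le_suminf[OF sm, of "{..<n}"]
      by (intro divide_right_mono) (auto simp: T_def)
    finally show ?thesis .
  qed
  have "(\<lambda>n. prob (A n)) \<longlonglongrightarrow> prob (\<Union>n. A n)"
    by (rule finite_Lim_measure_incseq) (auto simp: incseq_def A_def intro: order_trans)
  moreover have "(\<Union>n. A n) = {\<omega> \<in> space M. \<exists>k. l \<le> \<bar>\<Sum>i<k. a i * \<gamma> i \<omega>\<bar>}"
    by (auto simp: A_def)
  ultimately show ?thesis using le by (metis LIMSEQ_le_const2)
qed

text \<open>
  The maximal inequality for the coefficients from \<open>N\<close> on bounds the oscillation of the partial sums
  after \<open>N\<close> by a tail of \<open>\<Sum>i. (a i)\<^sup>2\<close>, so that almost surely the partial sums form a Cauchy sequence.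
\<close>

lemma AE_summable_signs:
  assumes s: "iid_signs M \<gamma>" and sm: "summable (\<lambda>i. (a i)\<^sup>2)"
  shows "AE \<omega> in M. summable (\<lambda>i. a i * \<gamma> i \<omega>)"
proof -
  note [measurable] = iid_signs_measurable[OF s]
  define S where "S k \<omega> = (\<Sum>i<k. a i * \<gamma> i \<omega>)" for k \<omega>
  have [measurable]: "S k \<in> borel_measurable M" for k unfolding S_def by measurable
  define D where "D l N = {\<omega> \<in> space M. \<exists>k\<ge>N. l \<le> \<bar>S k \<omega> - S N \<omega>\<bar>}" for l N
  have D [measurable]: "D l N \<in> events" for l N unfolding D_def by measurable
  have Dle: "prob (D l N) \<le> (\<Sum>i. (a (i + N))\<^sup>2) / l\<^sup>2" if "0 < l" for l N
  proof -
    \<comment> \<open>Dropping the coefficients before \<open>N\<close> makes the maximal inequality speak about increments from \<open>N\<close>.\<close>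
    define a' where "a' i = (if i < N then 0 else a i)" for i
    have sh: "(\<lambda>i. (a' (i + N))\<^sup>2) = (\<lambda>i. (a (i + N))\<^sup>2)" by (simp add: a'_def fun_eq_iff)
    have sm': "summable (\<lambda>i. (a' i)\<^sup>2)"
      by (subst summable_iff_shift[symmetric, of _ N]) (simp only: sh, intro summable_ignore_initial_segment sm)
    have sums: "(\<Sum>i. (a' i)\<^sup>2) = (\<Sum>i. (a (i + N))\<^sup>2)"
      using suminf_split_initial_segment[OF sm', of N] by (simp only: sh) (simp add: a'_def)
    have eq: "(\<Sum>i<k. a' i * \<gamma> i \<omega>) = S k \<omega> - S N \<omega>" if "k \<ge> N" for k \<omega>
      using that by (induction k rule: dec_induct) (auto simp: S_def a'_def)
    have "prob (D l N) \<le> prob {\<omega> \<in> space M. \<exists>k. l \<le> \<bar>\<Sum>i<k. a' i * \<gamma> i \<omega>\<bar>}"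
      by (rule finite_measure_mono) (auto simp: D_def eq[symmetric])
    also have "\<dots> \<le> (\<Sum>i. (a' i)\<^sup>2) / l\<^sup>2"
      by (rule kolmogorov_maximal_signs[OF s sm' that])
    finally show ?thesis by (simp only: sums)
  qed
  have null: "AE \<omega> in M. \<not> (\<forall>N. \<omega> \<in> D (inverse (Suc j)) N)" for j :: nat
  proof -
    let ?l = "inverse (real (Suc j))"
    have "(\<lambda>N. \<Sum>i. (a (i + N))\<^sup>2) \<longlonglongrightarrow> 0" by (rule suminf_exist_split2[OF sm])
    then have "(\<lambda>N. (\<Sum>i. (a (i + N))\<^sup>2) / ?l\<^sup>2) \<longlonglongrightarrow> 0 / ?l\<^sup>2"
      by (intro tendsto_divide tendsto_const) auto
    moreover have "prob (\<Inter>N. D ?l N) \<le> (\<Sum>i. (a (i + N))\<^sup>2) / ?l\<^sup>2" for N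
      by (rule order_trans[OF finite_measure_mono Dle]) auto
    ultimately have "prob (\<Inter>N. D ?l N) \<le> 0"
      by (metis (no_types, lifting) LIMSEQ_le_const div_0)
    then have "prob (\<Inter>N. D ?l N) = 0" by (simp add: order_antisym)
    then have "(\<Inter>N. D ?l N) \<in> null_sets M" by (auto simp: emeasure_eq_measure)
    then show ?thesis by (rule AE_I'[OF _ subsetI]) auto
  qed
  have "AE \<omega> in M. \<forall>j::nat. \<not> (\<forall>N. \<omega> \<in> D (inverse (Suc j)) N)"
    using null by (simp add: AE_all_countable)
  with AE_space show ?thesis
  proof eventually_elim
    case (elim \<omega>)
    have "Cauchy (\<lambda>k. S k \<omega>)"
    proof (rule CauchyI)
      fix e :: real assume "0 < e"
      then obtain j where j: "inverse (real (Suc j)) < e / 2" using reals_Archimedean[of "e/2"] by auto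
      from elim obtain N where N: "\<omega> \<notin> D (inverse (Suc j)) N" by blast
      have *: "\<bar>S k \<omega> - S N \<omega>\<bar> < e / 2" if "k \<ge> N" for k
        using N that elim(1) j by (force simp: D_def)
      have "norm (S k \<omega> - S k' \<omega>) < e" if "k \<ge> N" "k' \<ge> N" for k k'
        using *[OF that(1)] *[OF that(2)] by (simp add: abs_if split: if_splits)
      then show "\<exists>N. \<forall>k\<ge>N. \<forall>k'\<ge>N. norm (S k \<omega> - S k' \<omega>) < e" by blast
    qed
    then show ?case
      by (simp add: summable_iff_convergent S_def Cauchy_convergent_iff)
  qed
qed

lemma prob_suminf_signs_gt_le:
  assumes s: "iid_signs M \<gamma>" and sm: "summable (\<lambda>i. (a i)\<^sup>2)" and l: "0 < l"
  shows "prob {\<omega> \<in> space M. l < \<bar>\<Sum>i. a i * \<gamma> i \<omega>\<bar>} \<le> (\<Sum>i. (a i)\<^sup>2) / l\<^sup>2"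
proof -
  note [measurable] = iid_signs_measurable[OF s]
  have "prob {\<omega> \<in> space M. l < \<bar>\<Sum>i. a i * \<gamma> i \<omega>\<bar>} \<le> prob {\<omega> \<in> space M. \<exists>k. l \<le> \<bar>\<Sum>i<k. a i * \<gamma> i \<omega>\<bar>}"
  proof (rule finite_measure_mono_AE)
    show "AE \<omega> in M. \<omega> \<in> {\<omega> \<in> space M. l < \<bar>\<Sum>i. a i * \<gamma> i \<omega>\<bar>} \<longrightarrow> \<omega> \<in> {\<omega> \<in> space M. \<exists>k. l \<le> \<bar>\<Sum>i<k. a i * \<gamma> i \<omega>\<bar>}"
      using AE_summable_signs[OF s sm]
    proof eventually_elim
      case (elim \<omega>)
      then have "(\<lambda>k. \<bar>\<Sum>i<k. a i * \<gamma> i \<omega>\<bar>) \<longlonglongrightarrow> \<bar>\<Sum>i. a i * \<gamma> i \<omega>\<bar>"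
        by (intro tendsto_rabs summable_LIMSEQ)
      then have "\<exists>k. l \<le> \<bar>\<Sum>i<k. a i * \<gamma> i \<omega>\<bar>" if "l < \<bar>\<Sum>i. a i * \<gamma> i \<omega>\<bar>"
        using order_tendstoD(1)[OF _ that] eventually_happens'[OF sequentially_bot]
        by (metis (mono_tags, lifting) less_le)
      then show ?case by auto
    qed
  qed measurable
  with kolmogorov_maximal_signs[OF s sm l] show ?thesis by linarith
qed

end

section \<open>Independence and arrival times\<close>

lemma measurable_sequence:
  assumes "\<And>i::nat. X i \<in> measurable M K"
  shows "(\<lambda>\<omega> i. X i \<omega>) \<in> measurable M (Pi\<^sub>M UNIV (\<lambda>_. K))"
  using assms by (intro measurable_PiM_single') (auto dest: measurable_space)

context prob_space
begin

lemma poisson_arrival_times_measurable: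
  assumes "poisson_arrival_times M \<Gamma>"
  shows "\<Gamma> i \<in> borel_measurable M"
proof (induction i)
  case 0
  have "(\<lambda>\<omega>. \<Gamma> 0 \<omega> - (if 0 = (0::nat) then 0 else \<Gamma> (0 - 1) \<omega>)) \<in> borel_measurable M"
    using assms unfolding poisson_arrival_times_def Let_def indep_vars_def by blast
  then show ?case by simp
next
  case (Suc i)
  have "(\<lambda>\<omega>. \<Gamma> (Suc i) \<omega> - (if Suc i = 0 then 0 else \<Gamma> (Suc i - 1) \<omega>)) \<in> borel_measurable M"
    using assms unfolding poisson_arrival_times_def Let_def indep_vars_def by blast
  then have "(\<lambda>\<omega>. \<Gamma> (Suc i) \<omega> - \<Gamma> i \<omega>) \<in> borel_measurable M" by simp
  from borel_measurable_add[OF this Suc] show ?case by simp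
qed

lemma poisson_arrival_times_distributed:
  assumes "poisson_arrival_times M \<Gamma>"
  shows "distributed M lborel (\<Gamma> i) (\<lambda>x. ennreal (erlang_density i 1 x))"
proof -
  define T where "T i \<omega> = \<Gamma> i \<omega> - (if i = 0 then 0 else \<Gamma> (i - 1) \<omega>)" for i \<omega>
  have T: "indep_vars (\<lambda>_. borel) T UNIV" "\<And>i. distributed M lborel (T i) (\<lambda>x. ennreal (exponential_density 1 x))"
    using assms by (simp_all add: poisson_arrival_times_def Let_def T_def[abs_def])
  have "distributed M lborel (\<lambda>\<omega>. \<Sum>j\<in>{..i}. T j \<omega>) (erlang_density (card {..i} - 1) 1)"
    by (intro exponential_distributed_sum indep_vars_subset[OF T(1)] T(2)) auto
  moreover have "(\<Sum>j\<in>{..i}. T j \<omega>) = \<Gamma> i \<omega>" for \<omega>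
    by (induction i) (auto simp: T_def)
  ultimately show ?thesis by simp
qed

lemma iid_with_law_measurable: "iid_with_law M P V \<Longrightarrow> V i \<in> measurable M P"
  by (auto simp: iid_with_law_def indep_vars_def)

lemma independent_sequences_indep_sets:
  assumes "independent_sequences M K R L S P T"
  shows "indep_sets (\<lambda>k. [sequence_events M K R, sequence_events M L S, sequence_events M P T] ! k) {..<3}"
  using assms by (simp add: independent_sequences_def)

lemma independent_sequences_distr_pair:
  assumes ind: "independent_sequences M K R L S P T"
    and R: "\<And>i. R i \<in> measurable M K" and S: "\<And>i. S i \<in> measurable M L"
  shows "distr M (K \<Otimes>\<^sub>M L) (\<lambda>\<omega>. (R i \<omega>, S i \<omega>)) = distr M K (R i) \<Otimes>\<^sub>M distr M L (S i)"
proof -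
  note [measurable] = R S
  interpret R: prob_space "distr M K (R i)" by (rule prob_space_distr) simp
  interpret S: prob_space "distr M L (S i)" by (rule prob_space_distr) simp
  show ?thesis
  proof (rule pair_measure_eqI[symmetric])
    fix A B assume "A \<in> sets (distr M K (R i))" "B \<in> sets (distr M L (S i))"
    then have [measurable]: "A \<in> sets K" "B \<in> sets L" by auto
    define E where "E k = [R i -` A \<inter> space M, S i -` B \<inter> space M] ! k" for k :: nat
    have cyl: "X i -` C \<inter> space M \<in> sequence_events M K' X" if C: "C \<in> sets K'" and X: "\<And>i. X i \<in> measurable M K'"
      for C X and K' :: "'z measure"
    proof -
      let ?C = "(\<lambda>x. x i) -` C \<inter> space (Pi\<^sub>M (UNIV :: nat set) (\<lambda>_. K'))"
      have "?C \<in> sets (Pi\<^sub>M (UNIV :: nat set) (\<lambda>_. K'))" using C by measurable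
      moreover have "X i -` C \<inter> space M = (\<lambda>\<omega> i. X i \<omega>) -` ?C \<inter> space M"
        using X[THEN measurable_space] by (auto simp: space_PiM)
      ultimately show ?thesis unfolding sequence_events_def by blast
    qed
    have "prob (\<Inter>k\<in>{0,1}. E k) = (\<Prod>k\<in>{0,1}. prob (E k))"
      by (rule indep_setsD[OF independent_sequences_indep_sets[OF ind]]) (auto simp: E_def cyl R S)
    moreover have "(\<Inter>k\<in>{0,1}. E k) = (\<lambda>\<omega>. (R i \<omega>, S i \<omega>)) -` (A \<times> B) \<inter> space M"
      by (auto simp: E_def)
    ultimately have "prob ((\<lambda>\<omega>. (R i \<omega>, S i \<omega>)) -` (A \<times> B) \<inter> space M) = prob (R i -` A \<inter> space M) * prob (S i -` B \<inter> space M)"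
      by (simp add: E_def)
    then show "emeasure (distr M K (R i)) A * emeasure (distr M L (S i)) B =
        emeasure (distr M (K \<Otimes>\<^sub>M L) (\<lambda>\<omega>. (R i \<omega>, S i \<omega>))) (A \<times> B)"
      by (simp add: emeasure_distr emeasure_eq_measure ennreal_mult)
  qed (auto intro: R.sigma_finite_measure_axioms S.sigma_finite_measure_axioms simp: cong: sets_pair_measure_cong)
qed

lemma sequence_events_Int_stable: "Int_stable (sequence_events M K R)"
proof (unfold Int_stable_def, intro ballI)
  fix E F assume "E \<in> sequence_events M K R" "F \<in> sequence_events M K R"
  then obtain A B where AB: "A \<in> sets (\<Pi>\<^sub>M i\<in>UNIV. K)" "B \<in> sets (\<Pi>\<^sub>M i\<in>UNIV. K)"
    and E: "E = (\<lambda>\<omega> i. R i \<omega>) -` A \<inter> space M" and F: "F = (\<lambda>\<omega> i. R i \<omega>) -` B \<inter> space M"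
    unfolding sequence_events_def by blast
  have "E \<inter> F = (\<lambda>\<omega> i. R i \<omega>) -` (A \<inter> B) \<inter> space M" unfolding E F by blast
  then show "E \<inter> F \<in> sequence_events M K R"
    using sets.Int[OF AB] unfolding sequence_events_def by blast
qed

text \<open>
  The points are paired into one random element \<open>Z\<close> so that conditioning on them becomes integration
  over the first factor of a product measure. That \<open>Z\<close> as a whole is independent of the third sequence
  follows since independence passes from \<open>\<inter>\<close>-stable families to the generated \<open>\<sigma>\<close>-algebras.
\<close>

lemma independent_sequences_distr_triple:
  assumes ind: "independent_sequences M K R L S P T"
    and R: "\<And>i. R i \<in> measurable M K" and S: "\<And>i. S i \<in> measurable M L" and T: "\<And>i. T i \<in> measurable M P"
  defines "Z \<equiv> (\<lambda>\<omega>. ((\<lambda>i. R i \<omega>), (\<lambda>i. S i \<omega>)))" and "Q \<equiv> Pi\<^sub>M UNIV (\<lambda>_. K) \<Otimes>\<^sub>M Pi\<^sub>M UNIV (\<lambda>_. L)"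
    and "G \<equiv> (\<lambda>\<omega> i. T i \<omega>)" and "W \<equiv> Pi\<^sub>M UNIV (\<lambda>_. P)"
  shows "distr M (Q \<Otimes>\<^sub>M W) (\<lambda>\<omega>. (Z \<omega>, G \<omega>)) = distr M Q Z \<Otimes>\<^sub>M distr M W G"
proof -
  have Zm: "Z \<in> measurable M Q" and Gm: "G \<in> measurable M W"
    unfolding Z_def Q_def G_def W_def by (intro measurable_Pair measurable_sequence R S T)+
  define E where "E = (\<lambda>k::nat. [sequence_events M K R, sequence_events M L S, sequence_events M P T] ! k)"
  define A where "A = (\<lambda>b. sigma_sets (space M) (\<Union>k\<in>(if b then {0,1} else {2}). E k))"
  have indA: "indep_sets A UNIV"
    unfolding A_def
  proof (rule indep_sets_collect_sigma)
    have "(\<Union>b\<in>UNIV. if b then {0,1} else {2::nat}) = {..<3}" by (auto split: if_splits)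
    then show "indep_sets E (\<Union>b\<in>UNIV. if b then {0,1} else {2})"
      using independent_sequences_indep_sets[OF ind] by (simp only: E_def)
    show "Int_stable (E k)" if "k \<in> (if b then {0,1} else {2})" for k b
      using that by (auto simp: E_def sequence_events_Int_stable split: if_splits)
    show "disjoint_family (\<lambda>b. if b then {0,1} else {2::nat})"
      by (auto simp: disjoint_family_on_def)
  qed
  let ?\<Sigma> = "sigma (space M) (sequence_events M K R \<union> sequence_events M L S)"
  have sub: "sequence_events M K' X \<subseteq> Pow (space M)" for X and K' :: "'z measure" by (auto simp: sequence_events_def)
  have subU: "sequence_events M K R \<union> sequence_events M L S \<subseteq> Pow (space M)" by (intro Un_least sub)
  have seqm': "(\<lambda>\<omega> i. X i \<omega>) \<in> measurable ?\<Sigma> (Pi\<^sub>M (UNIV :: nat set) (\<lambda>_. K'))"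
    if "\<And>i. X i \<in> measurable M K'" "sequence_events M K' X \<subseteq> sequence_events M K R \<union> sequence_events M L S"
    for X and K' :: "'z measure"
  proof (rule measurableI)
    fix x assume "x \<in> space ?\<Sigma>"
    then show "(\<lambda>i. X i x) \<in> space (Pi\<^sub>M (UNIV :: nat set) (\<lambda>_. K'))"
      using measurable_space[OF measurable_sequence[OF that(1)]] by (simp add: space_measure_of_conv)
  next
    fix C assume "C \<in> sets (Pi\<^sub>M (UNIV :: nat set) (\<lambda>_. K'))"
    then have "(\<lambda>\<omega> i. X i \<omega>) -` C \<inter> space M \<in> sequence_events M K R \<union> sequence_events M L S"
      using that(2) unfolding sequence_events_def[of M K' X] by blast
    then show "(\<lambda>\<omega> i. X i \<omega>) -` C \<inter> space ?\<Sigma> \<in> sets ?\<Sigma>"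
      using subU by (simp add: space_measure_of_conv sets_measure_of_conv sigma_sets.Basic)
  qed
  have Z\<Sigma>: "Z \<in> measurable ?\<Sigma> Q"
    unfolding Z_def Q_def by (intro measurable_Pair seqm' R S) auto
  have inA: "Z -` C \<inter> space M \<in> A True" if "C \<in> sets Q" for C
  proof -
    have "Z -` C \<inter> space ?\<Sigma> \<in> sets ?\<Sigma>" using Z\<Sigma> that by (rule measurable_sets)
    then show ?thesis using subU by (simp add: A_def E_def space_measure_of_conv)
  qed
  have inA': "G -` D \<inter> space M \<in> A False" if "D \<in> sets W" for D
    using that by (auto simp: A_def E_def sequence_events_def G_def W_def intro!: sigma_sets.Basic)
  interpret Z: prob_space "distr M Q Z" by (rule prob_space_distr[OF Zm])
  interpret G: prob_space "distr M W G" by (rule prob_space_distr[OF Gm])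
  show ?thesis
  proof (rule pair_measure_eqI[symmetric])
    fix C D assume "C \<in> sets (distr M Q Z)" "D \<in> sets (distr M W G)"
    then have [measurable]: "C \<in> sets Q" "D \<in> sets W" by auto
    note [measurable] = Zm Gm
    have "prob (\<Inter>b\<in>UNIV. if b then Z -` C \<inter> space M else G -` D \<inter> space M) =
        (\<Prod>b\<in>UNIV. prob (if b then Z -` C \<inter> space M else G -` D \<inter> space M))"
      by (rule indep_setsD[OF indA]) (auto simp: inA inA')
    moreover have "(\<Inter>b\<in>UNIV. if b then Z -` C \<inter> space M else G -` D \<inter> space M) =
        (\<lambda>\<omega>. (Z \<omega>, G \<omega>)) -` (C \<times> D) \<inter> space M" by (simp add: UNIV_bool) auto
    ultimately have "prob ((\<lambda>\<omega>. (Z \<omega>, G \<omega>)) -` (C \<times> D) \<inter> space M) = prob (Z -` C \<inter> space M) * prob (G -` D \<inter> space M)"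
      by (simp add: UNIV_bool mult.commute)
    then show "emeasure (distr M Q Z) C * emeasure (distr M W G) D =
        emeasure (distr M (Q \<Otimes>\<^sub>M W) (\<lambda>\<omega>. (Z \<omega>, G \<omega>))) (C \<times> D)"
      by (simp add: emeasure_distr emeasure_eq_measure ennreal_mult)
  qed (auto intro: Z.sigma_finite_measure_axioms G.sigma_finite_measure_axioms cong: sets_pair_measure_cong)
qed

end

text \<open>
  The intensity of a unit rate Poisson process is Lebesgue measure: the exponential series cancels the
  factor \<open>exp (- x)\<close>.
\<close>

lemma suminf_erlang_density:
  "(\<Sum>i. ennreal (erlang_density i 1 x)) = indicator {0..} x"
proof (cases "x < 0")
  case False
  have "(\<lambda>i. x ^ i /\<^sub>R fact i) sums exp x" by (rule exp_converges)
  then have "(\<lambda>i. exp (-x) * (x ^ i /\<^sub>R fact i)) sums (exp (-x) * exp x)" by (rule sums_mult)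
  moreover have "exp (-x) * (x ^ i /\<^sub>R fact i) = erlang_density i 1 x" for i
    using False by (simp add: erlang_density_def divide_inverse mult.commute mult.left_commute)
  ultimately have "(\<lambda>i. erlang_density i 1 x) sums 1"
    by (simp add: exp_add[symmetric])
  then show ?thesis using False
    by (subst suminf_ennreal_eq[where x=1]) auto
qed (simp add: erlang_density_def)

text \<open>
  Campbell's formula for the point process of the \<open>(\<Gamma> i, V i)\<close>, whose intensity is the product of
  Lebesgue measure on the half-line and the law of the marks. The integral excludes \<open>y = 0\<close>, where
  powers with a negative exponent take a default value.
\<close>

lemma (in prob_space) campbell_marked_poisson:
  assumes \<Gamma>: "poisson_arrival_times M \<Gamma>" and V: "iid_with_law M P V"
    and ind: "independent_sequences M borel \<Gamma> P V K T"
    and [measurable]: "g \<in> borel_measurable (borel \<Otimes>\<^sub>M P)"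
  shows "(\<Sum>i. \<integral>\<^sup>+\<omega>. g (\<Gamma> i \<omega>, V i \<omega>) \<partial>M) = (\<integral>\<^sup>+x. (\<integral>\<^sup>+y. g (y, x) * indicator {0<..} y \<partial>lborel) \<partial>P)"
proof -
  note [measurable] = poisson_arrival_times_measurable[OF \<Gamma>] iid_with_law_measurable[OF V]
  have dV: "distr M P (V i) = P" for i using V by (simp add: iid_with_law_def)
  interpret P: prob_space P using prob_space_distr[OF iid_with_law_measurable[OF V, of 0]] by (simp add: dV)
  interpret LP: pair_sigma_finite lborel P ..
  have "(\<integral>\<^sup>+\<omega>. g (\<Gamma> i \<omega>, V i \<omega>) \<partial>M) = (\<integral>\<^sup>+x. (\<integral>\<^sup>+y. ennreal (erlang_density i 1 y) * g (y, x) \<partial>lborel) \<partial>P)" for i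
  proof -
    have dG: "distr M borel (\<Gamma> i) = density lborel (\<lambda>x. ennreal (erlang_density i 1 x))"
      using poisson_arrival_times_distributed[OF \<Gamma>, of i] unfolding distributed_def
      by (metis distr_cong sets_lborel)
    interpret G: prob_space "distr M borel (\<Gamma> i)" by (rule prob_space_distr) simp
    interpret GP: pair_sigma_finite "distr M borel (\<Gamma> i)" P ..
    have [measurable_cong]: "sets (distr M borel (\<Gamma> i)) = sets borel" by simp
    have "(\<integral>\<^sup>+\<omega>. g (\<Gamma> i \<omega>, V i \<omega>) \<partial>M) = (\<integral>\<^sup>+z. g z \<partial>distr M (borel \<Otimes>\<^sub>M P) (\<lambda>\<omega>. (\<Gamma> i \<omega>, V i \<omega>)))"
      by (subst nn_integral_distr) auto
    also have "\<dots> = (\<integral>\<^sup>+z. g z \<partial>(distr M borel (\<Gamma> i) \<Otimes>\<^sub>M P))"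
      by (subst independent_sequences_distr_pair[OF ind]) (auto simp: dV)
    also have "\<dots> = (\<integral>\<^sup>+x. (\<integral>\<^sup>+y. g (y, x) \<partial>distr M borel (\<Gamma> i)) \<partial>P)"
      by (subst GP.nn_integral_snd[symmetric]) auto
    also have "\<dots> = (\<integral>\<^sup>+x. (\<integral>\<^sup>+y. ennreal (erlang_density i 1 y) * g (y, x) \<partial>lborel) \<partial>P)"
      unfolding dG by (intro nn_integral_cong nn_integral_density) auto
    finally show ?thesis .
  qed
  then have "(\<Sum>i. \<integral>\<^sup>+\<omega>. g (\<Gamma> i \<omega>, V i \<omega>) \<partial>M) = (\<Sum>i. \<integral>\<^sup>+x. (\<integral>\<^sup>+y. ennreal (erlang_density i 1 y) * g (y, x) \<partial>lborel) \<partial>P)"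
    by simp
  also have "\<dots> = (\<integral>\<^sup>+x. (\<Sum>i. \<integral>\<^sup>+y. ennreal (erlang_density i 1 y) * g (y, x) \<partial>lborel) \<partial>P)"
    by (rule nn_integral_suminf[symmetric]) measurable
  also have "\<dots> = (\<integral>\<^sup>+x. (\<integral>\<^sup>+y. (\<Sum>i. ennreal (erlang_density i 1 y) * g (y, x)) \<partial>lborel) \<partial>P)"
    by (intro nn_integral_cong nn_integral_suminf[symmetric]) measurable
  also have "\<dots> = (\<integral>\<^sup>+x. (\<integral>\<^sup>+y. g (y, x) * indicator {0..} y \<partial>lborel) \<partial>P)"
    by (simp add: ennreal_suminf_multc suminf_erlang_density mult.commute)
  also have "\<dots> = (\<integral>\<^sup>+x. (\<integral>\<^sup>+y. g (y, x) * indicator {0<..} y \<partial>lborel) \<partial>P)"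
  proof (rule nn_integral_cong, rule nn_integral_cong_AE)
    fix x
    show "AE y in lborel. g (y, x) * indicator {0..} y = g (y, x) * indicator {0<..} y"
      using AE_lborel_singleton[of 0] by eventually_elim (auto simp: indicator_def)
  qed
  finally show ?thesis .
qed

section \<open>Series over a marked Poisson process\<close>

lemma summable_sq_of_truncated:
  fixes x :: "nat \<Rightarrow> real"
  assumes "(\<Sum>i. ennreal (min 1 ((x i)\<^sup>2))) < \<infinity>"
  shows "summable (\<lambda>i. (x i)\<^sup>2)"
proof -
  have s: "summable (\<lambda>i. min 1 ((x i)\<^sup>2))"
    using assms by (intro summable_suminf_not_top) auto
  then have "(\<lambda>i. min 1 ((x i)\<^sup>2)) \<longlonglongrightarrow> 0" by (rule summable_LIMSEQ_zero)
  then have "\<forall>\<^sub>F i in sequentially. min 1 ((x i)\<^sup>2) < 1" by (rule order_tendstoD) simp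
  then have "\<forall>\<^sub>F i in sequentially. (x i)\<^sup>2 = min 1 ((x i)\<^sup>2)"
    by eventually_elim auto
  then show ?thesis using s by (subst summable_cong)
qed

context prob_space
begin

text \<open>
  Truncating the squares costs nothing: if some term of the bound is at least one, the bound is
  trivial, and otherwise no square is truncated and the Chebyshev type bound applies.
\<close>

lemma prob_sign_series_gt_le_truncated:
  assumes s: "iid_signs M \<gamma>" and l: "0 < l"
  shows "emeasure M {\<omega> \<in> space M. l < \<bar>\<Sum>i. a i * \<gamma> i \<omega>\<bar>} \<le> (\<Sum>i. ennreal (min 1 ((a i / l)\<^sup>2)))"
    (is "_ \<le> ?R")
proof (cases "?R < \<infinity>")
  case fin: True
  have sm: "summable (\<lambda>i. (a i / l)\<^sup>2)" by (rule summable_sq_of_truncated[OF fin])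
  then have sm2: "summable (\<lambda>i. (a i)\<^sup>2)"
    using summable_mult[of "\<lambda>i. (a i / l)\<^sup>2" "l\<^sup>2"] l by (simp add: power_divide)
  show ?thesis
  proof (cases "\<exists>j. 1 \<le> (a j / l)\<^sup>2")
    case True
    then obtain j where "1 \<le> (a j / l)\<^sup>2" by blast
    then have "1 = (\<Sum>i\<in>{j}. ennreal (min 1 ((a i / l)\<^sup>2)))" by simp
    also have "\<dots> \<le> ?R" by (rule sum_le_suminf) auto
    finally have "1 \<le> ?R" .
    moreover have "emeasure M {\<omega> \<in> space M. l < \<bar>\<Sum>i. a i * \<gamma> i \<omega>\<bar>} \<le> 1" by (rule emeasure_le_1)
    ultimately show ?thesis by (rule order_trans[rotated])
  next
    case False
    then have eq: "min 1 ((a i / l)\<^sup>2) = (a i / l)\<^sup>2" for i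
      by (intro min_absorb2) (auto simp: not_le intro: less_imp_le)
    have "prob {\<omega> \<in> space M. l < \<bar>\<Sum>i. a i * \<gamma> i \<omega>\<bar>} \<le> (\<Sum>i. (a i)\<^sup>2) / l\<^sup>2"
      by (rule prob_suminf_signs_gt_le[OF s sm2 l])
    also have "\<dots> = (\<Sum>i. (a i / l)\<^sup>2)" by (simp add: suminf_divide[OF sm2] power_divide)
    finally show ?thesis
      unfolding eq emeasure_eq_measure using sm
      by (subst suminf_ennreal2) (auto intro: ennreal_leI)
  qed
qed (simp add: not_less top.extremum_unique)

text \<open>
  Fubini's theorem for the product law: the points may be taken from one outcome and the signs from
  another, independent one.
\<close>

lemma emeasure_eq_nn_integral_decoupled:
  assumes ind: "independent_sequences M K R L S P T"
    and R: "\<And>i. R i \<in> measurable M K" and S: "\<And>i. S i \<in> measurable M L" and T: "\<And>i. T i \<in> measurable M P"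
    and B: "B \<in> sets ((Pi\<^sub>M UNIV (\<lambda>_. K) \<Otimes>\<^sub>M Pi\<^sub>M UNIV (\<lambda>_. L)) \<Otimes>\<^sub>M Pi\<^sub>M UNIV (\<lambda>_. P))"
  shows "emeasure M {\<omega> \<in> space M. ((\<lambda>i. R i \<omega>, \<lambda>i. S i \<omega>), \<lambda>i. T i \<omega>) \<in> B} =
    (\<integral>\<^sup>+\<omega>'. emeasure M {\<omega> \<in> space M. ((\<lambda>i. R i \<omega>', \<lambda>i. S i \<omega>'), \<lambda>i. T i \<omega>) \<in> B} \<partial>M)"
proof -
  define Z where "Z = (\<lambda>\<omega>. ((\<lambda>i. R i \<omega>), (\<lambda>i. S i \<omega>)))"
  define Q where "Q = Pi\<^sub>M (UNIV::nat set) (\<lambda>_. K) \<Otimes>\<^sub>M Pi\<^sub>M (UNIV::nat set) (\<lambda>_. L)"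
  define G where "G = (\<lambda>\<omega> i. T i \<omega>)"
  define W where "W = Pi\<^sub>M (UNIV::nat set) (\<lambda>_. P)"
  have [measurable]: "Z \<in> measurable M Q" "G \<in> measurable M W"
    unfolding Z_def Q_def G_def W_def by (intro measurable_Pair measurable_sequence R S T)+
  have B' [measurable]: "B \<in> sets (Q \<Otimes>\<^sub>M W)" using B by (simp add: Q_def W_def)
  interpret G: prob_space "distr M W G" by (rule prob_space_distr) simp
  have "emeasure M {\<omega> \<in> space M. (Z \<omega>, G \<omega>) \<in> B} = emeasure (distr M (Q \<Otimes>\<^sub>M W) (\<lambda>\<omega>. (Z \<omega>, G \<omega>))) B"
    by (subst emeasure_distr) (auto intro!: arg_cong[where f="emeasure M"])
  also have "distr M (Q \<Otimes>\<^sub>M W) (\<lambda>\<omega>. (Z \<omega>, G \<omega>)) = distr M Q Z \<Otimes>\<^sub>M distr M W G"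
    unfolding Z_def Q_def G_def W_def by (rule independent_sequences_distr_triple[OF ind R S T])
  also have "emeasure \<dots> B = (\<integral>\<^sup>+z. emeasure (distr M W G) (Pair z -` B) \<partial>distr M Q Z)"
    by (rule G.emeasure_pair_measure_alt) (use B' in \<open>simp cong: sets_pair_measure_cong\<close>)
  also have "\<dots> = (\<integral>\<^sup>+\<omega>'. emeasure (distr M W G) (Pair (Z \<omega>') -` B) \<partial>M)"
  proof -
    have "(\<lambda>z. emeasure (distr M W G) (Pair z -` B)) \<in> borel_measurable Q"
      by (rule G.measurable_emeasure_Pair) (use B' in \<open>simp cong: sets_pair_measure_cong\<close>)
    then show ?thesis by (subst nn_integral_distr) simp_all
  qed
  also have "\<dots> = (\<integral>\<^sup>+\<omega>'. emeasure M {\<omega> \<in> space M. (Z \<omega>', G \<omega>) \<in> B} \<partial>M)"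
  proof (rule nn_integral_cong)
    fix \<omega>' assume "\<omega>' \<in> space M"
    have "Pair (Z \<omega>') -` B \<in> sets W" using B' by (rule sets_Pair1)
    then show "emeasure (distr M W G) (Pair (Z \<omega>') -` B) = emeasure M {\<omega> \<in> space M. (Z \<omega>', G \<omega>) \<in> B}"
      by (subst emeasure_distr) (auto intro!: arg_cong[where f="emeasure M"])
  qed
  finally show ?thesis by (simp only: Z_def G_def)
qed

text \<open>
  For fixed points both claims are statements about constant coefficients with random signs; Campbell's
  formula evaluates the mean of the resulting bound, whose finiteness makes the coefficients square
  summable for almost all points.
\<close>

lemma lepage_series:
  assumes \<Gamma>: "poisson_arrival_times M \<Gamma>" and V: "iid_with_law M P V" and s: "iid_signs M \<gamma>"
    and ind: "independent_sequences M borel \<Gamma> P V borel \<gamma>"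
    and g [measurable]: "g \<in> borel_measurable (borel \<Otimes>\<^sub>M P)"
    and l: "0 < l"
    and fin: "(\<integral>\<^sup>+x. (\<integral>\<^sup>+y. ennreal (min 1 ((g (y, x) / l)\<^sup>2)) * indicator {0<..} y \<partial>lborel) \<partial>P) < \<infinity>" (is "?J < _")
  shows "AE \<omega> in M. summable (\<lambda>i. \<gamma> i \<omega> * g (\<Gamma> i \<omega>, V i \<omega>))"
    and "emeasure M {\<omega> \<in> space M. l < \<bar>\<Sum>i. \<gamma> i \<omega> * g (\<Gamma> i \<omega>, V i \<omega>)\<bar>} \<le> ?J"
proof -
  note [measurable] = poisson_arrival_times_measurable[OF \<Gamma>] iid_with_law_measurable[OF V] iid_signs_measurable[OF s]
  have camp: "(\<integral>\<^sup>+\<omega>. (\<Sum>i. ennreal (min 1 ((g (\<Gamma> i \<omega>, V i \<omega>) / l)\<^sup>2))) \<partial>M) = ?J"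
    by (subst nn_integral_suminf, measurable)
      (rule campbell_marked_poisson[OF \<Gamma> V ind,
        of "\<lambda>z. ennreal (min 1 ((g z / l)\<^sup>2))"], measurable)
  let ?PQ = "(Pi\<^sub>M (UNIV::nat set) (\<lambda>_. borel :: real measure) \<Otimes>\<^sub>M Pi\<^sub>M (UNIV::nat set) (\<lambda>_. P)) \<Otimes>\<^sub>M Pi\<^sub>M (UNIV::nat set) (\<lambda>_. borel :: real measure)"
  note dec = emeasure_eq_nn_integral_decoupled[OF ind poisson_arrival_times_measurable[OF \<Gamma>] iid_with_law_measurable[OF V] iid_signs_measurable[OF s]]
  have tm [measurable]: "(\<lambda>z. snd z i * g (fst (fst z) i, snd (fst z) i)) \<in> borel_measurable ?PQ" for i
    by measurable
  define N where "N = {z \<in> space ?PQ. \<not> summable (\<lambda>i. snd z i * g (fst (fst z) i, snd (fst z) i))}"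
  define D where "D = {z \<in> space ?PQ. l < \<bar>\<Sum>i. snd z i * g (fst (fst z) i, snd (fst z) i)\<bar>}"
  have [measurable]: "Measurable.pred ?PQ (\<lambda>z. summable (\<lambda>i. snd z i * g (fst (fst z) i, snd (fst z) i)))"
    unfolding summable_iff_convergent Cauchy_convergent_iff[symmetric] by measurable
  have Ns: "N \<in> sets ?PQ" unfolding N_def by measurable
  have Ds: "D \<in> sets ?PQ" unfolding D_def by measurable
  have sp: "((\<lambda>i. \<Gamma> i \<omega>', \<lambda>i. V i \<omega>'), \<lambda>i. \<gamma> i \<omega>) \<in> space ?PQ" if "\<omega> \<in> space M" "\<omega>' \<in> space M" for \<omega> \<omega>'
    using that measurable_space[OF iid_with_law_measurable[OF V]] by (auto simp: space_pair_measure space_PiM)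
  have "emeasure M {\<omega> \<in> space M. \<not> summable (\<lambda>i. \<gamma> i \<omega> * g (\<Gamma> i \<omega>, V i \<omega>))} =
      emeasure M {\<omega> \<in> space M. ((\<lambda>i. \<Gamma> i \<omega>, \<lambda>i. V i \<omega>), \<lambda>i. \<gamma> i \<omega>) \<in> N}"
    using sp by (intro arg_cong[where f="emeasure M"]) (auto simp: N_def)
  also have "\<dots> = (\<integral>\<^sup>+\<omega>'. emeasure M {\<omega> \<in> space M. ((\<lambda>i. \<Gamma> i \<omega>', \<lambda>i. V i \<omega>'), \<lambda>i. \<gamma> i \<omega>) \<in> N} \<partial>M)"
    by (rule dec[OF Ns])
  also have "\<dots> = (\<integral>\<^sup>+\<omega>'. 0 \<partial>M)"
  proof (rule nn_integral_cong_AE)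
    have "AE \<omega>' in M. (\<Sum>i. ennreal (min 1 ((g (\<Gamma> i \<omega>', V i \<omega>') / l)\<^sup>2))) \<noteq> \<infinity>"
      by (rule nn_integral_PInf_AE) (use fin camp in auto)
    with AE_space show "AE \<omega>' in M. emeasure M {\<omega> \<in> space M. ((\<lambda>i. \<Gamma> i \<omega>', \<lambda>i. V i \<omega>'), \<lambda>i. \<gamma> i \<omega>) \<in> N} = 0"
    proof eventually_elim
      case (elim \<omega>')
      then have "summable (\<lambda>i. (g (\<Gamma> i \<omega>', V i \<omega>') / l)\<^sup>2)"
        by (intro summable_sq_of_truncated) (simp add: less_top)
      then have "summable (\<lambda>i. (g (\<Gamma> i \<omega>', V i \<omega>'))\<^sup>2)"
        using summable_mult[of "\<lambda>i. (g (\<Gamma> i \<omega>', V i \<omega>') / l)\<^sup>2" "l\<^sup>2"] l by (simp add: power_divide)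
      then have "AE \<omega> in M. summable (\<lambda>i. g (\<Gamma> i \<omega>', V i \<omega>') * \<gamma> i \<omega>)"
        by (rule AE_summable_signs[OF s])
      then have "AE \<omega> in M. \<not> ((\<lambda>i. \<Gamma> i \<omega>', \<lambda>i. V i \<omega>'), \<lambda>i. \<gamma> i \<omega>) \<in> N"
        by eventually_elim (simp add: N_def mult.commute)
      then show ?case by (rule emeasure_eq_0_AE)
    qed
  qed
  finally have "emeasure M {\<omega> \<in> space M. \<not> summable (\<lambda>i. \<gamma> i \<omega> * g (\<Gamma> i \<omega>, V i \<omega>))} = 0" by simp
  moreover have "{\<omega> \<in> space M. \<not> summable (\<lambda>i. \<gamma> i \<omega> * g (\<Gamma> i \<omega>, V i \<omega>))} \<in> events"
    unfolding summable_iff_convergent Cauchy_convergent_iff[symmetric] by measurable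
  ultimately show "AE \<omega> in M. summable (\<lambda>i. \<gamma> i \<omega> * g (\<Gamma> i \<omega>, V i \<omega>))"
    by (intro AE_I[of _ _ "{\<omega> \<in> space M. \<not> summable (\<lambda>i. \<gamma> i \<omega> * g (\<Gamma> i \<omega>, V i \<omega>))}"]) auto
  have "emeasure M {\<omega> \<in> space M. l < \<bar>\<Sum>i. \<gamma> i \<omega> * g (\<Gamma> i \<omega>, V i \<omega>)\<bar>} =
      emeasure M {\<omega> \<in> space M. ((\<lambda>i. \<Gamma> i \<omega>, \<lambda>i. V i \<omega>), \<lambda>i. \<gamma> i \<omega>) \<in> D}"
    using sp by (intro arg_cong[where f="emeasure M"]) (auto simp: D_def)
  also have "\<dots> = (\<integral>\<^sup>+\<omega>'. emeasure M {\<omega> \<in> space M. ((\<lambda>i. \<Gamma> i \<omega>', \<lambda>i. V i \<omega>'), \<lambda>i. \<gamma> i \<omega>) \<in> D} \<partial>M)"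
    by (rule dec[OF Ds])
  also have "\<dots> \<le> (\<integral>\<^sup>+\<omega>'. (\<Sum>i. ennreal (min 1 ((g (\<Gamma> i \<omega>', V i \<omega>') / l)\<^sup>2))) \<partial>M)"
  proof (rule nn_integral_mono)
    fix \<omega>' assume "\<omega>' \<in> space M"
    then have "{\<omega> \<in> space M. ((\<lambda>i. \<Gamma> i \<omega>', \<lambda>i. V i \<omega>'), \<lambda>i. \<gamma> i \<omega>) \<in> D} =
        {\<omega> \<in> space M. l < \<bar>\<Sum>i. g (\<Gamma> i \<omega>', V i \<omega>') * \<gamma> i \<omega>\<bar>}"
      using sp by (auto simp: D_def mult.commute)
    then show "emeasure M {\<omega> \<in> space M. ((\<lambda>i. \<Gamma> i \<omega>', \<lambda>i. V i \<omega>'), \<lambda>i. \<gamma> i \<omega>) \<in> D} \<le>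
        (\<Sum>i. ennreal (min 1 ((g (\<Gamma> i \<omega>', V i \<omega>') / l)\<^sup>2)))"
      using prob_sign_series_gt_le_truncated[OF s l, of "\<lambda>i. g (\<Gamma> i \<omega>', V i \<omega>')"] by simp
  qed
  also have "\<dots> = ?J" by (rule camp)
  finally show "emeasure M {\<omega> \<in> space M. l < \<bar>\<Sum>i. \<gamma> i \<omega> * g (\<Gamma> i \<omega>, V i \<omega>)\<bar>} \<le> ?J" .
qed

end

section \<open>Power estimates for the kernel\<close>

text \<open>
  A logarithm costs an arbitrarily small change \<open>\<eta>\<close> of the exponent, in the direction that depends on
  whether \<open>w\<close> is large or small.
\<close>

lemma powr_mult_ln_le:
  fixes w :: real
  assumes "0 < w" "0 < \<eta>"
  shows "w powr e * \<bar>ln w\<bar> \<le> (w powr (e + \<eta>) + w powr (e - \<eta>)) / \<eta>"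
proof -
  have "\<bar>ln w\<bar> \<le> (w powr \<eta> + w powr (-\<eta>)) / \<eta>"
  proof (cases "1 \<le> w")
    case True
    then show ?thesis using ln_powr_bound[of w \<eta>] assms
      by (simp add: field_simps) (metis add.commute add_increasing powr_ge_zero)
  next
    case False
    then have "ln (1/w) \<le> (1/w) powr \<eta> / \<eta>" using assms by (intro ln_powr_bound) auto
    then have "- ln w \<le> w powr (-\<eta>) / \<eta>"
      using assms by (simp add: ln_div powr_divide powr_minus inverse_eq_divide)
    moreover have "w powr \<eta> / \<eta> \<ge> 0" using assms by simp
    ultimately have "- ln w \<le> (w powr \<eta> + w powr (-\<eta>)) / \<eta>" by (simp add: add_divide_distrib)
    then show ?thesis using False assms by simp
  qed
  then have "w powr e * \<bar>ln w\<bar> \<le> w powr e * ((w powr \<eta> + w powr (-\<eta>)) / \<eta>)"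
    by (intro mult_left_mono) auto
  also have "\<dots> = (w powr (e + \<eta>) + w powr (e - \<eta>)) / \<eta>"
    by (simp add: powr_add[symmetric] ring_distribs)
  finally show ?thesis .
qed

lemma powr_between_le_sum:
  fixes s :: real
  assumes "0 \<le> s" "p \<le> e" "e \<le> q"
  shows "s powr e \<le> s powr p + s powr q"
proof (cases "s \<le> 1")
  case True
  then have "s powr e \<le> s powr p"
    using assms by (intro powr_mono') auto
  then show ?thesis by (simp add: add_increasing2)
next
  case False
  then have "s powr e \<le> s powr q" using assms by (intro powr_mono) auto
  then show ?thesis by (simp add: add_increasing)
qed

lemma powr_le_sum_powr:
  fixes w :: real
  assumes "0 \<le> w" "w \<le> s" "0 < p" "p \<le> e" "e \<le> q"
  shows "w powr e \<le> s powr p + s powr q"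
proof -
  have "w powr e \<le> s powr e" using assms by (intro powr_mono2) auto
  also have "s powr e \<le> s powr p + s powr q"
    using assms by (intro powr_between_le_sum) auto
  finally show ?thesis .
qed

lemma powr_neg_inverse_mult_le:
  fixes x :: real
  assumes "\<bar>x\<bar> powr \<beta> \<le> w" "0 < \<beta>" "0 < y"
  shows "y powr (-1/\<beta>) * \<bar>x\<bar> \<le> (w / y) powr (1/\<beta>)"
proof -
  have "y powr (-1/\<beta>) * \<bar>x\<bar> = (\<bar>x\<bar> powr \<beta> / y) powr (1/\<beta>)"
    using assms by (simp add: powr_divide powr_powr powr_minus_divide)
  also have "\<dots> \<le> (w / y) powr (1/\<beta>)"
    using assms by (intro powr_mono2 divide_right_mono) auto
  finally show ?thesis .
qed

text \<open>
  The mean value theorem in \<open>v\<close> at fixed \<open>y\<close>. The hypotheses bound \<open>F'\<close>, \<open>F\<close> and \<open>F * ln \<bar>F\<bar>\<close> at every \<open>v\<close>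
  in the exponent \<open>A v\<close> that belongs to that same \<open>v\<close>; this is why the whole product is differentiated
  instead of the two factors being treated separately, which would mix exponents of different points.
  As the intermediate point is unknown, the bound is a sum over the extreme exponents \<open>1/d\<close> and
  \<open>1/c\<close>, widened by \<open>\<eta>\<close> to absorb the logarithm.
\<close>

lemma power_kernel_increment_le:
  fixes F A F' A' :: "real \<Rightarrow> real"
  assumes A: "\<And>v. v \<in> ball u \<epsilon> \<Longrightarrow> (A has_real_derivative A' v) (at v)"
    and F: "\<And>v. v \<in> ball u \<epsilon> \<Longrightarrow> (F has_real_derivative F' v) (at v)"
    and A'_le: "\<And>v. v \<in> ball u \<epsilon> \<Longrightarrow> \<bar>A' v\<bar> \<le> K"
    and A_in: "\<And>v. A v \<in> {c..d}" and c: "0 < c"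
    and eta: "0 < \<eta>" "\<eta> < 1 / d"
    and w1: "\<And>v. v \<in> ball u \<epsilon> \<Longrightarrow> \<bar>F' v\<bar> powr A v \<le> w"
    and w2: "\<And>v. v \<in> ball u \<epsilon> \<Longrightarrow> \<bar>F v\<bar> powr A v \<le> w"
    and w3: "\<And>v. v \<in> ball u \<epsilon> \<Longrightarrow> \<bar>F v * ln \<bar>F v\<bar>\<bar> powr A v \<le> w"
    and y: "0 < y" and v: "v \<in> ball u \<epsilon>"
  shows "\<bar>y powr (-1 / A v) * F v - y powr (-1 / A u) * F u\<bar>
     \<le> (1 + K / c\<^sup>2 * d * (1 + 2 / (c * \<eta>))) * \<bar>v - u\<bar> * ((w / y) powr (1/d - \<eta>) + (w / y) powr (1/c + \<eta>))"
proof -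
  define s where "s = w / y"
  define P where "P = s powr (1/d - \<eta>) + s powr (1/c + \<eta>)"
  have P0: "0 \<le> P" by (simp add: P_def)
  have d: "0 < d" using A_in[of u] c by simp
  have cA: "c \<le> A x" "A x \<le> d" "0 < A x" for x using A_in[of x] c by auto
  have K0: "0 \<le> K" using A'_le[OF v] by (meson abs_ge_zero order_trans)
  define \<phi>' where "\<phi>' x = y powr (-1 / A x) * (F' x + F x * (A' x / (A x)\<^sup>2 * ln y))" for x
  have der: "((\<lambda>v. y powr (-1 / A v) * F v) has_real_derivative \<phi>' x) (at x)" if "x \<in> ball u \<epsilon>" for x
    unfolding \<phi>'_def powr_def
    using A[OF that] F[OF that] y cA[of x]
    by (auto intro!: derivative_eq_intros simp: field_simps power2_eq_square)
  have bound: "\<bar>\<phi>' x\<bar> \<le> (1 + K / c\<^sup>2 * d * (1 + 2 / (c * \<eta>))) * P" if x: "x \<in> ball u \<epsilon>" for x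
  proof -
    define \<beta> where "\<beta> = A x"
    have b: "c \<le> \<beta>" "\<beta> \<le> d" "0 < \<beta>" using cA[of x] by (auto simp: \<beta>_def)
    have ib: "1/d \<le> 1/\<beta>" "1/\<beta> \<le> 1/c" using b c by (auto simp: frac_le)
    have s0: "0 \<le> s" using order_trans[OF powr_ge_zero w2[OF x]] y by (simp add: s_def)
    have sP: "s powr (1/\<beta>) \<le> P" 
      unfolding P_def using s0 ib eta d by (intro powr_le_sum_powr) auto
    have T1: "y powr (-1/\<beta>) * \<bar>F' x\<bar> \<le> P"
      using powr_neg_inverse_mult_le[OF w1[OF x], of y] y b sP by (simp add: \<beta>_def s_def)
    have T2: "y powr (-1/\<beta>) * \<bar>F x\<bar> * \<bar>ln y\<bar> \<le> d * (1 + 2 / (c * \<eta>)) * P"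
    proof (cases "F x = 0")
      case True
      then show ?thesis using P0 d c eta by simp
    next
      case False
      define \<omega> where "\<omega> = \<bar>F x\<bar> powr \<beta> / y"
      have om: "0 < \<omega>" "\<omega> \<le> s" 
        using False y w2[OF x] by (auto simp: \<omega>_def s_def \<beta>_def intro!: divide_right_mono)
      have z: "y powr (-1/\<beta>) * \<bar>F x\<bar> = \<omega> powr (1/\<beta>)"
        using b y by (simp add: \<omega>_def powr_divide powr_powr powr_minus_divide)
      \<comment> \<open>Here \<open>\<omega> = z powr \<beta>\<close> for the jump size \<open>z\<close>; this trades \<open>ln y\<close> for two logarithms that are under control.\<close>
      have "ln y = \<beta> * ln \<bar>F x\<bar> - ln \<omega>"
        using False y by (simp add: \<omega>_def ln_div ln_powr)
      then have "\<bar>ln y\<bar> \<le> \<beta> * \<bar>ln \<bar>F x\<bar>\<bar> + \<bar>ln \<omega>\<bar>"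
        using b by (metis abs_mult abs_of_pos abs_triangle_ineq4)
      then have "y powr (-1/\<beta>) * \<bar>F x\<bar> * \<bar>ln y\<bar> \<le> y powr (-1/\<beta>) * \<bar>F x\<bar> * (\<beta> * \<bar>ln \<bar>F x\<bar>\<bar> + \<bar>ln \<omega>\<bar>)"
        by (intro mult_left_mono) auto
      also have "\<dots> = \<beta> * (y powr (-1/\<beta>) * \<bar>F x * ln \<bar>F x\<bar>\<bar>) + \<omega> powr (1/\<beta>) * \<bar>ln \<omega>\<bar>"
        by (simp add: z[symmetric] algebra_simps abs_mult)
      also have "y powr (-1/\<beta>) * \<bar>F x * ln \<bar>F x\<bar>\<bar> \<le> P"
        using powr_neg_inverse_mult_le[OF w3[OF x], of y] y b sP by (simp add: \<beta>_def s_def)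
      also have "\<omega> powr (1/\<beta>) * \<bar>ln \<omega>\<bar> \<le> (\<omega> powr (1/\<beta> + \<eta>) + \<omega> powr (1/\<beta> - \<eta>)) / \<eta>"
        by (rule powr_mult_ln_le) (use om eta in auto)
      also have "\<dots> \<le> (P + P) / \<eta>"
        unfolding P_def using om ib eta d
        by (intro divide_right_mono add_mono powr_le_sum_powr) (auto simp: algebra_simps)
      also have "\<beta> * P + (P + P) / \<eta> \<le> d * P + d * (2 / (c * \<eta>)) * P"
      proof (intro add_mono mult_right_mono)
        have "1 \<le> d / c" using b c by simp
        then have "2 / \<eta> * P * 1 \<le> 2 / \<eta> * P * (d / c)" using P0 eta by (intro mult_left_mono) auto
        then show "(P + P) / \<eta> \<le> d * (2 / (c * \<eta>)) * P" by (simp add: field_simps)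
      qed (use P0 b in auto)
      finally show ?thesis using b by (simp add: algebra_simps)
    qed
    have Ab: "\<bar>A' x\<bar> / \<beta>\<^sup>2 \<le> K / c\<^sup>2"
      using A'_le[OF x] b c K0 by (intro frac_le power_mono) auto
    have "\<bar>\<phi>' x\<bar> = \<bar>y powr (-1/\<beta>) * F' x + (A' x / \<beta>\<^sup>2) * (y powr (-1/\<beta>) * F x * ln y)\<bar>"
      by (simp add: \<phi>'_def \<beta>_def algebra_simps)
    also have "\<dots> \<le> y powr (-1/\<beta>) * \<bar>F' x\<bar> + (\<bar>A' x\<bar> / \<beta>\<^sup>2) * (y powr (-1/\<beta>) * \<bar>F x\<bar> * \<bar>ln y\<bar>)"
      by (rule order_trans[OF abs_triangle_ineq]) (simp add: abs_mult)
    also have "\<dots> \<le> P + (K / c\<^sup>2) * (d * (1 + 2 / (c * \<eta>)) * P)"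
      using Ab T1 T2 K0 c by (intro add_mono mult_mono[of _ "K / c\<^sup>2"]) auto
    also have "\<dots> = (1 + K / c\<^sup>2 * d * (1 + 2 / (c * \<eta>))) * P"
      unfolding distrib_right[of 1] by (simp only: mult.assoc mult_1)
    finally show ?thesis .
  qed
  have "norm (y powr (-1 / A v) * F v - y powr (-1 / A u) * F u) \<le>
      ((1 + K / c\<^sup>2 * d * (1 + 2 / (c * \<eta>))) * P) * norm (v - u)"
  proof (rule field_differentiable_bound[where S = "ball u \<epsilon>" and f' = \<phi>'])
    show "u \<in> ball u \<epsilon>" using v by (metis centre_in_ball zero_le_dist mem_ball order_le_less_trans)
  qed (use der bound v in \<open>auto intro: DERIV_subset\<close>)
  then show ?thesis by (simp add: P_def s_def algebra_simps)
qed

text \<open>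
  The minimum switches from \<open>1\<close> to the power at \<open>y = w * k powr (1/e)\<close>, so the integral is proportional to
  this number. The linear dependence on \<open>w\<close> is what produces an integral over \<open>m\<close> of the dominating
  function itself, whatever the exponent \<open>e\<close>.
\<close>

lemma nn_integral_min_powr_le:
  fixes e k w :: real
  assumes e: "1 < e" and k: "0 < k" and w: "0 \<le> w"
  shows "(\<integral>\<^sup>+y. ennreal (min 1 (k * (w / y) powr e)) * indicator {0<..} y \<partial>lborel)
    \<le> ennreal (k powr (1/e) * (e / (e - 1))) * ennreal w"
proof (cases "w = 0")
  case False
  define a where "a = w * k powr (1/e)"
  have a: "0 < a" using False w k by (simp add: a_def)
  have ae: "a powr e = k * w powr e" 
    using e k w by (simp add: a_def powr_mult powr_powr)
  have "(\<integral>\<^sup>+y. ennreal (min 1 (k * (w / y) powr e)) * indicator {0<..} y \<partial>lborel) \<le>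
      (\<integral>\<^sup>+y. indicator {0..a} y + ennreal (a powr e * y powr (-e)) * indicator {a..} y \<partial>lborel)"
  proof (rule nn_integral_mono)
    fix y :: real
    show "ennreal (min 1 (k * (w / y) powr e)) * indicator {0<..} y \<le> indicator {0..a} y + ennreal (a powr e * y powr (-e)) * indicator {a..} y"
    proof (cases "0 < y")
      case True
      have eq: "k * (w / y) powr e = a powr e * y powr (-e)"
        using True w by (simp add: ae powr_divide powr_minus_divide)
      show ?thesis
      proof (cases "y \<le> a")
        case True
        have "ennreal (min 1 (k * (w / y) powr e)) \<le> 1" by (simp add: ennreal_le_1)
        then show ?thesis using True \<open>0 < y\<close> by (simp add: add_increasing2)
      next
        case False
        then show ?thesis using \<open>0 < y\<close> unfolding eq by (simp add: ennreal_leI)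
      qed
    qed simp
  qed
  also have "\<dots> = ennreal a + (\<integral>\<^sup>+y. ennreal (a powr e * y powr (-e)) * indicator {a..} y \<partial>lborel)"
    using a by (subst nn_integral_add) auto
  also have "(\<integral>\<^sup>+y. ennreal (a powr e * y powr (-e)) * indicator {a..} y \<partial>lborel) =
      ennreal (0 - a powr e * (a powr (1-e) / (1-e)))"
  proof (rule nn_integral_FTC_atLeast[where F = "\<lambda>x. a powr e * (x powr (1-e) / (1-e))"])
    fix x assume "a \<le> x"
    then show "((\<lambda>x. a powr e * (x powr (1-e) / (1-e))) has_real_derivative a powr e * x powr (-e)) (at x)"
      using a e by (auto intro!: derivative_eq_intros)
  next
    have "((\<lambda>x. x powr (1-e)) \<longlongrightarrow> 0) at_top"
      using e by (intro tendsto_neg_powr filterlim_ident) auto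
    then have "((\<lambda>x. a powr e * (x powr (1-e) / (1-e))) \<longlongrightarrow> a powr e * (0 / (1-e))) at_top"
      using e by (intro tendsto_intros) auto
    then show "((\<lambda>x. a powr e * (x powr (1-e) / (1-e))) \<longlongrightarrow> 0) at_top" by simp
  qed auto
  also have "0 - a powr e * (a powr (1-e) / (1-e)) = a / (e - 1)"
    using a e by (simp add: powr_add[symmetric] field_simps)
  also have "ennreal a + ennreal (a / (e - 1)) = ennreal (k powr (1/e) * (e / (e - 1)) * w)"
    using a e by (subst ennreal_plus[symmetric]) (auto simp: a_def field_simps)
  also have "\<dots> = ennreal (k powr (1/e) * (e / (e - 1))) * ennreal w"
    using w e by (intro ennreal_mult) auto
  finally show ?thesis .
qed simp

text \<open>
  The contributions \<open>k powr (1/e) * (e / (e - 1))\<close> of the exponents \<open>e = 2 * p\<close> and \<open>e = 2 * q\<close>, where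
  \<open>k = 2 * \<kappa>\<^sup>2\<close> comes from squaring a sum of two terms.
\<close>

definition tail_const :: "real \<Rightarrow> real \<Rightarrow> real \<Rightarrow> real" where
  "tail_const p q \<kappa> = (2 * \<kappa>\<^sup>2) powr (1 / (2 * p)) * (2 * p / (2 * p - 1))
     + (2 * \<kappa>\<^sup>2) powr (1 / (2 * q)) * (2 * q / (2 * q - 1))"

lemma tail_const_nonneg: "1/2 < p \<Longrightarrow> 1/2 < q \<Longrightarrow> 0 \<le> tail_const p q \<kappa>"
  by (simp add: tail_const_def)

lemma tail_const_tendsto_0:
  assumes "1/2 < p" "1/2 < q" and k: "(k \<longlongrightarrow> 0) F"
  shows "((\<lambda>x. tail_const p q (k x)) \<longlongrightarrow> 0) F"
proof -
  have *: "((\<lambda>x. (2 * (k x)\<^sup>2) powr e) \<longlongrightarrow> 0) F" if "0 < e" for e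
  proof -
    have "((\<lambda>x. 2 * (k x)\<^sup>2) \<longlongrightarrow> 2 * 0\<^sup>2) F" by (intro tendsto_intros k)
    then show ?thesis using that by (intro tendsto_zero_powrI[where b=e]) auto
  qed
  have "((\<lambda>x. tail_const p q (k x)) \<longlongrightarrow> 0 * (2 * p / (2 * p - 1)) + 0 * (2 * q / (2 * q - 1))) F"
    unfolding tail_const_def using assms by (intro tendsto_add tendsto_mult * tendsto_const) auto
  then show ?thesis by simp
qed

lemma nn_integral_truncated_square_le:
  fixes g :: "real \<Rightarrow> real"
  assumes pq: "1/2 < p" "1/2 < q" and K: "0 < K" and l: "0 < l" and w: "0 \<le> w"
    and g: "\<And>y. 0 < y \<Longrightarrow> \<bar>g y\<bar> \<le> K * ((w / y) powr p + (w / y) powr q)"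
  shows "(\<integral>\<^sup>+y. ennreal (min 1 ((g y / l)\<^sup>2)) * indicator {0<..} y \<partial>lborel) \<le> ennreal (tail_const p q (K / l)) * ennreal w"
proof -
  define k where "k = 2 * (K / l)\<^sup>2"
  have k: "0 < k" using K l by (simp add: k_def)
  have "(\<integral>\<^sup>+y. ennreal (min 1 ((g y / l)\<^sup>2)) * indicator {0<..} y \<partial>lborel) \<le>
     (\<integral>\<^sup>+y. ennreal (min 1 (k * (w / y) powr (2 * p))) * indicator {0<..} y
        + ennreal (min 1 (k * (w / y) powr (2 * q))) * indicator {0<..} y \<partial>lborel)"
  proof (rule nn_integral_mono)
    fix y :: real
    have "min 1 ((g y / l)\<^sup>2) \<le> min 1 (k * (w / y) powr (2 * p)) + min 1 (k * (w / y) powr (2 * q))" if y: "0 < y"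
    proof -
      let ?a = "(w / y) powr p" and ?b = "(w / y) powr q"
      have "\<bar>g y / l\<bar> \<le> K / l * (?a + ?b)" using g[OF y] l by (simp add: field_simps)
      then have "(g y / l)\<^sup>2 \<le> (K / l * (?a + ?b))\<^sup>2"
        by (rule abs_le_square_iff[THEN iffD1, OF order_trans]) (use K l in simp)
      also have "\<dots> = (K / l)\<^sup>2 * (?a + ?b)\<^sup>2" by (rule power_mult_distrib)
      also have "\<dots> \<le> (K / l)\<^sup>2 * (2 * (?a\<^sup>2 + ?b\<^sup>2))"
        using sum_squares_bound[of ?a ?b] by (intro mult_left_mono) (auto simp: power2_sum)
      also have "\<dots> = k * ?a\<^sup>2 + k * ?b\<^sup>2" by (simp add: k_def algebra_simps)
      also have "?a\<^sup>2 = (w / y) powr (2 * p)" by (simp add: powr_powr powr_numeral[symmetric] mult.commute del: powr_numeral)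
      also have "?b\<^sup>2 = (w / y) powr (2 * q)" by (simp add: powr_powr powr_numeral[symmetric] mult.commute del: powr_numeral)
      finally have "(g y / l)\<^sup>2 \<le> k * (w / y) powr (2 * p) + k * (w / y) powr (2 * q)" .
      moreover have "0 \<le> k * (w / y) powr (2 * p)" "0 \<le> k * (w / y) powr (2 * q)" using k by auto
      ultimately show ?thesis by (auto simp: min_def)
    qed
    then show "ennreal (min 1 ((g y / l)\<^sup>2)) * indicator {0<..} y \<le>
        ennreal (min 1 (k * (w / y) powr (2 * p))) * indicator {0<..} y
        + ennreal (min 1 (k * (w / y) powr (2 * q))) * indicator {0<..} y"
      using k by (auto simp: indicator_def ennreal_plus[symmetric] simp del: ennreal_plus intro!: ennreal_leI)
  qed
  also have "\<dots> = (\<integral>\<^sup>+y. ennreal (min 1 (k * (w / y) powr (2 * p))) * indicator {0<..} y \<partial>lborel)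
      + (\<integral>\<^sup>+y. ennreal (min 1 (k * (w / y) powr (2 * q))) * indicator {0<..} y \<partial>lborel)"
    by (rule nn_integral_add) measurable
  also have "\<dots> \<le> ennreal (k powr (1 / (2 * p)) * (2 * p / (2 * p - 1))) * ennreal w
      + ennreal (k powr (1 / (2 * q)) * (2 * q / (2 * q - 1))) * ennreal w"
    using pq k w by (intro add_mono nn_integral_min_powr_le) auto
  also have "\<dots> = ennreal (tail_const p q (K / l)) * ennreal w"
    using pq by (simp add: tail_const_def k_def distrib_right[symmetric] ennreal_plus[symmetric] del: ennreal_plus)
  finally show ?thesis .
qed

lemma tail_const_pos: "1/2 < p \<Longrightarrow> 1/2 < q \<Longrightarrow> 0 < \<kappa> \<Longrightarrow> 0 < tail_const p q \<kappa>"
  unfolding tail_const_def by (intro add_pos_pos mult_pos_pos) auto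

section \<open>The normalising constant\<close>

text \<open>
  For \<open>0 < a < 2\<close> this integral converges absolutely at both ends, in contrast to the integral of
  \<open>x powr (-a) * sin x\<close> that defines \<open>C_const\<close>.
\<close>

definition cos_mellin :: "real \<Rightarrow> real" where
  "cos_mellin a = integral {0<..} (\<lambda>x. x powr (-a - 1) * (1 - cos x))"

lemma one_minus_cos_le: "0 \<le> 1 - cos x" "1 - cos x \<le> 2" "1 - cos x \<le> x\<^sup>2 / 2" for x :: real
proof -
  have "1 - cos x = 2 * (sin (x/2))\<^sup>2" using cos_double_sin[of "x/2"] by simp
  also have "(sin (x/2))\<^sup>2 \<le> (x/2)\<^sup>2" using abs_sin_x_le_abs_x[of "x/2"] by (simp only: abs_le_square_iff)
  finally show "1 - cos x \<le> x\<^sup>2 / 2" by (simp add: power2_eq_square)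
qed (use cos_ge_minus_one[of x] in auto)

lemma cos_mellin_integrable:
  assumes "0 < a" "a < 2"
  shows "(\<lambda>x::real. x powr (-a - 1) * (1 - cos x)) absolutely_integrable_on {0<..}"
proof -
  let ?f = "\<lambda>x::real. x powr (-a - 1) * (1 - cos x)"
  have 1: "?f absolutely_integrable_on {0<..1}"
  proof (rule measurable_bounded_by_integrable_imp_absolutely_integrable)
    show "?f \<in> borel_measurable (lebesgue_on {0<..1})"
      by (intro continuous_imp_measurable_on_sets_lebesgue continuous_intros) auto
    have "(\<lambda>x::real. x powr (1 - a)) integrable_on {0..1}"
      using has_integral_powr_from_0[of "1 - a" 1] assms by (auto simp: integrable_on_def)
    then have "(\<lambda>x::real. x powr (1 - a)) integrable_on {0<..1}"
      by (rule integrable_spike_set) (rule negligible_subset[of "{0}"]; auto)+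
    then show "(\<lambda>x::real. x powr (1 - a)) integrable_on {0<..1}" .
    fix x :: real assume x: "x \<in> {0<..1}"
    have "norm (?f x) = ?f x" using one_minus_cos_le[of x] by (simp add: abs_mult)
    also have "\<dots> \<le> x powr (-a - 1) * x powr 2"
      using order_trans[OF one_minus_cos_le(3), of x "x\<^sup>2"] x
      by (intro mult_left_mono) (auto simp: powr_numeral)
    also have "\<dots> = x powr (1 - a)" by (simp add: powr_add[symmetric])
    finally show "norm (?f x) \<le> x powr (1 - a)" .
  qed auto
  have 2: "?f absolutely_integrable_on {1..}"
  proof (rule measurable_bounded_by_integrable_imp_absolutely_integrable)
    show "?f \<in> borel_measurable (lebesgue_on {1..})"
      by (intro continuous_imp_measurable_on_sets_lebesgue continuous_intros) auto
    show "(\<lambda>x::real. x powr (-a - 1) * 2) integrable_on {1..}"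
      using has_integral_powr_to_inf[of "-a - 1" 1] assms
      by (intro integrable_on_mult_left) (auto simp: integrable_on_def)
    fix x :: real assume x: "x \<in> {1..}"
    have "norm (?f x) = ?f x" using one_minus_cos_le[of x] by (simp add: abs_mult)
    also have "\<dots> \<le> x powr (-a - 1) * 2"
      using one_minus_cos_le[of x] by (intro mult_left_mono) auto
    finally show "norm (?f x) \<le> x powr (-a - 1) * 2" .
  qed auto
  have "?f absolutely_integrable_on ({0<..1} \<union> {1..})"
    by (rule absolutely_integrable_Un[OF 1 2])
  also have "{0<..1} \<union> {1..} = {0::real<..}" by auto
  finally show ?thesis .
qed

lemma cos_mellin_pos:
  assumes "0 < a" "a < 2"
  shows "0 < cos_mellin a"
proof -
  let ?f = "\<lambda>x::real. x powr (-a - 1) * (1 - cos x)"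
  have i: "?f integrable_on {0<..}"
    using cos_mellin_integrable[OF assms] by (simp add: absolutely_integrable_on_def)
  have nn: "0 \<le> ?f x" for x using one_minus_cos_le[of x] by simp
  \<comment> \<open>On the interval from 1 to 2 the integrand is bounded below by \<open>m > 0\<close>.\<close>
  define m where "m = 2 powr (-a - 1) * (1 - cos 1)"
  have m: "0 < m" using cos_monotone_0_pi[of 0 1] pi_ge_two by (simp add: m_def)
  have i12: "?f integrable_on {1..2}"
    by (intro integrable_continuous_interval continuous_intros) auto
  have "m = integral {1..2::real} (\<lambda>_. m)" by simp
  also have "\<dots> \<le> integral {1..2} ?f"
  proof (rule integral_le)
    fix x :: real assume x: "x \<in> {1..2}"
    have "cos x \<le> cos 1" using x pi_ge_two by (intro cos_monotone_0_pi_le) auto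
    moreover have "2 powr (-a - 1) \<le> x powr (-a - 1)" using x assms by (intro powr_mono2') auto
    moreover have "0 \<le> 1 - cos (1::real)" by simp
    ultimately show "m \<le> ?f x" unfolding m_def by (intro mult_mono) auto
  qed (use i12 in auto)
  also have "\<dots> \<le> integral {0<..} ?f"
    by (rule integral_subset_le) (use i i12 nn in auto)
  finally show ?thesis using m by (simp add: cos_mellin_def)
qed

text \<open>
  Integration by parts with the primitive \<open>1 - cos x\<close> of \<open>sin x\<close>. The boundary term
  \<open>x powr (-a) * (1 - cos x)\<close> vanishes at \<open>0\<close> since \<open>a < 2\<close> and at infinity since \<open>0 < a\<close>.
\<close>

lemma powr_sin_has_integral:
  assumes a: "0 < a" "a < 2"
  shows "((\<lambda>x. x powr (-a) * sin x) has_integral a * cos_mellin a) {0<..}"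
proof -
  define F where "F x = x powr (-a) * (1 - cos x)" for x :: real
  define F' where "F' x = -a * (x powr (-a - 1) * (1 - cos x)) + x powr (-a) * sin x" for x :: real
  have Fb: "\<bar>F x\<bar> \<le> x powr (2 - a)" "\<bar>F x\<bar> \<le> 2 * x powr (-a)" if "0 \<le> x" for x
  proof -
    have F0: "\<bar>F x\<bar> = F x" using one_minus_cos_le[of x] by (simp add: F_def)
    have "F x \<le> x powr (-a) * x powr 2"
      unfolding F_def using order_trans[OF one_minus_cos_le(3), of x "x\<^sup>2"] that
      by (intro mult_left_mono) (auto simp: powr_numeral)
    then show "\<bar>F x\<bar> \<le> x powr (2 - a)" by (simp add: F0 powr_add[symmetric])
    have "F x \<le> x powr (-a) * 2"
      unfolding F_def using one_minus_cos_le(2)[of x] by (intro mult_left_mono) auto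
    then show "\<bar>F x\<bar> \<le> 2 * x powr (-a)" by (simp add: F0)
  qed
  have F0: "F 0 = 0" by (simp add: F_def)
  have lim0: "(F \<longlongrightarrow> 0) (at 0 within {0..b})" for b
  proof (rule Lim_null_comparison)
    show "\<forall>\<^sub>F x in at 0 within {0..b}. norm (F x) \<le> x powr (2 - a)"
      using Fb(1) by (auto simp: eventually_at_filter)
    have "((\<lambda>x. x powr (2 - a)) \<longlongrightarrow> 0 powr (2 - a)) (at 0 within {0..b})"
      using a by (intro tendsto_powr' tendsto_intros) (auto simp: eventually_at_filter)
    then show "((\<lambda>x. x powr (2 - a)) \<longlongrightarrow> 0) (at 0 within {0..b})" by simp
  qed
  have cont: "continuous_on {0..b} F" for b
  proof (rule continuous_on_eq_continuous_within[THEN iffD2], rule ballI)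
    fix x assume x: "x \<in> {0..b}"
    show "continuous (at x within {0..b}) F"
    proof (cases "x = 0")
      case True
      then show ?thesis using lim0 by (simp add: continuous_within F0)
    next
      case False
      then have "isCont F x" unfolding F_def by (intro continuous_intros) auto
      then show ?thesis by (rule continuous_at_imp_continuous_at_within)
    qed
  qed
  have der: "(F has_real_derivative F' x) (at x)" if "0 < x" for x
    unfolding F_def F'_def using that
    by (auto intro!: derivative_eq_intros)
  have int_b: "(F' has_integral F b) {0..b}" if "0 \<le> b" for b
  proof -
    have "(F' has_integral F b - F 0) {0..b}"
      by (rule fundamental_theorem_of_calculus_interior[OF that cont])
        (use der in \<open>auto simp: has_real_derivative_iff_has_vector_derivative[symmetric]\<close>)
    then show ?thesis by (simp add: F0)
  qed
  have "(F' has_integral 0) {0<..}"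
  proof (subst has_integral', intro allI impI)
    fix e :: real assume e: "0 < e"
    have "(F \<longlongrightarrow> 0) at_top"
    proof (rule Lim_null_comparison)
      show "\<forall>\<^sub>F x in at_top. norm (F x) \<le> 2 * x powr (-a)"
        using Fb(2) by (auto intro: eventually_at_top_linorderI[of 0])
      have "((\<lambda>x. 2 * x powr (-a)) \<longlongrightarrow> 2 * 0) at_top"
        using a by (intro tendsto_intros tendsto_neg_powr filterlim_ident) auto
      then show "((\<lambda>x. 2 * x powr (-a)) \<longlongrightarrow> 0) at_top" by simp
    qed
    then have "\<forall>\<^sub>F x in at_top. \<bar>F x\<bar> < e" using e by (auto dest: tendstoD simp: dist_real_def)
    then obtain B where B: "\<And>x. B \<le> x \<Longrightarrow> \<bar>F x\<bar> < e" by (auto simp: eventually_at_top_linorder)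
    show "\<exists>B>0. \<forall>l r. ball 0 B \<subseteq> cbox l r \<longrightarrow>
        (\<exists>z. ((\<lambda>x. if x \<in> {0<..} then F' x else 0) has_integral z) (cbox l r) \<and> norm (z - 0) < e)"
    proof (rule exI[of _ "\<bar>B\<bar> + 1"], intro conjI allI impI)
      fix l r :: real assume sub: "ball 0 (\<bar>B\<bar> + 1) \<subseteq> cbox l r"
      have "\<bar>B\<bar> \<in> ball 0 (\<bar>B\<bar> + 1)" "0 \<in> ball 0 (\<bar>B\<bar> + 1)" by auto
      then have lr: "l \<le> 0" "\<bar>B\<bar> \<le> r" using sub by (auto simp: subset_iff)
      have "((\<lambda>x. if x \<in> {0..r} then F' x else 0) has_integral F r) {l..r}"
        using lr int_b[of r] by (subst has_integral_restrict) auto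
      then have "((\<lambda>x. if x \<in> {0<..} then F' x else 0) has_integral F r) {l..r}"
        by (rule has_integral_eq[rotated]) (auto simp: F'_def)
      then show "\<exists>z. ((\<lambda>x. if x \<in> {0<..} then F' x else 0) has_integral z) (cbox l r) \<and> norm (z - 0) < e"
        using B[of r] lr by (intro exI[of _ "F r"]) auto
    qed simp
  qed
  moreover have "((\<lambda>x. a * (x powr (-a - 1) * (1 - cos x))) has_integral a * cos_mellin a) {0<..}"
    unfolding cos_mellin_def using cos_mellin_integrable[OF a]
    by (intro has_integral_mult_right integrable_integral) (simp add: absolutely_integrable_on_def)
  ultimately have "((\<lambda>x. F' x + a * (x powr (-a - 1) * (1 - cos x))) has_integral 0 + a * cos_mellin a) {0<..}"
    by (rule has_integral_add)
  then show ?thesis by (simp add: F'_def)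
qed

lemma cos_mellin_lipschitz:
  assumes ab: "a \<in> {c..d}" "b \<in> {c..d}" and e: "0 < \<eta>" "\<eta> < c" "d + \<eta> < 2"
  shows "\<bar>cos_mellin a - cos_mellin b\<bar> \<le> 2 / \<eta> * (cos_mellin (c - \<eta>) + cos_mellin (d + \<eta>)) * \<bar>a - b\<bar>"
proof -
  let ?f = "\<lambda>a x::real. x powr (-a - 1) * (1 - cos x)"
  have i: "?f t integrable_on {0<..}" if "t \<in> {c - \<eta>..d + \<eta>}" for t
    using cos_mellin_integrable[of t] that e by (auto simp: absolutely_integrable_on_def)
  have cd: "c \<le> d" using ab by auto
  let ?g = "\<lambda>x. (2 / \<eta> * \<bar>a - b\<bar>) * (?f (c - \<eta>) x + ?f (d + \<eta>) x)"
  have "norm (integral {0<..} (\<lambda>x. ?f a x - ?f b x)) \<le> integral {0<..} ?g"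
  proof (rule integral_norm_bound_integral)
    show "(\<lambda>x. ?f a x - ?f b x) integrable_on {0<..}" using ab e by (intro integrable_diff i) auto
    show "?g integrable_on {0<..}" using e cd by (intro integrable_on_mult_right integrable_add i) auto
    fix x :: real assume x: "x \<in> {0<..}"
    let ?Q = "x powr (-(c - \<eta>) - 1) + x powr (-(d + \<eta>) - 1)"
    have "norm (x powr (-a - 1) - x powr (-b - 1)) \<le> (2 / \<eta> * ?Q) * norm (a - b)"
    proof (rule field_differentiable_bound[where S = "{c..d}" and f = "\<lambda>t. x powr (-t - 1)" and f' = "\<lambda>t. - (x powr (-t - 1) * ln x)"])
      fix t assume t: "t \<in> {c..d}"
      show "((\<lambda>t. x powr (-t - 1)) has_field_derivative - (x powr (-t - 1) * ln x)) (at t within {c..d})"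
        unfolding powr_def using x by (auto intro!: derivative_eq_intros)
      have "norm (- (x powr (-t - 1) * ln x)) = x powr (-t - 1) * \<bar>ln x\<bar>" by (simp add: abs_mult)
      also have "\<dots> \<le> (x powr (-t - 1 + \<eta>) + x powr (-t - 1 - \<eta>)) / \<eta>"
        using x e by (intro powr_mult_ln_le) auto
      also have "\<dots> \<le> (?Q + ?Q) / \<eta>"
      proof (intro divide_right_mono add_mono)
        show "x powr (-t - 1 + \<eta>) \<le> ?Q"
          using powr_between_le_sum[of x "-(d + \<eta>) - 1" "-t - 1 + \<eta>" "-(c - \<eta>) - 1"] x t e by simp
        show "x powr (-t - 1 - \<eta>) \<le> ?Q"
          using powr_between_le_sum[of x "-(d + \<eta>) - 1" "-t - 1 - \<eta>" "-(c - \<eta>) - 1"] x t e by simp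
      qed (use e in auto)
      finally show "norm (- (x powr (-t - 1) * ln x)) \<le> 2 / \<eta> * ?Q" by simp
    qed (use ab in auto)
    then have "norm (x powr (-a - 1) - x powr (-b - 1)) * (1 - cos x) \<le> ((2 / \<eta> * ?Q) * norm (a - b)) * (1 - cos x)"
      using one_minus_cos_le[of x] by (intro mult_right_mono) auto
    moreover have "?f a x - ?f b x = (x powr (-a - 1) - x powr (-b - 1)) * (1 - cos x)"
      by (simp add: left_diff_distrib)
    then have "norm (?f a x - ?f b x) = norm (x powr (-a - 1) - x powr (-b - 1)) * (1 - cos x)"
      using one_minus_cos_le[of x] by (simp only: norm_mult) simp
    moreover have "((2 / \<eta> * ?Q) * norm (a - b)) * (1 - cos x) = ?g x"
      by (simp only: distrib_left distrib_right mult.assoc mult.commute mult.left_commute real_norm_def)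
    ultimately show "norm (?f a x - ?f b x) \<le> ?g x" by (simp only:)
  qed
  also have "integral {0<..} (\<lambda>x. ?f a x - ?f b x) = cos_mellin a - cos_mellin b"
    unfolding cos_mellin_def using ab e by (intro integral_diff i) auto
  also have "integral {0<..} ?g = (2 / \<eta> * \<bar>a - b\<bar>) * (cos_mellin (c - \<eta>) + cos_mellin (d + \<eta>))"
    unfolding cos_mellin_def
    by (subst integral_mult_right, subst integral_add) (rule i refl; use e cd in simp)+
  finally show ?thesis by (simp only: mult.commute mult.left_commute mult.assoc real_norm_def)
qed

text \<open>
  A bound on the increments from the one point \<open>u\<close>. It is weaker than differentiability at \<open>u\<close> but still
  stable under products and under composition with differentiable functions, and it can be checked
  for \<open>cos_mellin\<close> without differentiating under the integral.
\<close>

definition lipschitz_at :: "(real \<Rightarrow> real) \<Rightarrow> real \<Rightarrow> bool" where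
  "lipschitz_at g u \<longleftrightarrow> (\<exists>L. \<forall>\<^sub>F v in at u. \<bar>g v - g u\<bar> \<le> L * \<bar>v - u\<bar>)"

lemma lipschitz_at_tendsto:
  assumes "lipschitz_at g u"
  shows "(g \<longlongrightarrow> g u) (at u)"
proof -
  obtain L where L: "\<forall>\<^sub>F v in at u. \<bar>g v - g u\<bar> \<le> L * \<bar>v - u\<bar>"
    using assms by (auto simp: lipschitz_at_def)
  have "((\<lambda>v. L * \<bar>v - u\<bar>) \<longlongrightarrow> L * \<bar>u - u\<bar>) (at u)" by (intro tendsto_intros)
  then have "((\<lambda>v. L * \<bar>v - u\<bar>) \<longlongrightarrow> 0) (at u)" by simp
  then have "((\<lambda>v. g v - g u) \<longlongrightarrow> 0) (at u)"
    by (rule Lim_null_comparison[rotated]) (use L in simp)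
  then show ?thesis by (simp add: LIM_zero_iff)
qed

lemma lipschitz_at_compose:
  assumes D: "(\<phi> has_real_derivative D) (at (g u))" and g: "lipschitz_at g u"
  shows "lipschitz_at (\<lambda>v. \<phi> (g v)) u"
proof -
  obtain L where L: "\<forall>\<^sub>F v in at u. \<bar>g v - g u\<bar> \<le> L * \<bar>v - u\<bar>"
    using g by (auto simp: lipschitz_at_def)
  have "((\<lambda>x. \<bar>(\<phi> x - \<phi> (g u)) / (x - g u)\<bar>) \<longlongrightarrow> \<bar>D\<bar>) (at (g u))"
    using D unfolding has_field_derivative_iff by (rule tendsto_rabs)
  then have "\<forall>\<^sub>F x in at (g u). \<bar>(\<phi> x - \<phi> (g u)) / (x - g u)\<bar> < \<bar>D\<bar> + 1"
    by (rule order_tendstoD) simp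
  then have "\<forall>\<^sub>F x in nhds (g u). \<bar>\<phi> x - \<phi> (g u)\<bar> \<le> (\<bar>D\<bar> + 1) * \<bar>x - g u\<bar>"
    unfolding eventually_at_filter by eventually_elim (auto simp: field_simps abs_mult)
  then have "\<forall>\<^sub>F v in at u. \<bar>\<phi> (g v) - \<phi> (g u)\<bar> \<le> (\<bar>D\<bar> + 1) * \<bar>g v - g u\<bar>"
    using lipschitz_at_tendsto[OF g] by (rule eventually_compose_filterlim)
  with L have "\<forall>\<^sub>F v in at u. \<bar>\<phi> (g v) - \<phi> (g u)\<bar> \<le> (\<bar>D\<bar> + 1) * L * \<bar>v - u\<bar>"
  proof eventually_elim
    case (elim v)
    have "(\<bar>D\<bar> + 1) * \<bar>g v - g u\<bar> \<le> (\<bar>D\<bar> + 1) * (L * \<bar>v - u\<bar>)" using elim(1) by (intro mult_left_mono) auto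
    with elim(2) show ?case by simp
  qed
  then show ?thesis unfolding lipschitz_at_def by blast
qed

lemma lipschitz_at_ident: "lipschitz_at (\<lambda>v. v) u"
  unfolding lipschitz_at_def by (intro exI[of _ 1]) auto

lemmas lipschitz_at_differentiable = lipschitz_at_compose[OF _ lipschitz_at_ident]

lemma lipschitz_at_mult:
  assumes f: "lipschitz_at f u" and g: "lipschitz_at g u"
  shows "lipschitz_at (\<lambda>v. f v * g v) u"
proof -
  obtain L where L: "\<forall>\<^sub>F v in at u. \<bar>f v - f u\<bar> \<le> L * \<bar>v - u\<bar>"
    using f by (auto simp: lipschitz_at_def)
  obtain K where K: "\<forall>\<^sub>F v in at u. \<bar>g v - g u\<bar> \<le> K * \<bar>v - u\<bar>"
    using g by (auto simp: lipschitz_at_def)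
  have "\<forall>\<^sub>F v in at u. \<bar>f v\<bar> < \<bar>f u\<bar> + 1"
    by (rule order_tendstoD(2)[OF tendsto_rabs[OF lipschitz_at_tendsto[OF f]]]) simp
  with L K have "\<forall>\<^sub>F v in at u. \<bar>f v * g v - f u * g u\<bar> \<le> ((\<bar>f u\<bar> + 1) * K + \<bar>g u\<bar> * L) * \<bar>v - u\<bar>"
  proof eventually_elim
    case (elim v)
    have "\<bar>f v * g v - f u * g u\<bar> = \<bar>f v * (g v - g u) + g u * (f v - f u)\<bar>" by (simp add: algebra_simps)
    also have "\<dots> \<le> \<bar>f v\<bar> * \<bar>g v - g u\<bar> + \<bar>g u\<bar> * \<bar>f v - f u\<bar>" by (rule order_trans[OF abs_triangle_ineq]) (simp only: abs_mult order_refl)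
    also have "\<dots> \<le> (\<bar>f u\<bar> + 1) * (K * \<bar>v - u\<bar>) + \<bar>g u\<bar> * (L * \<bar>v - u\<bar>)"
      using elim by (intro add_mono mult_mono) auto
    finally show ?case by (simp add: algebra_simps)
  qed
  then show ?thesis unfolding lipschitz_at_def by blast
qed

lemma C_const_eq:
  assumes "0 < a" "a < 2"
  shows "C_const a = inverse (a * cos_mellin a)"
  unfolding C_const_def using integral_unique[OF powr_sin_has_integral[OF assms]] by simp

lemma lipschitz_at_normalisation:
  assumes A: "\<And>v. A v \<in> {c..d}" and cd: "0 < c" "d < 2"
    and A': "(A has_real_derivative A') (at u)" and b': "(b has_real_derivative b') (at u)"
  shows "lipschitz_at (\<lambda>v. b v * C_const (A v) powr (1 / A v)) u"
proof -
  have c2: "0 < A v" "A v < 2" for v using A[of v] cd by auto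
  have lA: "lipschitz_at A u" by (rule lipschitz_at_differentiable[OF A'])
  \<comment> \<open>The exponents \<open>c - \<eta>\<close> and \<open>d + \<eta>\<close> stay inside the interval from 0 to 2 where \<open>cos_mellin\<close> converges.\<close>
  define \<eta> where "\<eta> = min c (2 - d) / 2"
  have e: "0 < \<eta>" "\<eta> < c" "d + \<eta> < 2" using cd by (auto simp: \<eta>_def min_def field_simps)
  have lJ: "lipschitz_at (\<lambda>v. cos_mellin (A v)) u"
  proof -
    define K where "K = 2 / \<eta> * (cos_mellin (c - \<eta>) + cos_mellin (d + \<eta>))"
    have K0: "0 \<le> K" unfolding K_def using e cd A[of u]
      by (intro mult_nonneg_nonneg add_nonneg_nonneg less_imp_le[OF cos_mellin_pos]) auto
    obtain L where "\<forall>\<^sub>F v in at u. \<bar>A v - A u\<bar> \<le> L * \<bar>v - u\<bar>"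
      using lA by (auto simp: lipschitz_at_def)
    then have "\<forall>\<^sub>F v in at u. \<bar>cos_mellin (A v) - cos_mellin (A u)\<bar> \<le> K * L * \<bar>v - u\<bar>"
    proof eventually_elim
      case (elim v)
      have "\<bar>cos_mellin (A v) - cos_mellin (A u)\<bar> \<le> K * \<bar>A v - A u\<bar>"
        unfolding K_def by (rule cos_mellin_lipschitz[OF A A e])
      also have "\<dots> \<le> K * (L * \<bar>v - u\<bar>)" using elim K0 by (intro mult_left_mono)
      finally show ?case by simp
    qed
    then show ?thesis unfolding lipschitz_at_def by blast
  qed
  have pos: "0 < A v * cos_mellin (A v)" for v using c2[of v] cos_mellin_pos by simp
  have 1: "lipschitz_at (\<lambda>v. ln (A v * cos_mellin (A v))) u"
    by (rule lipschitz_at_compose[OF DERIV_ln lipschitz_at_mult[OF lA lJ]]) (rule pos)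
  have "((\<lambda>v. - 1 / A v) has_real_derivative A' / (A u)\<^sup>2) (at u)"
    using A' c2[of u] by (auto intro!: derivative_eq_intros simp: power2_eq_square)
  then have 2: "lipschitz_at (\<lambda>v. - 1 / A v) u" by (rule lipschitz_at_differentiable)
  have "lipschitz_at (\<lambda>v. b v * exp (- 1 / A v * ln (A v * cos_mellin (A v)))) u"
    by (rule lipschitz_at_mult[OF lipschitz_at_differentiable[OF b'] lipschitz_at_compose[OF DERIV_exp lipschitz_at_mult[OF 2 1]]])
  moreover have "exp (- 1 / A v * ln (A v * cos_mellin (A v))) = C_const (A v) powr (1 / A v)" for v
    using pos[of v] c2[of v] by (simp add: C_const_eq[OF c2] powr_def ln_inverse less_imp_neq[OF cos_mellin_pos[OF c2], symmetric]
        del: inverse_mult_distrib)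
  ultimately show ?thesis by simp
qed

section \<open>Suprema over an interval and lower integrals\<close>

text \<open>
  For functions that are not measurable the nonnegative integral is a lower integral, which is only
  superadditive in general. If one summand is measurable, it can be subtracted from every simple
  function below the sum. This is applied to the supremum of the derivative, whose measurability is
  not obvious.
\<close>

lemma nn_integral_add_le:
  assumes g: "g \<in> borel_measurable M"
  shows "(\<integral>\<^sup>+x. f x + g x \<partial>M) \<le> (\<integral>\<^sup>+x. f x \<partial>M) + (\<integral>\<^sup>+x. g x \<partial>M)"
proof (cases "(\<integral>\<^sup>+x. g x \<partial>M) = \<infinity>")
  case False
  note [measurable] = g
  have gfin: "AE x in M. g x \<noteq> \<infinity>" using False by (intro nn_integral_PInf_AE) auto
  show ?thesis
    unfolding nn_integral_def[of M "\<lambda>x. f x + g x"]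
  proof (rule SUP_least, safe)
    fix s assume s: "simple_function M s" "s \<le> (\<lambda>x. f x + g x)"
    have [measurable]: "s \<in> borel_measurable M" using s(1) by (rule borel_measurable_simple_function)
    have "integral\<^sup>S M s = (\<integral>\<^sup>+x. s x \<partial>M)" using s(1) by (rule nn_integral_eq_simple_integral[symmetric])
    also have "\<dots> \<le> (\<integral>\<^sup>+x. (s x - g x) + g x \<partial>M)"
    proof (rule nn_integral_mono)
      fix x
      show "s x \<le> (s x - g x) + g x"
        by (cases "g x \<le> s x") (simp_all add: diff_add_cancel_ennreal add_increasing)
    qed
    also have "\<dots> = (\<integral>\<^sup>+x. s x - g x \<partial>M) + (\<integral>\<^sup>+x. g x \<partial>M)"
      by (rule nn_integral_add) auto
    also have "(\<integral>\<^sup>+x. s x - g x \<partial>M) \<le> (\<integral>\<^sup>+x. f x \<partial>M)"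
    proof (rule nn_integral_mono_AE)
      show "AE x in M. s x - g x \<le> f x"
        using gfin by eventually_elim (use s(2) in \<open>auto simp: le_fun_def ennreal_minus_le_iff add.commute\<close>)
    qed
    finally show "integral\<^sup>S M s \<le> (\<integral>\<^sup>+x. f x \<partial>M) + (\<integral>\<^sup>+x. g x \<partial>M)" by simp
  qed
qed simp

lemma SUP_ball_eq_SUP_rat:
  fixes \<phi> :: "real \<Rightarrow> real"
  assumes "continuous_on (ball u \<epsilon>) \<phi>"
  shows "(SUP w\<in>ball u \<epsilon>. ennreal (\<phi> w)) = (SUP w\<in>ball u \<epsilon> \<inter> \<rat>. ennreal (\<phi> w))"
proof (rule antisym)
  show "(SUP w\<in>ball u \<epsilon>. ennreal (\<phi> w)) \<le> (SUP w\<in>ball u \<epsilon> \<inter> \<rat>. ennreal (\<phi> w))" (is "_ \<le> ?S")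
  proof (rule SUP_least)
    fix w assume w: "w \<in> ball u \<epsilon>"
    show "ennreal (\<phi> w) \<le> ?S"
    proof (rule ccontr)
      assume "\<not> ennreal (\<phi> w) \<le> ?S"
      then have less: "?S < ennreal (\<phi> w)" by simp
      have "isCont \<phi> w" using assms w by (simp add: continuous_on_eq_continuous_at)
      then have "((\<lambda>x. ennreal (\<phi> x)) \<longlongrightarrow> ennreal (\<phi> w)) (nhds w)"
        by (intro tendsto_ennrealI) (simp add: continuous_at tendsto_at_iff_tendsto_nhds)
      then have "\<forall>\<^sub>F x in nhds w. ?S < ennreal (\<phi> x)" using less by (rule order_tendstoD(1))
      moreover have "\<forall>\<^sub>F x in nhds w. x \<in> ball u \<epsilon>" using w by (intro eventually_nhds_in_open) auto
      ultimately have "\<forall>\<^sub>F x in nhds w. ?S < ennreal (\<phi> x) \<and> x \<in> ball u \<epsilon>" by eventually_elim simp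
      then obtain e where e: "0 < e" "\<And>x. dist x w < e \<Longrightarrow> ?S < ennreal (\<phi> x) \<and> x \<in> ball u \<epsilon>"
        unfolding eventually_nhds_metric by blast
      obtain q where "q \<in> \<rat>" "w < q" "q < w + e" using Rats_dense_in_real[of w "w + e"] e by auto
      then have "?S < ennreal (\<phi> q)" "q \<in> ball u \<epsilon> \<inter> \<rat>" using e(2)[of q] by (auto simp: dist_real_def)
      then show False using SUP_upper[of q "ball u \<epsilon> \<inter> \<rat>" "\<lambda>w. ennreal (\<phi> w)"] by (simp add: leD)
    qed
  qed
qed (rule SUP_subset_mono; auto)

lemma isCont_mult_ln_abs: "isCont (\<lambda>x::real. x * ln \<bar>x\<bar>) x"
proof (cases "x = 0")
  case True
  have "((\<lambda>x::real. x * ln \<bar>x\<bar>) \<longlongrightarrow> 0) (at 0)"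
  proof (rule Lim_null_comparison)
    show "\<forall>\<^sub>F x::real in at 0. norm (x * ln \<bar>x\<bar>) \<le> (\<bar>x\<bar> powr (3/2) + \<bar>x\<bar> powr (1/2)) / (1/2)"
    proof (rule eventually_at_filter[THEN iffD2], rule always_eventually, safe)
      fix x :: real assume "x \<noteq> 0"
      then show "norm (x * ln \<bar>x\<bar>) \<le> (\<bar>x\<bar> powr (3/2) + \<bar>x\<bar> powr (1/2)) / (1/2)"
        using powr_mult_ln_le[of "\<bar>x\<bar>" "1/2" 1] by (simp add: abs_mult)
    qed
    have z: "((\<lambda>x::real. \<bar>x\<bar>) \<longlongrightarrow> 0) (at 0)"
      by (rule tendsto_rabs_zero) (rule tendsto_ident_at)
    have "((\<lambda>x::real. \<bar>x\<bar> powr e) \<longlongrightarrow> 0) (at 0)" if "0 < e" for e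
      using z that by (intro tendsto_zero_powrI[where b=e]) auto
    then have "((\<lambda>x::real. (\<bar>x\<bar> powr (3/2) + \<bar>x\<bar> powr (1/2)) / (1/2)) \<longlongrightarrow> (0 + 0) / (1/2)) (at 0)"
      by (intro tendsto_intros) auto
    then show "((\<lambda>x::real. (\<bar>x\<bar> powr (3/2) + \<bar>x\<bar> powr (1/2)) / (1/2)) \<longlongrightarrow> 0) (at 0)" by simp
  qed
  then show ?thesis using True by (simp add: isCont_def)
qed (auto intro!: continuous_intros)

text \<open>
  By continuity in the index the supremum may be restricted to rational indices.
\<close>

lemma borel_measurable_SUP_ball_AE:
  fixes \<phi> :: "real \<Rightarrow> 'e \<Rightarrow> real"
  assumes "\<And>w. \<phi> w \<in> borel_measurable m"
    and "AE x in m. continuous_on (ball u \<epsilon>) (\<lambda>w. \<phi> w x)"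
  obtains g where "g \<in> borel_measurable m" "AE x in m. (SUP w\<in>ball u \<epsilon>. ennreal (\<phi> w x)) = g x"
proof
  have "countable (ball u \<epsilon> \<inter> \<rat>)" by (rule countable_subset[OF _ countable_rat]) auto
  then show "(\<lambda>x. SUP w\<in>ball u \<epsilon> \<inter> \<rat>. ennreal (\<phi> w x)) \<in> borel_measurable m"
    using assms(1) by (intro borel_measurable_SUP) auto
  show "AE x in m. (SUP w\<in>ball u \<epsilon>. ennreal (\<phi> w x)) = (SUP w\<in>ball u \<epsilon> \<inter> \<rat>. ennreal (\<phi> w x))"
    using assms(2) by eventually_elim (rule SUP_ball_eq_SUP_rat)
qed

definition envelope :: "(real \<Rightarrow> real) \<Rightarrow> real \<Rightarrow> real \<Rightarrow> (real \<Rightarrow> 'e \<Rightarrow> real) \<Rightarrow> 'e \<Rightarrow> ennreal" where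
  "envelope \<alpha> u \<epsilon> \<phi> x = (SUP w\<in>ball u \<epsilon>. ennreal (\<bar>\<phi> w x\<bar> powr \<alpha> w))"

lemma locally_sup_integrable_ball:
  assumes "locally_sup_integrable m \<alpha> u g"
  obtains \<epsilon>0 C where "0 < \<epsilon>0" "C < \<infinity>"
    "\<And>\<epsilon> t. \<epsilon> \<le> \<epsilon>0 \<Longrightarrow> t \<in> ball u \<epsilon> \<Longrightarrow> (\<integral>\<^sup>+x. envelope \<alpha> u \<epsilon> (g t) x \<partial>m) \<le> C"
proof -
  obtain \<epsilon>0 where e: "0 < \<epsilon>0" and fin: "(SUP t\<in>ball u \<epsilon>0. \<integral>\<^sup>+x. envelope \<alpha> u \<epsilon>0 (g t) x \<partial>m) < \<infinity>" (is "?C < _")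
    using assms unfolding locally_sup_integrable_def envelope_def by blast
  have "(\<integral>\<^sup>+x. envelope \<alpha> u \<epsilon> (g t) x \<partial>m) \<le> ?C" if "\<epsilon> \<le> \<epsilon>0" "t \<in> ball u \<epsilon>" for \<epsilon> t
  proof -
    have sub: "ball u \<epsilon> \<subseteq> ball u \<epsilon>0" using that by auto
    have "(\<integral>\<^sup>+x. envelope \<alpha> u \<epsilon> (g t) x \<partial>m) \<le> (\<integral>\<^sup>+x. envelope \<alpha> u \<epsilon>0 (g t) x \<partial>m)"
      unfolding envelope_def by (intro nn_integral_mono SUP_subset_mono sub) auto
    also have "\<dots> \<le> ?C" using that sub by (intro SUP_upper) auto
    finally show ?thesis .
  qed
  with e fin show ?thesis by (rule that)
qed

lemma nn_integral_le_cmult: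
  assumes u [measurable]: "u \<in> borel_measurable M" and c: "0 < c"
    and le: "AE x in M. u x \<le> ennreal c * W x"
  shows "(\<integral>\<^sup>+x. u x \<partial>M) \<le> ennreal c * (\<integral>\<^sup>+x. W x \<partial>M)"
proof -
  have cc: "ennreal c * (ennreal (1 / c) * a) = a" "ennreal (1 / c) * (ennreal c * a) = a" for a
    using c by (simp_all add: mult.assoc[symmetric] ennreal_mult[symmetric])
  have "ennreal (1 / c) * (\<integral>\<^sup>+x. u x \<partial>M) = (\<integral>\<^sup>+x. ennreal (1 / c) * u x \<partial>M)"
    by (simp add: nn_integral_cmult)
  also have "\<dots> \<le> (\<integral>\<^sup>+x. W x \<partial>M)"
  proof (rule nn_integral_mono_AE)
    show "AE x in M. ennreal (1 / c) * u x \<le> W x"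
      using le by eventually_elim (metis cc(2) mult_left_mono zero_le)
  qed
  finally have "ennreal c * (ennreal (1 / c) * (\<integral>\<^sup>+x. u x \<partial>M)) \<le> ennreal c * (\<integral>\<^sup>+x. W x \<partial>M)"
    by (rule mult_left_mono) simp
  then show ?thesis by (simp only: cc)
qed

lemma le_enn2real: "ennreal a \<le> W \<Longrightarrow> W < \<top> \<Longrightarrow> 0 \<le> a \<Longrightarrow> a \<le> enn2real W"
  using enn2real_mono[of "ennreal a" W] by simp

section \<open>Perturbation of finite-dimensional convergence\<close>

lemma fd_vector_measurable [measurable]:
  fixes Y :: "real \<Rightarrow> 'a \<Rightarrow> real"
  assumes "\<And>t. Y t \<in> borel_measurable M"
  shows "fd_vector Y n s \<in> borel_measurable M"
  unfolding fd_vector_def[abs_def] using assms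
  by (intro measurable_coordinatewise_then_product) auto

lemma dist_fun_le:
  fixes x y :: "nat \<Rightarrow> real"
  assumes "\<And>i. \<bar>x i - y i\<bar> \<le> e"
  shows "dist x y \<le> 2 * e"
proof -
  have g: "(\<lambda>n. (1/2::real)^n * e) sums (2 * e)"
    using sums_mult2[OF geometric_sums[of "1/2::real"]] by simp
  have sm: "summable (\<lambda>n. (1/2::real)^n * min (dist (x (from_nat n)) (y (from_nat n))) 1)"
    by (rule summable_comparison_test'[of "\<lambda>n. (1/2)^n * e" 0])
       (use g assms in \<open>auto simp: sums_iff dist_real_def abs_mult intro!: min.coboundedI1\<close>)
  have "dist x y \<le> (\<Sum>n. (1/2::real)^n * e)"
    unfolding dist_fun_def using sm g assms
    by (intro suminf_le) (auto simp: sums_iff dist_real_def intro!: min.coboundedI1)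
  then show ?thesis using g by (simp add: sums_iff)
qed

text \<open>
  The values of \<open>fd_vector\<close> with coordinates bounded by \<open>K\<close> lie in this set, a product of compact
  intervals.
\<close>

lemma compact_box_fun: "compact {x :: nat \<Rightarrow> real. \<forall>i. x i \<in> (if i < n then {-K..K} else {0})}"
proof -
  have "compactin (product_topology (\<lambda>i. euclidean) UNIV) (PiE UNIV (\<lambda>i. if i < n then {-K..K} else {0::real}))"
    by (subst compactin_PiE) (auto simp: compactin_euclidean_iff)
  then show ?thesis
    by (simp add: euclidean_product_topology compactin_euclidean_iff PiE_UNIV_domain Pi_def)
qed

text \<open>
  Slutsky's theorem. The limit is tight, hence so is \<open>Z\<close> near the limit of the filter: outside an event of
  small probability its values stay in a compact box. On a slightly larger box the test function \<open>g\<close>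
  is uniformly continuous, so a perturbation that is small in probability changes the integral of \<open>g\<close>
  by little.
\<close>

lemma (in prob_space) fdd_converges_perturb:
  fixes Z W :: "real \<Rightarrow> real \<Rightarrow> 'a \<Rightarrow> real" and Z' :: "real \<Rightarrow> 'b \<Rightarrow> real"
  assumes N: "real_process N Z'"
    and Zm: "\<And>\<rho> t. Z \<rho> t \<in> borel_measurable M" and Wm: "\<And>\<rho> t. W \<rho> t \<in> borel_measurable M"
    and conv: "fdd_converges M Z N Z' F"
    and close: "\<And>t e. 0 < e \<Longrightarrow> ((\<lambda>\<rho>. prob {\<omega> \<in> space M. e < \<bar>W \<rho> t \<omega> - Z \<rho> t \<omega>\<bar>}) \<longlongrightarrow> 0) F"
  shows "fdd_converges M W N Z' F"
  unfolding fdd_converges_def conv_in_distribution_def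
proof (intro allI impI, elim conjE)
  fix n s and g :: "(nat \<Rightarrow> real) \<Rightarrow> real"
  assume g: "continuous_on UNIV g" and bg: "bounded (range g)"
  interpret N: prob_space N using N by (simp add: real_process_def)
  note [measurable] = Zm Wm
  have [measurable]: "Z' t \<in> borel_measurable N" for t using N by (simp add: real_process_def)
  let ?Z = "\<lambda>\<rho>. fd_vector (Z \<rho>) n s" and ?W = "\<lambda>\<rho>. fd_vector (W \<rho>) n s" and ?Z' = "fd_vector Z' n s"
  have [measurable]: "g \<in> borel_measurable borel" using g by (rule borel_measurable_continuous_onI)
  obtain B where B: "\<And>x. \<bar>g x\<bar> \<le> B" and B0: "0 < B"
    using bg unfolding bounded_pos by auto
  have convZ: "((\<lambda>\<rho>. \<integral>\<omega>. k (?Z \<rho> \<omega>) \<partial>M) \<longlongrightarrow> (\<integral>\<omega>. k (?Z' \<omega>) \<partial>N)) F"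
    if "continuous_on UNIV k" "bounded (range k)" for k :: "(nat \<Rightarrow> real) \<Rightarrow> real"
    using conv that unfolding fdd_converges_def conv_in_distribution_def by blast
  \<comment> \<open>Tightness is read off from a continuous test function that equals one outside the box of size \<open>K + 1\<close> and vanishes on the box of size \<open>K\<close>.\<close>
  define \<psi> :: "nat \<Rightarrow> (nat \<Rightarrow> real) \<Rightarrow> real" where "\<psi> K x = min 1 (\<Sum>i<n. max 0 (\<bar>x i\<bar> - real K))" for K x
  have \<psi>c: "continuous_on UNIV (\<psi> K)" for K unfolding \<psi>_def
    by (intro continuous_intros continuous_on_product_coordinates)
  have [measurable]: "\<psi> K \<in> borel_measurable borel" for K using \<psi>c by (rule borel_measurable_continuous_onI)
  have \<psi>b: "0 \<le> \<psi> K x" "\<psi> K x \<le> 1" for K x by (auto simp: \<psi>_def intro!: sum_nonneg)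
  have \<psi>br: "bounded (range (\<psi> K))" for K
    by (rule boundedI[of _ 1]) (use \<psi>b in auto)
  have \<psi>1: "\<psi> K x = 1" if "i < n" "real K + 1 < \<bar>x i\<bar>" for K x i
  proof -
    have "1 \<le> max 0 (\<bar>x i\<bar> - real K)" using that by auto
    also have "\<dots> \<le> (\<Sum>i<n. max 0 (\<bar>x i\<bar> - real K))"
      using that by (intro member_le_sum[of i _ "\<lambda>i. max 0 (\<bar>x i\<bar> - real K)"]) auto
    finally show ?thesis by (simp add: \<psi>_def)
  qed
  have tight: "(\<lambda>K. \<integral>\<omega>. \<psi> K (?Z' \<omega>) \<partial>N) \<longlonglongrightarrow> (\<integral>\<omega>. 0 \<partial>N)"
  proof (rule integral_dominated_convergence[where w="\<lambda>_. 1"])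
    have "(\<lambda>K. \<psi> K x) \<longlonglongrightarrow> 0" for x
    proof -
      obtain K0 :: nat where K0: "(\<Sum>i<n. \<bar>x i\<bar>) \<le> real K0" using real_arch_simple by blast
      have "\<psi> K x = 0" if "K \<ge> K0" for K
      proof -
        have "\<bar>x i\<bar> \<le> real K" if "i < n" for i
          using member_le_sum[of i "{..<n}" "\<lambda>i. \<bar>x i\<bar>"] K0 that \<open>K \<ge> K0\<close> by simp
        then have "(\<Sum>i<n. max 0 (\<bar>x i\<bar> - real K)) = 0" by (intro sum.neutral) auto
        then show ?thesis by (simp add: \<psi>_def)
      qed
      then show ?thesis by (intro tendsto_eventually eventually_sequentiallyI) auto
    qed
    then show "AE \<omega> in N. (\<lambda>K. \<psi> K (?Z' \<omega>)) \<longlonglongrightarrow> 0" by simp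
  qed (use \<psi>b in auto)
  have diff: "((\<lambda>\<rho>. (\<integral>\<omega>. g (?W \<rho> \<omega>) \<partial>M) - (\<integral>\<omega>. g (?Z \<rho> \<omega>) \<partial>M)) \<longlongrightarrow> 0) F"
  proof (rule tendstoI)
    fix e :: real assume e: "0 < e"
    define e' where "e' = e / 4"
    have e': "0 < e'" using e by (simp add: e'_def)
    have "\<forall>\<^sub>F K in sequentially. (\<integral>\<omega>. \<psi> K (?Z' \<omega>) \<partial>N) < e' / (2 * B)"
      by (rule order_tendstoD(2)[OF tight]) (use e' B0 in auto)
    then obtain K where K: "(\<integral>\<omega>. \<psi> K (?Z' \<omega>) \<partial>N) < e' / (2 * B)"
      using eventually_happens'[OF sequentially_bot] by blast
    define C where "C = {x :: nat \<Rightarrow> real. \<forall>i. x i \<in> (if i < n then {-(real K + 2)..real K + 2} else {0})}"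
    have "uniformly_continuous_on C g"
      unfolding C_def by (intro compact_uniformly_continuous continuous_on_subset[OF g] compact_box_fun) auto
    then obtain d where d: "0 < d" "\<And>x y. x \<in> C \<Longrightarrow> y \<in> C \<Longrightarrow> dist x y < d \<Longrightarrow> \<bar>g x - g y\<bar> < e'"
      using e' unfolding uniformly_continuous_on_def by (metis dist_real_def)
    define \<delta> where "\<delta> = min 1 (d / 3)"
    have \<delta>: "0 < \<delta>" "\<delta> \<le> 1" "2 * \<delta> < d" using d by (auto simp: \<delta>_def)
    define E where "E \<rho> i = {\<omega> \<in> space M. \<delta> < \<bar>W \<rho> (s i) \<omega> - Z \<rho> (s i) \<omega>\<bar>}" for \<rho> i
    have [measurable]: "E \<rho> i \<in> events" for \<rho> i unfolding E_def by measurable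
    have pw: "\<bar>g (?W \<rho> \<omega>) - g (?Z \<rho> \<omega>)\<bar> \<le> e' + 2 * B * \<psi> K (?Z \<rho> \<omega>) + 2 * B * (\<Sum>i<n. indicator (E \<rho> i) \<omega>)"
      if om: "\<omega> \<in> space M" for \<rho> \<omega>
    proof -
      have g2: "\<bar>g x - g y\<bar> \<le> 2 * B" for x y using B[of x] B[of y] by linarith
      have nn: "0 \<le> 2 * B * \<psi> K (?Z \<rho> \<omega>)" "0 \<le> 2 * B * (\<Sum>i<n. indicator (E \<rho> i) \<omega>)"
        using B0 \<psi>b by (auto intro!: mult_nonneg_nonneg sum_nonneg)
      consider (a) i where "i < n" "real K + 1 < \<bar>Z \<rho> (s i) \<omega>\<bar>" | (b) i where "i < n" "\<omega> \<in> E \<rho> i"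
        | (c) "\<forall>i<n. \<bar>Z \<rho> (s i) \<omega>\<bar> \<le> real K + 1" "\<forall>i<n. \<omega> \<notin> E \<rho> i"
        by (meson not_le)
      then show ?thesis
      proof cases
        case a
        then have "\<psi> K (?Z \<rho> \<omega>) = 1" by (intro \<psi>1[of i]) (auto simp: fd_vector_def)
        then show ?thesis using g2[of "?W \<rho> \<omega>" "?Z \<rho> \<omega>"] nn e' by simp
      next
        case b
        have "indicator (E \<rho> i) \<omega> \<le> (\<Sum>i<n. indicator (E \<rho> i) \<omega> :: real)"
          using b by (intro member_le_sum) auto
        then have "1 \<le> (\<Sum>i<n. indicator (E \<rho> i) \<omega> :: real)" using b by simp
        then have "2 * B * 1 \<le> 2 * B * (\<Sum>i<n. indicator (E \<rho> i) \<omega> :: real)" using B0 by (intro mult_left_mono) auto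
        then show ?thesis using g2[of "?W \<rho> \<omega>" "?Z \<rho> \<omega>"] nn e' by simp
      next
        case c
        then have cl: "\<bar>W \<rho> (s i) \<omega> - Z \<rho> (s i) \<omega>\<bar> \<le> \<delta>" if "i < n" for i
          using that om by (auto simp: E_def not_less)
        have "?Z \<rho> \<omega> \<in> C" using c(1) by (fastforce simp: C_def fd_vector_def)
        moreover have "?W \<rho> \<omega> \<in> C"
        proof -
          have "\<bar>W \<rho> (s i) \<omega>\<bar> \<le> real K + 2" if "i < n" for i
            using cl[OF that] c(1) that \<delta>(2) by (smt (verit))
          then show ?thesis by (fastforce simp: C_def fd_vector_def)
        qed
        moreover have "dist (?W \<rho> \<omega>) (?Z \<rho> \<omega>) \<le> 2 * \<delta>"
          using cl \<delta>(1) by (intro dist_fun_le) (auto simp: fd_vector_def)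
        ultimately have "\<bar>g (?W \<rho> \<omega>) - g (?Z \<rho> \<omega>)\<bar> < e'" using d(2) \<delta>(3) by auto
        then show ?thesis using nn by simp
      qed
    qed
    have ig: "integrable M (\<lambda>\<omega>. g (?W \<rho> \<omega>))" "integrable M (\<lambda>\<omega>. g (?Z \<rho> \<omega>))" for \<rho>
      using B by (auto intro!: integrable_const_bound[of _ B])
    have i\<psi>: "integrable M (\<lambda>\<omega>. \<psi> K (?Z \<rho> \<omega>))" for \<rho>
      using \<psi>b by (auto intro!: integrable_const_bound[of _ 1])
    have main: "\<bar>(\<integral>\<omega>. g (?W \<rho> \<omega>) \<partial>M) - (\<integral>\<omega>. g (?Z \<rho> \<omega>) \<partial>M)\<bar> \<le>
        e' + 2 * B * (\<integral>\<omega>. \<psi> K (?Z \<rho> \<omega>) \<partial>M) + 2 * B * (\<Sum>i<n. prob (E \<rho> i))" for \<rho>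
    proof -
      have "\<bar>(\<integral>\<omega>. g (?W \<rho> \<omega>) \<partial>M) - (\<integral>\<omega>. g (?Z \<rho> \<omega>) \<partial>M)\<bar> = \<bar>\<integral>\<omega>. g (?W \<rho> \<omega>) - g (?Z \<rho> \<omega>) \<partial>M\<bar>"
        using ig by simp
      also have "\<dots> \<le> (\<integral>\<omega>. \<bar>g (?W \<rho> \<omega>) - g (?Z \<rho> \<omega>)\<bar> \<partial>M)"
        by (rule integral_abs_bound)
      also have "\<dots> \<le> (\<integral>\<omega>. e' + 2 * B * \<psi> K (?Z \<rho> \<omega>) + 2 * B * (\<Sum>i<n. indicator (E \<rho> i) \<omega>) \<partial>M)"
        by (intro integral_mono pw) 
          (auto intro!: ig i\<psi> Bochner_Integration.integrable_add integrable_mult_right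
            Bochner_Integration.integrable_sum integrable_real_indicator simp: less_top[symmetric])
      also have "\<dots> = e' + 2 * B * (\<integral>\<omega>. \<psi> K (?Z \<rho> \<omega>) \<partial>M) + 2 * B * (\<Sum>i<n. prob (E \<rho> i))"
        by (simp add: i\<psi> prob_space integrable_real_indicator less_top[symmetric])
      finally show ?thesis .
    qed
    have "((\<lambda>\<rho>. e' + 2 * B * (\<integral>\<omega>. \<psi> K (?Z \<rho> \<omega>) \<partial>M) + 2 * B * (\<Sum>i<n. prob (E \<rho> i))) \<longlongrightarrow>
        e' + 2 * B * (\<integral>\<omega>. \<psi> K (?Z' \<omega>) \<partial>N) + 2 * B * (\<Sum>i<n. 0)) F"
      unfolding E_def by (intro tendsto_intros convZ \<psi>c \<psi>br close \<delta>)
    moreover have "e' + 2 * B * (\<integral>\<omega>. \<psi> K (?Z' \<omega>) \<partial>N) + 2 * B * (\<Sum>i<n. 0) < e"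
      using K B0 e by (simp add: e'_def field_simps)
    ultimately have "\<forall>\<^sub>F \<rho> in F. e' + 2 * B * (\<integral>\<omega>. \<psi> K (?Z \<rho> \<omega>) \<partial>M) + 2 * B * (\<Sum>i<n. prob (E \<rho> i)) < e"
      by (rule order_tendstoD(2))
    then show "\<forall>\<^sub>F \<rho> in F. dist ((\<integral>\<omega>. g (?W \<rho> \<omega>) \<partial>M) - (\<integral>\<omega>. g (?Z \<rho> \<omega>) \<partial>M)) 0 < e"
      by eventually_elim (use main in \<open>auto simp: dist_real_def intro: order_le_less_trans\<close>)
  qed
  show "((\<lambda>\<rho>. \<integral>\<omega>. g (?W \<rho> \<omega>) \<partial>M) \<longlongrightarrow> (\<integral>\<omega>. g (?Z' \<omega>) \<partial>N)) F"
    using tendsto_add[OF diff convZ[OF g bg]] by simp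
qed

section \<open>The field near the diagonal\<close>

text \<open>
  The coefficient of the sign in \<open>series_field\<close>, as a function of arrival time and mark. The factor \<open>r\<close>
  only rescales the arrival time (\<open>stable_kernel_eq\<close>).
\<close>

definition stable_kernel :: "(real \<Rightarrow> real) \<Rightarrow> ('e \<Rightarrow> real) \<Rightarrow> (real \<Rightarrow> real \<Rightarrow> 'e \<Rightarrow> real) \<Rightarrow> real \<Rightarrow> real \<Rightarrow> real \<times> 'e \<Rightarrow> real" where
  "stable_kernel \<alpha> r f t v z = fst z powr (-1 / \<alpha> v) * r (snd z) powr (1 / \<alpha> v) * f t v (snd z)"

lemma stable_kernel_eq:
  assumes "0 < y" "0 < r x"
  shows "stable_kernel \<alpha> r f t v (y, x) = (y / r x) powr (-1 / \<alpha> v) * f t v x"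
  using assms by (simp add: stable_kernel_def powr_divide powr_minus field_simps)

locale lepage_representation = prob_space M
  for M :: "'a measure" +
  fixes m :: "'e measure" and r :: "'e \<Rightarrow> real" and \<alpha> :: "real \<Rightarrow> real" and c d :: real
    and f :: "real \<Rightarrow> real \<Rightarrow> 'e \<Rightarrow> real"
    and \<Gamma> \<gamma> :: "nat \<Rightarrow> 'a \<Rightarrow> real" and V :: "nat \<Rightarrow> 'a \<Rightarrow> 'e" and mhat :: "'e measure"
  assumes mhat_eq: "mhat = density m (\<lambda>x. ennreal (1 / r x))"
    and r_measurable [measurable]: "r \<in> borel_measurable m"
    and r_pos: "\<And>x. x \<in> space m \<Longrightarrow> 0 < r x"
    and cd: "0 < c" "d < 2" and \<alpha>_in: "\<And>v. \<alpha> v \<in> {c..d}"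
    and f_in: "\<And>t v. f t v \<in> F_space (\<alpha> v) m"
    and \<Gamma>: "poisson_arrival_times M \<Gamma>" and V: "iid_with_law M mhat V" and signs: "iid_signs M \<gamma>"
    and indep: "independent_sequences M borel \<Gamma> mhat V borel \<gamma>"
begin

definition S :: "real \<Rightarrow> real \<Rightarrow> 'a \<Rightarrow> real" where
  "S t v \<omega> = (\<Sum>i. \<gamma> i \<omega> * stable_kernel \<alpha> r f t v (\<Gamma> i \<omega>, V i \<omega>))"

lemma series_field_eq:
  "series_field b \<alpha> r f \<gamma> \<Gamma> V t v \<omega> = b v * C_const (\<alpha> v) powr (1 / \<alpha> v) * S t v \<omega>"
  by (simp add: series_field_def S_def stable_kernel_def mult.assoc)

lemma f_measurable [measurable]: "f t v \<in> borel_measurable m"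
  using f_in[of t v] by (simp add: F_space_def)

lemma sets_mhat [measurable_cong]: "sets mhat = sets m"
  by (simp add: mhat_eq)

lemma stable_kernel_measurable [measurable]: "stable_kernel \<alpha> r f t v \<in> borel_measurable (borel \<Otimes>\<^sub>M mhat)"
  unfolding stable_kernel_def[abs_def] by measurable

lemma S_measurable [measurable]: "S t v \<in> borel_measurable M"
proof -
  note [measurable] = poisson_arrival_times_measurable[OF \<Gamma>] iid_with_law_measurable[OF V] iid_signs_measurable[OF signs]
  show ?thesis unfolding S_def[abs_def] by measurable
qed

text \<open>
  The integral over \<open>y\<close> at a fixed mark \<open>x\<close> is proportional to \<open>W x * r x\<close>, and the density \<open>1 / r x\<close> of the
  marks removes \<open>r x\<close>. The dominating function \<open>W\<close> need not be measurable, since the left-hand side is.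
\<close>

lemma truncated_integral_le:
  assumes g [measurable]: "g \<in> borel_measurable (borel \<Otimes>\<^sub>M mhat)"
    and pq: "1/2 < p" "1/2 < q" and K: "0 < K" and l: "0 < l"
    and le: "AE x in m. W x < \<top> \<longrightarrow> (\<forall>y>0. \<bar>g (y, x)\<bar> \<le>
      K * ((enn2real (W x) / (y / r x)) powr p + (enn2real (W x) / (y / r x)) powr q))"
  shows "(\<integral>\<^sup>+x. (\<integral>\<^sup>+y. ennreal (min 1 ((g (y, x) / l)\<^sup>2)) * indicator {0<..} y \<partial>lborel) \<partial>mhat)
    \<le> ennreal (tail_const p q (K / l)) * (\<integral>\<^sup>+x. W x \<partial>m)"
proof -
  let ?I = "\<lambda>x. \<integral>\<^sup>+y. ennreal (min 1 ((g (y, x) / l)\<^sup>2)) * indicator {0<..} y \<partial>lborel"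
  have [measurable]: "?I \<in> borel_measurable m" by measurable
  have tc: "0 < tail_const p q (K / l)" using pq K l by (intro tail_const_pos) auto
  have "(\<integral>\<^sup>+x. ?I x \<partial>mhat) = (\<integral>\<^sup>+x. ennreal (1 / r x) * ?I x \<partial>m)"
    unfolding mhat_eq by (rule nn_integral_density) measurable
  also have "\<dots> \<le> ennreal (tail_const p q (K / l)) * (\<integral>\<^sup>+x. W x \<partial>m)"
  proof (rule nn_integral_le_cmult[OF _ tc])
    show "AE x in m. ennreal (1 / r x) * ?I x \<le> ennreal (tail_const p q (K / l)) * W x"
      using le AE_space
    proof eventually_elim
      case (elim x)
      then have r: "0 < r x" by (simp add: r_pos)
      show ?case
      proof (cases "W x < \<top>")
        case True
        define w where "w = enn2real (W x)"
        have w: "0 \<le> w" "W x = ennreal w" using True by (auto simp: w_def)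
        have "?I x \<le> ennreal (tail_const p q (K / l)) * ennreal (w * r x)"
          by (rule nn_integral_truncated_square_le[OF pq K l]) (use elim(1) True w r in \<open>auto simp: w_def[symmetric]\<close>)
        then have "ennreal (1 / r x) * ?I x \<le> ennreal (1 / r x) * (ennreal (tail_const p q (K / l)) * ennreal (w * r x))"
          by (rule mult_left_mono) simp
        also have "\<dots> = ennreal (tail_const p q (K / l)) * W x"
          using r w tc by (simp add: ennreal_mult[symmetric])
        finally show ?thesis .
      next
        case False
        then show ?thesis using tc by (simp add: not_less top.extremum_unique ennreal_mult_top)
      qed
    qed
  qed measurable
  finally show ?thesis .
qed

lemma lepage_series_dominated:
  assumes g: "g \<in> borel_measurable (borel \<Otimes>\<^sub>M mhat)"
    and pq: "1/2 < p" "1/2 < q" and K: "0 < K" and l: "0 < l"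
    and le: "AE x in m. W x < \<top> \<longrightarrow> (\<forall>y>0. \<bar>g (y, x)\<bar> \<le>
      K * ((enn2real (W x) / (y / r x)) powr p + (enn2real (W x) / (y / r x)) powr q))"
    and W: "(\<integral>\<^sup>+x. W x \<partial>m) \<le> ennreal C" and C: "0 \<le> C"
  shows "AE \<omega> in M. summable (\<lambda>i. \<gamma> i \<omega> * g (\<Gamma> i \<omega>, V i \<omega>))"
    and "prob {\<omega> \<in> space M. l < \<bar>\<Sum>i. \<gamma> i \<omega> * g (\<Gamma> i \<omega>, V i \<omega>)\<bar>} \<le> tail_const p q (K / l) * C"
proof -
  have "(\<integral>\<^sup>+x. (\<integral>\<^sup>+y. ennreal (min 1 ((g (y, x) / l)\<^sup>2)) * indicator {0<..} y \<partial>lborel) \<partial>mhat)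
      \<le> ennreal (tail_const p q (K / l)) * (\<integral>\<^sup>+x. W x \<partial>m)" (is "?J \<le> _")
    by (rule truncated_integral_le[OF g pq K l le])
  also have "\<dots> \<le> ennreal (tail_const p q (K / l)) * ennreal C" using W by (rule mult_left_mono) simp
  also have "\<dots> = ennreal (tail_const p q (K / l) * C)"
    using C tail_const_nonneg[OF pq] by (simp add: ennreal_mult)
  finally have J: "?J \<le> ennreal (tail_const p q (K / l) * C)" .
  then have fin: "?J < \<infinity>" using le_less_trans ennreal_less_top by fastforce
  show "AE \<omega> in M. summable (\<lambda>i. \<gamma> i \<omega> * g (\<Gamma> i \<omega>, V i \<omega>))"
    by (rule lepage_series(1)[OF \<Gamma> V signs indep g l fin])
  have "emeasure M {\<omega> \<in> space M. l < \<bar>\<Sum>i. \<gamma> i \<omega> * g (\<Gamma> i \<omega>, V i \<omega>)\<bar>} \<le> ennreal (tail_const p q (K / l) * C)"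
    using lepage_series(2)[OF \<Gamma> V signs indep g l fin] J by (rule order_trans)
  then show "prob {\<omega> \<in> space M. l < \<bar>\<Sum>i. \<gamma> i \<omega> * g (\<Gamma> i \<omega>, V i \<omega>)\<bar>} \<le> tail_const p q (K / l) * C"
    using C tail_const_nonneg[OF pq] by (simp add: emeasure_eq_measure)
qed

lemma \<alpha>_pos: "0 < \<alpha> v" and \<alpha>_half: "1/2 < 1 / \<alpha> v"
  using \<alpha>_in[of v] cd by (auto simp: field_simps)

lemma stable_kernel_le:
  assumes "0 < y" "0 < r x" "\<bar>f t v x\<bar> powr \<alpha> v \<le> w"
  shows "\<bar>stable_kernel \<alpha> r f t v (y, x)\<bar> \<le> 1 * ((w / (y / r x)) powr (1 / \<alpha> v) + (w / (y / r x)) powr (1 / \<alpha> v))"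
proof -
  have "\<bar>stable_kernel \<alpha> r f t v (y, x)\<bar> = (y / r x) powr (-1 / \<alpha> v) * \<bar>f t v x\<bar>"
    using assms by (simp add: stable_kernel_eq abs_mult)
  also have "\<dots> \<le> (w / (y / r x)) powr (1 / \<alpha> v)"
    by (rule powr_neg_inverse_mult_le) (use assms \<alpha>_pos in auto)
  finally show ?thesis by (simp add: add_increasing2)
qed

lemma AE_summable_S: "AE \<omega> in M. summable (\<lambda>i. \<gamma> i \<omega> * stable_kernel \<alpha> r f t v (\<Gamma> i \<omega>, V i \<omega>))"
proof (rule lepage_series_dominated(1)[where p = "1 / \<alpha> v" and q = "1 / \<alpha> v" and K = 1 and l = 1
      and W = "\<lambda>x. ennreal (\<bar>f t v x\<bar> powr \<alpha> v)"])
  let ?J = "\<integral>\<^sup>+x. ennreal (\<bar>f t v x\<bar> powr \<alpha> v) \<partial>m"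
  have "?J < \<infinity>" using f_in[of t v] by (simp add: F_space_def)
  then show "?J \<le> ennreal (enn2real ?J)" by simp
  show "AE x in m. ennreal (\<bar>f t v x\<bar> powr \<alpha> v) < \<top> \<longrightarrow>
      (\<forall>y>0. \<bar>stable_kernel \<alpha> r f t v (y, x)\<bar> \<le> 1 * ((enn2real (ennreal (\<bar>f t v x\<bar> powr \<alpha> v)) / (y / r x)) powr (1 / \<alpha> v)
        + (enn2real (ennreal (\<bar>f t v x\<bar> powr \<alpha> v)) / (y / r x)) powr (1 / \<alpha> v)))"
    using AE_space by eventually_elim (intro impI allI stable_kernel_le; simp add: r_pos)
qed (use \<alpha>_half in auto)

lemma AE_S_diff:
  "AE \<omega> in M. S t v \<omega> - S t u \<omega> = (\<Sum>i. \<gamma> i \<omega> * (stable_kernel \<alpha> r f t v (\<Gamma> i \<omega>, V i \<omega>) - stable_kernel \<alpha> r f t u (\<Gamma> i \<omega>, V i \<omega>)))"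
  using AE_summable_S[of t v] AE_summable_S[of t u]
  by eventually_elim (simp add: S_def suminf_diff right_diff_distrib)

end

context lepage_representation
begin

text \<open>
  A common bound for the three quantities that enter \<open>power_kernel_increment_le\<close>; its integral is bounded
  near \<open>u\<close> by the integrability conditions on \<open>f\<close>, on its derivative and on \<open>f * ln \<bar>f\<bar>\<close>.
\<close>

definition joint_envelope :: "real \<Rightarrow> real \<Rightarrow> real \<Rightarrow> 'e \<Rightarrow> ennreal" where
  "joint_envelope u \<epsilon> t x = envelope \<alpha> u \<epsilon> (\<lambda>w x. deriv (\<lambda>v. f t v x) w) x +
     (envelope \<alpha> u \<epsilon> (f t) x + envelope \<alpha> u \<epsilon> (\<lambda>w x. f t w x * ln \<bar>f t w x\<bar>) x)"

lemma le_joint_envelope: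
  assumes "joint_envelope u \<epsilon> t x < \<top>" and v: "v \<in> ball u \<epsilon>"
  shows "\<bar>deriv (\<lambda>v. f t v x) v\<bar> powr \<alpha> v \<le> enn2real (joint_envelope u \<epsilon> t x)"
    and "\<bar>f t v x\<bar> powr \<alpha> v \<le> enn2real (joint_envelope u \<epsilon> t x)"
    and "\<bar>f t v x * ln \<bar>f t v x\<bar>\<bar> powr \<alpha> v \<le> enn2real (joint_envelope u \<epsilon> t x)"
proof -
  have up: "ennreal (\<bar>\<phi> v x\<bar> powr \<alpha> v) \<le> envelope \<alpha> u \<epsilon> \<phi> x" for \<phi> :: "real \<Rightarrow> 'e \<Rightarrow> real"
    unfolding envelope_def using v by (rule SUP_upper)
  show "\<bar>deriv (\<lambda>v. f t v x) v\<bar> powr \<alpha> v \<le> enn2real (joint_envelope u \<epsilon> t x)"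
    by (rule le_enn2real[OF _ assms(1)])
      (auto simp: joint_envelope_def intro!: add_increasing2 up[of "\<lambda>w x. deriv (\<lambda>v. f t v x) w"])
  show "\<bar>f t v x\<bar> powr \<alpha> v \<le> enn2real (joint_envelope u \<epsilon> t x)"
    by (rule le_enn2real[OF _ assms(1)])
      (auto simp: joint_envelope_def intro!: add_increasing[OF zero_le add_increasing2[OF zero_le up[of "f t"]]])
  show "\<bar>f t v x * ln \<bar>f t v x\<bar>\<bar> powr \<alpha> v \<le> enn2real (joint_envelope u \<epsilon> t x)"
    by (rule le_enn2real[OF _ assms(1)])
      (auto simp: joint_envelope_def intro!: add_increasing[OF zero_le add_increasing[OF zero_le up[of "\<lambda>w x. f t w x * ln \<bar>f t w x\<bar>"]]])
qed

lemma nn_integral_joint_envelope_le: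
  assumes diff: "AE x in m. \<forall>v\<in>ball u \<epsilon>. (\<lambda>v. f t v x) differentiable (at v)"
    and \<alpha>c: "continuous_on UNIV \<alpha>"
  shows "(\<integral>\<^sup>+x. joint_envelope u \<epsilon> t x \<partial>m) \<le> (\<integral>\<^sup>+x. envelope \<alpha> u \<epsilon> (\<lambda>w x. deriv (\<lambda>v. f t v x) w) x \<partial>m) +
     ((\<integral>\<^sup>+x. envelope \<alpha> u \<epsilon> (f t) x \<partial>m) + (\<integral>\<^sup>+x. envelope \<alpha> u \<epsilon> (\<lambda>w x. f t w x * ln \<bar>f t w x\<bar>) x \<partial>m))"
proof -
  have c1: "AE x in m. continuous_on (ball u \<epsilon>) (\<lambda>w. f t w x)"
    using diff
  proof eventually_elim
    case (elim x)
    then show ?case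
      by (auto intro!: continuous_at_imp_continuous_on differentiable_imp_continuous_within)
  qed
  have pw: "continuous_on (ball u \<epsilon>) (\<lambda>w. \<bar>\<phi> w\<bar> powr \<alpha> w)" if "continuous_on (ball u \<epsilon>) \<phi>" for \<phi>
    using that \<alpha>_pos by (intro continuous_on_powr' continuous_intros continuous_on_subset[OF \<alpha>c]) auto
  have c2: "AE x in m. continuous_on (ball u \<epsilon>) (\<lambda>w. \<bar>f t w x\<bar> powr \<alpha> w)"
    using c1 by eventually_elim (rule pw)
  have c3: "AE x in m. continuous_on (ball u \<epsilon>) (\<lambda>w. \<bar>f t w x * ln \<bar>f t w x\<bar>\<bar> powr \<alpha> w)"
    using c1
  proof eventually_elim
    case (elim x)
    have "continuous_on UNIV (\<lambda>x::real. x * ln \<bar>x\<bar>)"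
      by (intro continuous_at_imp_continuous_on ballI isCont_mult_ln_abs)
    from continuous_on_compose2[OF this elim] show ?case by (intro pw) auto
  qed
  obtain g2 where g2 [measurable]: "g2 \<in> borel_measurable m" "AE x in m. (SUP w\<in>ball u \<epsilon>. ennreal (\<bar>f t w x\<bar> powr \<alpha> w)) = g2 x"
    by (rule borel_measurable_SUP_ball_AE[OF _ c2]) auto
  obtain g3 where g3 [measurable]: "g3 \<in> borel_measurable m"
    "AE x in m. (SUP w\<in>ball u \<epsilon>. ennreal (\<bar>f t w x * ln \<bar>f t w x\<bar>\<bar> powr \<alpha> w)) = g3 x"
    by (rule borel_measurable_SUP_ball_AE[OF _ c3]) auto
  have i2: "(\<integral>\<^sup>+x. envelope \<alpha> u \<epsilon> (f t) x \<partial>m) = (\<integral>\<^sup>+x. g2 x \<partial>m)"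
    unfolding envelope_def by (rule nn_integral_cong_AE) (rule g2)
  have i3: "(\<integral>\<^sup>+x. envelope \<alpha> u \<epsilon> (\<lambda>w x. f t w x * ln \<bar>f t w x\<bar>) x \<partial>m) = (\<integral>\<^sup>+x. g3 x \<partial>m)"
    unfolding envelope_def by (rule nn_integral_cong_AE) (rule g3)
  have "(\<integral>\<^sup>+x. joint_envelope u \<epsilon> t x \<partial>m) =
      (\<integral>\<^sup>+x. envelope \<alpha> u \<epsilon> (\<lambda>w x. deriv (\<lambda>v. f t v x) w) x + (g2 x + g3 x) \<partial>m)"
  proof (rule nn_integral_cong_AE)
    show "AE x in m. joint_envelope u \<epsilon> t x = envelope \<alpha> u \<epsilon> (\<lambda>w x. deriv (\<lambda>v. f t v x) w) x + (g2 x + g3 x)"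
      using g2(2) g3(2) by eventually_elim (simp only: joint_envelope_def envelope_def[of _ _ _ "f t"] envelope_def[of _ _ _ "\<lambda>w x. f t w x * ln \<bar>f t w x\<bar>"])
  qed
  also have "\<dots> \<le> (\<integral>\<^sup>+x. envelope \<alpha> u \<epsilon> (\<lambda>w x. deriv (\<lambda>v. f t v x) w) x \<partial>m) + (\<integral>\<^sup>+x. g2 x + g3 x \<partial>m)"
    by (rule nn_integral_add_le) simp
  also have "(\<integral>\<^sup>+x. g2 x + g3 x \<partial>m) = (\<integral>\<^sup>+x. g2 x \<partial>m) + (\<integral>\<^sup>+x. g3 x \<partial>m)"
    by (rule nn_integral_add) simp_all
  finally show ?thesis by (simp only: i2 i3)
qed

text \<open>
  A single radius \<open>\<epsilon>\<close> serves the differentiability and all integrability conditions. The bound for the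
  increment is stated with any \<open>D \<ge> \<bar>v - u\<bar>\<close> that is positive, so that \<open>v = u\<close> needs no special treatment.
\<close>

lemma local_tail_bounds:
  assumes \<alpha>C1: "\<alpha> C1_differentiable_on UNIV"
    and Cs1: "\<exists>\<delta>>0. \<forall>t\<in>ball u \<delta>. AE x in m. \<forall>v\<in>ball u \<delta>. (\<lambda>v. f t v x) differentiable (at v)"
    and Cs2: "locally_sup_integrable m \<alpha> u f"
    and Cs3: "locally_sup_integrable m \<alpha> u (\<lambda>t w x. deriv (\<lambda>v. f t v x) w)"
    and Cs4: "locally_sup_integrable m \<alpha> u (\<lambda>t w x. f t w x * ln \<bar>f t w x\<bar>)"
  obtains \<epsilon> C K p q where "0 < \<epsilon>" "0 \<le> C" "0 < K" "1/2 < p" "1/2 < q"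
    "\<And>t v l D. t \<in> ball u \<epsilon> \<Longrightarrow> v \<in> ball u \<epsilon> \<Longrightarrow> 0 < l \<Longrightarrow> \<bar>v - u\<bar> \<le> D \<Longrightarrow> 0 < D \<Longrightarrow>
       prob {\<omega> \<in> space M. l < \<bar>S t v \<omega> - S t u \<omega>\<bar>} \<le> tail_const p q (K * D / l) * C"
    "\<And>t l. t \<in> ball u \<epsilon> \<Longrightarrow> 0 < l \<Longrightarrow>
       prob {\<omega> \<in> space M. l < \<bar>S t u \<omega>\<bar>} \<le> tail_const (1 / \<alpha> u) (1 / \<alpha> u) (1 / l) * C"
proof -
  obtain A' where A': "\<And>v. (\<alpha> has_vector_derivative A' v) (at v)" and A'c: "continuous_on UNIV A'"
    using \<alpha>C1 by (auto simp: C1_differentiable_on_def)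
  have A'r: "(\<alpha> has_real_derivative A' v) (at v)" for v
    using A' by (simp add: has_real_derivative_iff_has_vector_derivative)
  have \<alpha>c: "continuous_on UNIV \<alpha>"
    using A'r by (auto intro!: continuous_at_imp_continuous_on DERIV_isCont)
  have "bounded (A' ` cball u 1)"
    by (intro compact_imp_bounded compact_continuous_image continuous_on_subset[OF A'c]) auto
  then have "\<exists>K0. \<forall>v\<in>cball u 1. \<bar>A' v\<bar> \<le> K0" by (simp add: bounded_iff)
  then obtain K0 where K0: "\<And>v. v \<in> cball u 1 \<Longrightarrow> \<bar>A' v\<bar> \<le> K0" by blast
  have K0pos: "0 \<le> K0" using K0[of u] by simp
  obtain \<delta> where \<delta>: "0 < \<delta>" "\<And>t. t \<in> ball u \<delta> \<Longrightarrow> AE x in m. \<forall>v\<in>ball u \<delta>. (\<lambda>v. f t v x) differentiable (at v)"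
    using Cs1 by blast
  obtain e2 C2 where e2: "0 < e2" "C2 < \<infinity>"
    "\<And>\<epsilon> t. \<epsilon> \<le> e2 \<Longrightarrow> t \<in> ball u \<epsilon> \<Longrightarrow> (\<integral>\<^sup>+x. envelope \<alpha> u \<epsilon> (f t) x \<partial>m) \<le> C2"
    by (rule locally_sup_integrable_ball[OF Cs2], rule that)
  obtain e3 C3 where e3: "0 < e3" "C3 < \<infinity>"
    "\<And>\<epsilon> t. \<epsilon> \<le> e3 \<Longrightarrow> t \<in> ball u \<epsilon> \<Longrightarrow> (\<integral>\<^sup>+x. envelope \<alpha> u \<epsilon> (\<lambda>w x. deriv (\<lambda>v. f t v x) w) x \<partial>m) \<le> C3"
    by (rule locally_sup_integrable_ball[OF Cs3], rule that)
  obtain e4 C4 where e4: "0 < e4" "C4 < \<infinity>"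
    "\<And>\<epsilon> t. \<epsilon> \<le> e4 \<Longrightarrow> t \<in> ball u \<epsilon> \<Longrightarrow> (\<integral>\<^sup>+x. envelope \<alpha> u \<epsilon> (\<lambda>w x. f t w x * ln \<bar>f t w x\<bar>) x \<partial>m) \<le> C4"
    by (rule locally_sup_integrable_ball[OF Cs4], rule that)
  define \<epsilon> where "\<epsilon> = Min {1, \<delta>, e2, e3, e4}"
  have \<epsilon>: "0 < \<epsilon>" "\<epsilon> \<le> 1" "\<epsilon> \<le> \<delta>" "\<epsilon> \<le> e2" "\<epsilon> \<le> e3" "\<epsilon> \<le> e4"
    using \<delta>(1) e2(1) e3(1) e4(1) by (auto simp: \<epsilon>_def)
  have balls: "ball u \<epsilon> \<subseteq> ball u \<delta>" "ball u \<epsilon> \<subseteq> cball u 1" using \<epsilon> by auto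
  define C where "C = enn2real (C3 + (C2 + C4))"
  have diff: "AE x in m. \<forall>v\<in>ball u \<epsilon>. (\<lambda>v. f t v x) differentiable (at v)" if "t \<in> ball u \<epsilon>" for t
  proof -
    have "t \<in> ball u \<delta>" using that balls by blast
    from \<delta>(2)[OF this] show ?thesis by eventually_elim (use balls in blast)
  qed
  have W: "(\<integral>\<^sup>+x. joint_envelope u \<epsilon> t x \<partial>m) \<le> ennreal C" if t: "t \<in> ball u \<epsilon>" for t
  proof -
    have "(\<integral>\<^sup>+x. joint_envelope u \<epsilon> t x \<partial>m) \<le> C3 + (C2 + C4)"
      by (rule order_trans[OF nn_integral_joint_envelope_le[OF diff[OF t] \<alpha>c]])
        (intro add_mono e2(3) e3(3) e4(3) \<epsilon> t)
    also have "\<dots> = ennreal C" using e2(2) e3(2) e4(2) by (simp add: C_def)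
    finally show ?thesis .
  qed
  have cd': "0 < d" "c \<le> d" using \<alpha>_in[of u] cd by auto
  \<comment> \<open>Half of the gap between \<open>1/d\<close> and the critical exponent one half is spent on the logarithm.\<close>
  define \<eta> where "\<eta> = (1/d - 1/2) / 2"
  have "1/2 < 1/d" using cd cd' by (simp add: field_simps)
  moreover have "0 < (x - 1/2) / 2 \<and> (x - 1/2) / 2 < x \<and> 1/2 < x - (x - 1/2) / 2" if "1/2 < x" for x :: real
    using that by (simp add: field_simps)
  ultimately have \<eta>: "0 < \<eta>" "\<eta> < 1/d" "1/2 < 1/d - \<eta>" unfolding \<eta>_def by blast+
  have "1/d \<le> 1/c" using cd cd' by (simp add: frac_le)
  then have \<eta>': "1/2 < 1/c + \<eta>" using \<eta> by linarith
  define K where "K = 1 + K0 / c\<^sup>2 * d * (1 + 2 / (c * \<eta>))"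
  have K: "0 < K" unfolding K_def using K0pos cd cd' \<eta>
    by (intro add_pos_nonneg mult_nonneg_nonneg add_nonneg_nonneg divide_nonneg_nonneg) auto
  show ?thesis
  proof (rule that[OF \<epsilon>(1) _ K \<eta>(3) \<eta>'])
    show "0 \<le> C" by (simp add: C_def)
  next
    fix t v l D :: real
    assume t: "t \<in> ball u \<epsilon>" and v: "v \<in> ball u \<epsilon>" and l: "0 < l" and D: "\<bar>v - u\<bar> \<le> D" "0 < D"
    let ?g = "\<lambda>z. stable_kernel \<alpha> r f t v z - stable_kernel \<alpha> r f t u z"
    have "prob {\<omega> \<in> space M. l < \<bar>S t v \<omega> - S t u \<omega>\<bar>} =
        prob {\<omega> \<in> space M. l < \<bar>\<Sum>i. \<gamma> i \<omega> * ?g (\<Gamma> i \<omega>, V i \<omega>)\<bar>}"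
    proof (rule measure_eq_AE)
      note [measurable] = poisson_arrival_times_measurable[OF \<Gamma>] iid_with_law_measurable[OF V] iid_signs_measurable[OF signs]
      show "{\<omega> \<in> space M. l < \<bar>S t v \<omega> - S t u \<omega>\<bar>} \<in> events" by measurable
      show "{\<omega> \<in> space M. l < \<bar>\<Sum>i. \<gamma> i \<omega> * ?g (\<Gamma> i \<omega>, V i \<omega>)\<bar>} \<in> events" by measurable
      show "AE \<omega> in M. (\<omega> \<in> {\<omega> \<in> space M. l < \<bar>S t v \<omega> - S t u \<omega>\<bar>}) =
          (\<omega> \<in> {\<omega> \<in> space M. l < \<bar>\<Sum>i. \<gamma> i \<omega> * ?g (\<Gamma> i \<omega>, V i \<omega>)\<bar>})"
        using AE_S_diff[of t v u] by eventually_elim simp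
    qed
    also have "\<dots> \<le> tail_const (1/d - \<eta>) (1/c + \<eta>) (K * D / l) * C"
    proof (rule lepage_series_dominated(2)[OF _ \<eta>(3) \<eta>' _ l _ W[OF t]])
      show "?g \<in> borel_measurable (borel \<Otimes>\<^sub>M mhat)" by measurable
      show "0 < K * D" using K D by simp
      show "0 \<le> C" by (simp add: C_def)
      show "AE x in m. joint_envelope u \<epsilon> t x < \<top> \<longrightarrow> (\<forall>y>0. \<bar>?g (y, x)\<bar> \<le>
          K * D * ((enn2real (joint_envelope u \<epsilon> t x) / (y / r x)) powr (1/d - \<eta>) +
            (enn2real (joint_envelope u \<epsilon> t x) / (y / r x)) powr (1/c + \<eta>)))"
        using diff[OF t] AE_space
      proof (eventually_elim, intro impI allI)
        fix x :: 'e and y :: real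
        assume dx: "\<forall>v\<in>ball u \<epsilon>. (\<lambda>v. f t v x) differentiable at v" and x: "x \<in> space m"
          and fin: "joint_envelope u \<epsilon> t x < \<top>" and y: "0 < y"
        let ?w = "enn2real (joint_envelope u \<epsilon> t x)"
        let ?P = "(?w / (y / r x)) powr (1/d - \<eta>) + (?w / (y / r x)) powr (1/c + \<eta>)"
        have r: "0 < r x" using x by (rule r_pos)
        have "\<bar>(y / r x) powr (-1 / \<alpha> v) * f t v x - (y / r x) powr (-1 / \<alpha> u) * f t u x\<bar>
            \<le> (1 + K0 / c\<^sup>2 * d * (1 + 2 / (c * \<eta>))) * \<bar>v - u\<bar> * ?P"
        proof (rule power_kernel_increment_le[where A' = A' and F' = "\<lambda>w. deriv (\<lambda>v. f t v x) w" and \<epsilon> = \<epsilon>])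
          fix w assume w: "w \<in> ball u \<epsilon>"
          show "((\<lambda>v. f t v x) has_real_derivative deriv (\<lambda>v. f t v x) w) (at w)"
            using dx w by (simp add: DERIV_deriv_iff_real_differentiable)
          show "\<bar>A' w\<bar> \<le> K0" using w balls by (intro K0) auto
        qed (use A'r \<alpha>_in cd \<eta> le_joint_envelope[OF fin] y r v in auto)
        also have "\<dots> = K * \<bar>v - u\<bar> * ?P" by (simp only: K_def)
        also have "\<dots> \<le> K * D * ?P" using K D by (intro mult_right_mono mult_left_mono) auto
        finally show "\<bar>?g (y, x)\<bar> \<le> K * D * ?P" using y r by (simp add: stable_kernel_eq)
      qed
    qed
    finally show "prob {\<omega> \<in> space M. l < \<bar>S t v \<omega> - S t u \<omega>\<bar>} \<le> tail_const (1/d - \<eta>) (1/c + \<eta>) (K * D / l) * C" .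
  next
    fix t l :: real
    assume t: "t \<in> ball u \<epsilon>" and l: "0 < l"
    show "prob {\<omega> \<in> space M. l < \<bar>S t u \<omega>\<bar>} \<le> tail_const (1 / \<alpha> u) (1 / \<alpha> u) (1 / l) * C"
      unfolding S_def
    proof (rule lepage_series_dominated(2)[OF _ \<alpha>_half \<alpha>_half _ l _ W[OF t]])
      show "AE x in m. joint_envelope u \<epsilon> t x < \<top> \<longrightarrow> (\<forall>y>0. \<bar>stable_kernel \<alpha> r f t u (y, x)\<bar> \<le>
          1 * ((enn2real (joint_envelope u \<epsilon> t x) / (y / r x)) powr (1 / \<alpha> u) +
            (enn2real (joint_envelope u \<epsilon> t x) / (y / r x)) powr (1 / \<alpha> u)))"
        using AE_space
        by eventually_elim (intro impI allI stable_kernel_le le_joint_envelope(2); use \<epsilon>(1) in \<open>simp add: r_pos\<close>)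
    qed (auto simp: C_def)
  qed
qed

end

text \<open>
  With \<open>v = u + \<rho> * t\<close>, the increment splits into \<open>B v * (S v v - S v u)\<close> and \<open>(B v - B u) * S v u\<close>. Both are
  of order \<open>\<rho>\<close>, so the two tail bounds are used at a ratio of order \<open>\<rho> powr (1 - h)\<close>.
\<close>

lemma (in lepage_representation) diagonal_increment_negligible:
  fixes B :: "real \<Rightarrow> real" and u h t e :: real
  assumes B: "lipschitz_at B u" and h: "0 < h" "h < 1" and e: "0 < e"
    and \<alpha>C1: "\<alpha> C1_differentiable_on UNIV"
    and Cs1: "\<exists>\<delta>>0. \<forall>t\<in>ball u \<delta>. AE x in m. \<forall>v\<in>ball u \<delta>. (\<lambda>v. f t v x) differentiable (at v)"
    and Cs2: "locally_sup_integrable m \<alpha> u f"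
    and Cs3: "locally_sup_integrable m \<alpha> u (\<lambda>t w x. deriv (\<lambda>v. f t v x) w)"
    and Cs4: "locally_sup_integrable m \<alpha> u (\<lambda>t w x. f t w x * ln \<bar>f t w x\<bar>)"
  shows "((\<lambda>\<rho>. prob {\<omega> \<in> space M. e < \<bar>B (u + \<rho> * t) * S (u + \<rho> * t) (u + \<rho> * t) \<omega>
      - B u * S (u + \<rho> * t) u \<omega>\<bar> / \<rho> powr h}) \<longlongrightarrow> 0) (at_right 0)"
proof -
  obtain \<epsilon> C K p q where eps: "0 < \<epsilon>" and C: "0 \<le> C" and K: "0 < K" and pq: "1/2 < p" "1/2 < q"
    and diff_bound: "\<And>t v l D. t \<in> ball u \<epsilon> \<Longrightarrow> v \<in> ball u \<epsilon> \<Longrightarrow> 0 < l \<Longrightarrow> \<bar>v - u\<bar> \<le> D \<Longrightarrow> 0 < D \<Longrightarrow>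
       prob {\<omega> \<in> space M. l < \<bar>S t v \<omega> - S t u \<omega>\<bar>} \<le> tail_const p q (K * D / l) * C"
    and bound: "\<And>t l. t \<in> ball u \<epsilon> \<Longrightarrow> 0 < l \<Longrightarrow>
       prob {\<omega> \<in> space M. l < \<bar>S t u \<omega>\<bar>} \<le> tail_const (1 / \<alpha> u) (1 / \<alpha> u) (1 / l) * C"
    by (rule local_tail_bounds[OF \<alpha>C1 Cs1 Cs2 Cs3 Cs4], rule that)
  obtain L where L: "\<forall>\<^sub>F v in at u. \<bar>B v - B u\<bar> \<le> L * \<bar>v - u\<bar>" using B by (auto simp: lipschitz_at_def)
  define b0 where "b0 = \<bar>B u\<bar> + 1"
  have b0: "0 < b0" by (simp add: b0_def)
  \<comment> \<open>Adding one keeps the bound \<open>\<rho> * s\<close> on \<open>\<bar>v - u\<bar>\<close> positive when \<open>t = 0\<close>.\<close>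
  define s where "s = \<bar>t\<bar> + 1"
  have s: "0 < s" by (simp add: s_def)
  define L' where "L' = (\<bar>L\<bar> + 1) * s"
  have L': "0 < L'" using s by (simp add: L'_def)
  have lim: "((\<lambda>\<rho>. u + \<rho> * t) \<longlongrightarrow> u) (at_right 0)"
    by (rule tendsto_eq_intros refl tendsto_ident_at | simp)+
  have "\<forall>\<^sub>F v in nhds u. \<bar>B v - B u\<bar> \<le> L * \<bar>v - u\<bar>"
    using L unfolding eventually_at_filter by eventually_elim auto
  then have ev1: "\<forall>\<^sub>F \<rho> in at_right 0. \<bar>B (u + \<rho> * t) - B u\<bar> \<le> L * \<bar>(u + \<rho> * t) - u\<bar>"
    using lim by (rule eventually_compose_filterlim)
  have "\<forall>\<^sub>F v in at u. \<bar>B v\<bar> < b0"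
    by (rule order_tendstoD(2)[OF tendsto_rabs[OF lipschitz_at_tendsto[OF B]]]) (simp add: b0_def)
  then have "\<forall>\<^sub>F v in nhds u. \<bar>B v\<bar> < b0"
    unfolding eventually_at_filter by eventually_elim (auto simp: b0_def)
  then have ev2: "\<forall>\<^sub>F \<rho> in at_right 0. \<bar>B (u + \<rho> * t)\<bar> < b0"
    using lim by (rule eventually_compose_filterlim)
  have "\<forall>\<^sub>F v in nhds u. v \<in> ball u \<epsilon>" using eps by (intro eventually_nhds_in_open) auto
  then have ev3: "\<forall>\<^sub>F \<rho> in at_right 0. u + \<rho> * t \<in> ball u \<epsilon>"
    using lim by (rule eventually_compose_filterlim)
  have ev4: "\<forall>\<^sub>F \<rho> in at_right 0. 0 < (\<rho>::real)" by (simp add: eventually_at_right_less)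
  define c1 where "c1 = K * s * 2 * b0 / e"
  define c2 where "c2 = 2 * L' / e"
  define U where "U \<rho> = tail_const p q (c1 * \<rho> powr (1 - h)) * C
      + tail_const (1 / \<alpha> u) (1 / \<alpha> u) (c2 * \<rho> powr (1 - h)) * C" for \<rho>
  have le: "\<forall>\<^sub>F \<rho> in at_right 0. prob {\<omega> \<in> space M. e < \<bar>B (u + \<rho> * t) * S (u + \<rho> * t) (u + \<rho> * t) \<omega>
      - B u * S (u + \<rho> * t) u \<omega>\<bar> / \<rho> powr h} \<le> U \<rho>"
    using ev1 ev2 ev3 ev4
  proof eventually_elim
    case (elim \<rho>)
    define v where "v = u + \<rho> * t"
    have v: "v \<in> ball u \<epsilon>" "\<bar>B v\<bar> < b0" "\<bar>B v - B u\<bar> \<le> L * \<bar>v - u\<bar>" using elim by (auto simp: v_def)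
    have \<rho>h: "0 < \<rho> powr h" using elim by simp
    have \<rho>1: "\<rho> / \<rho> powr h = \<rho> powr (1 - h)" using elim by (simp add: powr_diff)
    have vu: "\<bar>v - u\<bar> \<le> \<rho> * s" using elim by (simp add: v_def s_def abs_mult algebra_simps)
    have \<rho>s: "0 < \<rho> * s" using elim s by simp
    have BL: "\<bar>B v - B u\<bar> \<le> L' * \<rho>"
    proof -
      have "L * \<bar>v - u\<bar> \<le> (\<bar>L\<bar> + 1) * (\<rho> * s)" using vu by (intro mult_mono) auto
      then show ?thesis using v(3) by (simp add: L'_def algebra_simps)
    qed
    \<comment> \<open>Each summand is allowed half of \<open>e * \<rho> powr h\<close>.\<close>
    define l1 where "l1 = e * \<rho> powr h / (2 * b0)"
    define l2 where "l2 = e * \<rho> powr h / (2 * (L' * \<rho>))"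
    have l: "0 < l1" "0 < l2" using e \<rho>h b0 L' elim by (auto simp: l1_def l2_def)
    have "{\<omega> \<in> space M. e < \<bar>B v * S v v \<omega> - B u * S v u \<omega>\<bar> / \<rho> powr h} \<subseteq>
        {\<omega> \<in> space M. l1 < \<bar>S v v \<omega> - S v u \<omega>\<bar>} \<union> {\<omega> \<in> space M. l2 < \<bar>S v u \<omega>\<bar>}"
    proof (rule subsetI, rule ccontr)
      fix \<omega> assume "\<omega> \<in> {\<omega> \<in> space M. e < \<bar>B v * S v v \<omega> - B u * S v u \<omega>\<bar> / \<rho> powr h}"
        and "\<omega> \<notin> {\<omega> \<in> space M. l1 < \<bar>S v v \<omega> - S v u \<omega>\<bar>} \<union> {\<omega> \<in> space M. l2 < \<bar>S v u \<omega>\<bar>}"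
      then have big: "e < \<bar>B v * S v v \<omega> - B u * S v u \<omega>\<bar> / \<rho> powr h"
        and small: "\<bar>S v v \<omega> - S v u \<omega>\<bar> \<le> l1" "\<bar>S v u \<omega>\<bar> \<le> l2" by auto
      have "\<bar>B v * S v v \<omega> - B u * S v u \<omega>\<bar> = \<bar>B v * (S v v \<omega> - S v u \<omega>) + (B v - B u) * S v u \<omega>\<bar>"
        by (simp add: algebra_simps)
      also have "\<dots> \<le> \<bar>B v\<bar> * \<bar>S v v \<omega> - S v u \<omega>\<bar> + \<bar>B v - B u\<bar> * \<bar>S v u \<omega>\<bar>"
        by (rule order_trans[OF abs_triangle_ineq]) (simp only: abs_mult order_refl)
      also have "\<dots> \<le> b0 * l1 + (L' * \<rho>) * l2"
        using v(2) BL small b0 L' elim by (intro add_mono mult_mono) auto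
      also have "\<dots> = e * \<rho> powr h" using b0 L' elim by (simp add: l1_def l2_def field_simps)
      finally show False using big \<rho>h by (simp add: field_simps)
    qed
    then have "prob {\<omega> \<in> space M. e < \<bar>B v * S v v \<omega> - B u * S v u \<omega>\<bar> / \<rho> powr h} \<le>
        prob ({\<omega> \<in> space M. l1 < \<bar>S v v \<omega> - S v u \<omega>\<bar>} \<union> {\<omega> \<in> space M. l2 < \<bar>S v u \<omega>\<bar>})"
      by (rule finite_measure_mono) measurable
    also have "\<dots> \<le> prob {\<omega> \<in> space M. l1 < \<bar>S v v \<omega> - S v u \<omega>\<bar>} + prob {\<omega> \<in> space M. l2 < \<bar>S v u \<omega>\<bar>}"
      by (rule measure_Un_le) measurable
    also have "\<dots> \<le> tail_const p q (K * (\<rho> * s) / l1) * C + tail_const (1 / \<alpha> u) (1 / \<alpha> u) (1 / l2) * C"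
      by (intro add_mono diff_bound bound v(1) l vu \<rho>s)
    also have "K * (\<rho> * s) / l1 = c1 * (\<rho> / \<rho> powr h)"
      using e b0 \<rho>h by (simp add: l1_def c1_def field_simps)
    also have "1 / l2 = c2 * (\<rho> / \<rho> powr h)"
      using e L' \<rho>h elim by (simp add: l2_def c2_def field_simps)
    finally show ?case unfolding \<rho>1 U_def v_def .
  qed
  have "((\<lambda>\<rho>::real. \<rho> powr (1 - h)) \<longlongrightarrow> 0) (at_right 0)"
    using h by (intro tendsto_zero_powrI[where b="1 - h"]) (auto intro: tendsto_ident_at simp: eventually_at_filter)
  then have "((\<lambda>\<rho>. c * \<rho> powr (1 - h)) \<longlongrightarrow> 0) (at_right 0)" for c
    by (rule tendsto_mult_right_zero)
  then have "(U \<longlongrightarrow> 0 * C + 0 * C) (at_right 0)"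
    unfolding U_def using pq \<alpha>_half by (intro tendsto_intros tail_const_tendsto_0) auto
  then have U: "(U \<longlongrightarrow> 0) (at_right 0)" by simp
  show ?thesis
    by (rule tendsto_sandwich[OF _ le tendsto_const U]) simp
qed

theorem theorem5:
  fixes m :: "'e measure" and r :: "'e \<Rightarrow> real"
    and \<alpha> b :: "real \<Rightarrow> real" and c d :: real
    and f :: "real \<Rightarrow> real \<Rightarrow> 'e \<Rightarrow> real"
    and M :: "'a measure" and \<Gamma> \<gamma> :: "nat \<Rightarrow> 'a \<Rightarrow> real" and V :: "nat \<Rightarrow> 'a \<Rightarrow> 'e"
    and u h :: real
    and N :: "'b measure" and X' :: "real \<Rightarrow> 'b \<Rightarrow> real"
  defines "mhat \<equiv> density m (\<lambda>x. ennreal (1 / r x))"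
    and "X \<equiv> series_field b \<alpha> r f \<gamma> \<Gamma> V"
  assumes "sigma_finite_measure m"
    and "r \<in> borel_measurable m" and "\<And>x. x \<in> space m \<Longrightarrow> 0 < r x"
    and "prob_space mhat"
    and "0 < c" and "d < 2" and "\<And>v. \<alpha> v \<in> {c..d}"
    and "\<alpha> C1_differentiable_on UNIV"
    and "b C1_differentiable_on UNIV"
    and "\<And>t v. f t v \<in> F_space (\<alpha> v) m"
    and "prob_space M"
    and "poisson_arrival_times M \<Gamma>"
    and "iid_with_law M mhat V"
    and "iid_signs M \<gamma>"
    and "independent_sequences M borel \<Gamma> mhat V borel \<gamma>"
    and "0 < h" and "h < 1"
    and "localisable_with M (\<lambda>t. X t u) u h N X'"
    and Cs1: "\<exists>\<delta>>0. \<forall>t\<in>ball u \<delta>. AE x in m. \<forall>v\<in>ball u \<delta>. (\<lambda>v. f t v x) differentiable (at v)"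
    and Cs2: "locally_sup_integrable m \<alpha> u f"
    and Cs3: "locally_sup_integrable m \<alpha> u (\<lambda>t w x. deriv (\<lambda>v. f t v x) w)"
    and Cs4: "locally_sup_integrable m \<alpha> u (\<lambda>t w x. f t w x * ln \<bar>f t w x\<bar>)"
    and Cs5: "locally_sup_integrable m \<alpha> u (\<lambda>t w x. f t w x * ln (r x))"
  shows "localisable_with M (\<lambda>t. X t t) u h N X'"
proof -
  interpret prob_space M by fact
  interpret lepage_representation M m r \<alpha> c d f \<Gamma> \<gamma> V mhat
    using assms by unfold_locales (simp_all add: mhat_def)
  define B where "B v = b v * C_const (\<alpha> v) powr (1 / \<alpha> v)" for v
  have X: "X t v \<omega> = B v * S t v \<omega>" for t v \<omega>
    by (simp add: X_def B_def series_field_eq)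
  have Xm: "X t v \<in> borel_measurable M" for t v
    using S_measurable[of t v] by (simp add: X[abs_def] cong: measurable_cong) 
  obtain \<alpha>' where "\<And>v. (\<alpha> has_vector_derivative \<alpha>' v) (at v)"
    using \<open>\<alpha> C1_differentiable_on UNIV\<close> by (auto simp: C1_differentiable_on_def)
  moreover obtain b' where "\<And>v. (b has_vector_derivative b' v) (at v)"
    using \<open>b C1_differentiable_on UNIV\<close> by (auto simp: C1_differentiable_on_def)
  ultimately have B: "lipschitz_at B u"
    unfolding B_def
    by (intro lipschitz_at_normalisation[OF \<alpha>_in cd])
      (simp_all add: has_real_derivative_iff_has_vector_derivative)
  note loc = \<open>localisable_with M (\<lambda>t. X t u) u h N X'\<close>[unfolded localisable_with_def]
  have "fdd_converges M (\<lambda>\<rho> t \<omega>. (X (u + \<rho> * t) (u + \<rho> * t) \<omega> - X u u \<omega>) / \<rho> powr h) N X' (at_right 0)"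
  proof (rule fdd_converges_perturb)
    show "real_process N X'" using loc by blast
    show "fdd_converges M (\<lambda>\<rho> t \<omega>. (X (u + \<rho> * t) u \<omega> - X u u \<omega>) / \<rho> powr h) N X' (at_right 0)"
      using loc by blast
    fix t e :: real assume e: "0 < e"
    have eq: "\<bar>(X (u + \<rho> * t) (u + \<rho> * t) \<omega> - X u u \<omega>) / \<rho> powr h - (X (u + \<rho> * t) u \<omega> - X u u \<omega>) / \<rho> powr h\<bar> =
        \<bar>B (u + \<rho> * t) * S (u + \<rho> * t) (u + \<rho> * t) \<omega> - B u * S (u + \<rho> * t) u \<omega>\<bar> / \<rho> powr h" for \<rho> \<omega>
      by (simp add: X diff_divide_distrib[symmetric])
    show "((\<lambda>\<rho>. prob {\<omega> \<in> space M. e < \<bar>(X (u + \<rho> * t) (u + \<rho> * t) \<omega> - X u u \<omega>) / \<rho> powr h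
        - (X (u + \<rho> * t) u \<omega> - X u u \<omega>) / \<rho> powr h\<bar>}) \<longlongrightarrow> 0) (at_right 0)"
      unfolding eq
      by (rule diagonal_increment_negligible[OF B \<open>0 < h\<close> \<open>h < 1\<close> e \<open>\<alpha> C1_differentiable_on UNIV\<close> Cs1 Cs2 Cs3 Cs4])
  qed (use Xm in measurable)
  then show ?thesis
    unfolding localisable_with_def real_process_def
    using loc Xm \<open>prob_space M\<close> by (auto simp: real_process_def)
qed

end
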